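(* Let $n\ge2$. There exists a strictly convex compact $C^2$ hypersurface $\Sigma\subset\mathbb{R}^n$ such that for every $\varepsilon>0$ and all sufficiently large $R>0$ (depending on $\varepsilon$) there exist $f\in L^2(\Sigma)$ and $w:\mathbb{R}^n\to[0,1]$ supported in $B_R$ with \[\int_{B_R}|\mathcal{E}_\Sigma f(x)|^2w(x)\,dx\ge R^{\frac{n-1}{n+1}-\varepsilon}\|f\|_{L^2(\Sigma)}^2\|\mathcal{M}w\|_{L^\infty(\mathbb{S}^{n-1})}.\]
   Context: $\mathcal{E}_\Sigma f(x)=\int_\Sigma f(\sigma)e^{2\pi ix\cdot\sigma}d\sigma(\sigma)$ with $d\sigma$ surface measure. For $\nu\in\mathbb{S}^{n-1}$, $\mathcal{M}w(\nu)=\sup_T\int_Tw$, over all infinite tubes $T$ of radius $1$ parallel to $\nu$. $B_R$ is the ball of radius $R$ centered at $0$. *)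

theory Defs
  imports "HOL-Analysis.Analysis"
begin

text \<open>s-dimensional Hausdorff measure (normalised so that it agrees with
  surface area on C1 hypersurfaces when s = n - 1).\<close>

definition hausdorff_approx :: "real \<Rightarrow> real \<Rightarrow> 'a::metric_space set \<Rightarrow> ennreal" where
  "hausdorff_approx s \<delta> A =
     (INF C \<in> {C :: nat \<Rightarrow> 'a set. A \<subseteq> (\<Union>i. C i) \<and> (\<forall>i. bounded (C i) \<and> diameter (C i) \<le> \<delta>)}.
        (\<Sum>i. ennreal (unit_ball_vol s * (diameter (C i) / 2) powr s)))"

definition hausdorff_outer :: "real \<Rightarrow> 'a::metric_space set \<Rightarrow> ennreal" where
  "hausdorff_outer s A = (SUP \<delta> \<in> {0<..}. hausdorff_approx s \<delta> A)"

definition surface_measure :: "'a::euclidean_space set \<Rightarrow> 'a measure" where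
  "surface_measure S =
     measure_of S (sets (restrict_space borel S)) (hausdorff_outer (real (DIM('a) - 1)))"

text \<open>Strictly convex compact C2 hypersurface: zero set of a C2 defining function rho
  (gradient g, Hessian H, continuous), with nonvanishing gradient on the surface, bounding the
  compact convex body rho le 0, and with positive definite second fundamental form.\<close>

definition strictly_convex_compact_C2_hypersurface :: "'a::euclidean_space set \<Rightarrow> bool" where
  "strictly_convex_compact_C2_hypersurface \<Sigma> \<longleftrightarrow>
     (\<exists>(\<rho>::'a \<Rightarrow> real) (g::'a \<Rightarrow> 'a) (H::'a \<Rightarrow> 'a \<Rightarrow> 'a).
        (\<forall>x. (\<rho> has_derivative (\<lambda>h. g x \<bullet> h)) (at x)) \<and>
        (\<forall>x. (g has_derivative H x) (at x)) \<and>
        (\<forall>v. continuous_on UNIV (\<lambda>x. H x v)) \<and>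
        \<Sigma> = {x. \<rho> x = 0} \<and> \<Sigma> \<noteq> {} \<and>
        compact {x. \<rho> x \<le> 0} \<and> convex {x. \<rho> x \<le> 0} \<and>
        (\<forall>x\<in>\<Sigma>. g x \<noteq> 0) \<and>
        (\<forall>x\<in>\<Sigma>. \<forall>v. v \<noteq> 0 \<and> g x \<bullet> v = 0 \<longrightarrow> H x v \<bullet> v > 0))"

definition extension_op :: "'a::euclidean_space set \<Rightarrow> ('a \<Rightarrow> complex) \<Rightarrow> 'a \<Rightarrow> complex" where
  "extension_op \<Sigma> f x = (LINT s|surface_measure \<Sigma>. f s * cis (2 * pi * (x \<bullet> s)))"

definition L2_on :: "'a measure \<Rightarrow> ('a \<Rightarrow> complex) \<Rightarrow> bool" where
  "L2_on M f \<longleftrightarrow> f \<in> borel_measurable M \<and> integrable M (\<lambda>s. (cmod (f s))\<^sup>2)"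

definition L2_norm_sq :: "'a measure \<Rightarrow> ('a \<Rightarrow> complex) \<Rightarrow> real" where
  "L2_norm_sq M f = (LINT s|M. (cmod (f s))\<^sup>2)"

definition tube :: "'a::euclidean_space \<Rightarrow> 'a \<Rightarrow> 'a set" where
  "tube a \<nu> = {x. norm ((x - a) - ((x - a) \<bullet> \<nu>) *\<^sub>R \<nu>) < 1}"

definition MT_max :: "('a::euclidean_space \<Rightarrow> real) \<Rightarrow> 'a \<Rightarrow> real" where
  "MT_max w \<nu> = (SUP a. (LINT x:tube a \<nu>|lborel. w x))"

text \<open>L-infinity norm of MT_max w over the unit sphere (sup; MT_max w is lower semicontinuous,
  so this equals the essential sup).\<close>

definition MT_norm :: "('a::euclidean_space \<Rightarrow> real) \<Rightarrow> real" where
  "MT_norm w = (SUP \<nu> \<in> sphere 0 1. MT_max w \<nu>)"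

end

theory Submission
  imports Defs "HOL-Probability.Probability" "HOL-Computational_Algebra.Primes" "HOL-Real_Asymp.Real_Asymp"
begin

text \<open>
  At scale \<open>R\<close> take \<open>m\<close> random vectors \<open>u\<^sub>j\<close> in the torus and the generalised arithmetic progression of
  all \<open>\<Sum>\<^sub>j a\<^sub>j u\<^sub>j\<close> modulo integer vectors, with \<open>0 \<le> a\<^sub>j < L\<close> and \<open>L\<^sup>m\<close> roughly \<open>R\<close>. It behaves like
  a random set of about \<open>R\<close> points, so (second moment method) about \<open>R powr ((n - 1) / (n + 1))\<close> caps of
  radius \<open>\<delta> = R powr (- 1 / (n + 1))\<close> and thickness \<open>\<delta>\<^sup>2\<close> of the unit sphere contain one of its points.
  Bumps of height \<open>\<delta>\<^sup>2\<close> and width \<open>\<delta>\<close>, which are bounded in \<open>C\<^sup>2\<close>, move the sphere onto these points;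
  the scales use disjoint parts of the sphere and summable bump sizes, so a single surface serves
  all of them.

  With \<open>f\<close> the indicator of the \<open>1/R\<close>-caps around the chosen points, all phases agree on the Bohr
  set \<open>X\<close> where every \<open>x \<bullet> u\<^sub>j\<close> and every coordinate of \<open>x\<close> is nearly an integer; \<open>w\<close> is the indicator
  of \<open>X\<close> in the ball. By pigeonhole \<open>X\<close> has density about \<open>1/R\<close>. A tube meets \<open>X\<close> in small measure:
  majorise \<open>X\<close> by a Fejer kernel, whose integral along a line in direction \<open>\<nu>\<close> counts the resonances
  \<open>\<nu> \<bullet> (\<Sum>\<^sub>j a\<^sub>j u\<^sub>j + b) = O(1/R)\<close>; a union bound over \<open>\<nu>\<close> and over tuples of vectors in echelon
  form shows that for typical \<open>u\<^sub>j\<close> these are few for all \<open>\<nu>\<close> at once. Up to factors \<open>R powr \<epsilon>\<close> the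
  ratio is then the number of caps.
\<close>


section \<open>Metric outer measures\<close>

definition positively_separated :: "'a::metric_space set \<Rightarrow> 'a set \<Rightarrow> bool" where
  "positively_separated A B \<longleftrightarrow> (\<exists>e>0. \<forall>x\<in>A. \<forall>y\<in>B. e \<le> dist x y)"

lemma positively_separatedI:
  assumes "0 < e" "\<And>x y. x \<in> A \<Longrightarrow> y \<in> B \<Longrightarrow> e \<le> dist x y"
  shows "positively_separated A B"
  using assms unfolding positively_separated_def by blast

lemma positively_separated_subset:
  assumes "positively_separated A B" "A_le \<subseteq> A" "B' \<subseteq> B"
  shows "positively_separated A_le B'"
  using assms unfolding positively_separated_def by (meson subsetD)

definition far_points :: "'a::metric_space set \<Rightarrow> 'a set \<Rightarrow> nat \<Rightarrow> 'a set" where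
  "far_points F A i = {x \<in> A. 1 / real (Suc i) \<le> infdist x F}"

lemma incseq_far_points: "incseq (far_points F A)"
proof (rule incseq_SucI, rule subsetI)
  fix i x assume "x \<in> far_points F A i"
  moreover have "1 / real (Suc (Suc i)) \<le> 1 / real (Suc i)" by (intro divide_left_mono) auto
  ultimately show "x \<in> far_points F A (Suc i)" by (simp add: far_points_def)
qed

lemma UN_far_points:
  assumes "closed F" "F \<noteq> {}"
  shows "(\<Union>i. far_points F A i) = A - F"
proof (intro equalityI subsetI)
  fix x assume "x \<in> (\<Union>i. far_points F A i)"
  then obtain i where i: "x \<in> A" "1 / real (Suc i) \<le> infdist x F" by (auto simp: far_points_def)
  then have "0 < infdist x F" by (intro less_le_trans[OF _ i(2)]) simp
  then show "x \<in> A - F" using i(1) by auto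
next
  fix x assume x: "x \<in> A - F"
  then have "0 < infdist x F"
    using in_closed_iff_infdist_zero[OF assms] infdist_nonneg[of x F] by (simp add: less_le)
  then obtain i where "1 / real (Suc i) < infdist x F" using nat_approx_posE by blast
  then show "x \<in> (\<Union>i. far_points F A i)" using x by (auto simp: far_points_def intro: less_imp_le)
qed

lemma far_points_separated_from_rest: "positively_separated (far_points F A i) (A - far_points F A (Suc i))"
proof (rule positively_separatedI)
  show "0 < 1 / real (Suc i) - 1 / real (Suc (Suc i))"
    by (simp only: diff_gt_0_iff_gt, intro divide_strict_left_mono) auto
  fix x y assume "x \<in> far_points F A i" "y \<in> A - far_points F A (Suc i)"
  then show "1 / real (Suc i) - 1 / real (Suc (Suc i)) \<le> dist x y"
    using infdist_triangle[of x F y] by (auto simp: far_points_def)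
qed

lemma far_points_separated: "positively_separated F (far_points F A i)"
proof (rule positively_separatedI[of "1 / real (Suc i)"])
  fix x y assume "x \<in> F" "y \<in> far_points F A i"
  then show "1 / real (Suc i) \<le> dist x y"
    using infdist_le[of x F y] by (auto simp: far_points_def dist_commute)
qed simp

lemma ennreal_suminf_tail_tendsto_0:
  fixes f :: "nat \<Rightarrow> ennreal"
  assumes fin: "(\<Sum>i. f i) \<noteq> top"
  shows "(\<lambda>m. \<Sum>i. f (i + m)) \<longlonglongrightarrow> 0"
proof -
  have f_eq: "f i = ennreal (enn2real (f i))" for i
    using ennreal_suminf_lessD[of f top i] fin by (simp add: less_top)
  have summable: "summable (\<lambda>i. enn2real (f i))"
    using fin f_eq by (intro summable_suminf_not_top) auto
  have "(\<lambda>m. ennreal (\<Sum>i. enn2real (f (i + m)))) \<longlonglongrightarrow> ennreal 0"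
    by (intro tendsto_ennrealI suminf_exist_split2 summable)
  moreover have "(\<Sum>i. f (i + m)) = ennreal (\<Sum>i. enn2real (f (i + m)))" for m
    by (subst f_eq, rule suminf_ennreal2[OF _ summable_ignore_initial_segment[OF summable]]) simp
  ultimately show ?thesis by simp
qed

locale metric_outer_measure =
  fixes \<mu> :: "'a::metric_space set \<Rightarrow> ennreal"
  assumes empty [simp]: "\<mu> {} = 0"
    and mono: "A \<subseteq> B \<Longrightarrow> \<mu> A \<le> \<mu> B"
    and countably_subadditive: "\<mu> (\<Union>i::nat. C i) \<le> (\<Sum>i. \<mu> (C i))"
    and separated_superadditive: "positively_separated A B \<Longrightarrow> \<mu> A + \<mu> B \<le> \<mu> (A \<union> B)"
begin

lemma subadditive: "\<mu> (A \<union> B) \<le> \<mu> A + \<mu> B"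
proof -
  have "\<mu> (\<Union>i. binaryset A B i) \<le> (\<Sum>i. \<mu> (binaryset A B i))"
    by (rule countably_subadditive)
  also have "\<dots> = \<mu> A + \<mu> B"
    by (intro suminf_binaryset_eq) simp
  finally show ?thesis by (simp add: UN_binaryset_eq)
qed

lemma finite_UN_less_top:
  assumes "finite I" "\<And>i. i \<in> I \<Longrightarrow> \<mu> (A i) < top"
  shows "\<mu> (\<Union>i\<in>I. A i) < top"
  using assms
proof (induction I rule: finite_induct)
  case (insert i I)
  have "\<mu> (\<Union>i\<in>insert i I. A i) \<le> \<mu> (A i) + \<mu> (\<Union>i\<in>I. A i)"
    using subadditive by simp
  also have "\<dots> < top" using insert by simp
  finally show ?case .
qed simp

lemma sum_alternate_differences_le:
  assumes G: "incseq G" and sep: "\<And>i. positively_separated (G i) ((\<Union>j. G j) - G (Suc i))"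
  shows "(\<Sum>i<m. \<mu> (G (Suc (2 * i + c)) - G (2 * i + c))) \<le> \<mu> (G (2 * m + c))"
proof -
  let ?D = "\<lambda>i. G (Suc (2 * i + c)) - G (2 * i + c)"
  have "(\<Sum>i<m. \<mu> (?D i)) \<le> \<mu> (\<Union>i<m. ?D i)"
  proof (induction m)
    case (Suc m)
    have "positively_separated (\<Union>i<m. ?D i) (?D m)"
    proof (cases m)
      case 0
      then show ?thesis by (auto intro: positively_separatedI[of 1])
    next
      case (Suc l)
      have "G (Suc (2 * i + c)) \<subseteq> G (Suc (2 * l + c))" if "i < m" for i
        using that Suc by (intro incseqD[OF G]) simp
      then have "(\<Union>i<m. ?D i) \<subseteq> G (Suc (2 * l + c))" by auto
      then show ?thesis
        by (rule positively_separated_subset[OF sep]) (use Suc in auto)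
    qed
    then have "\<mu> (\<Union>i<m. ?D i) + \<mu> (?D m) \<le> \<mu> ((\<Union>i<m. ?D i) \<union> ?D m)"
      by (rule separated_superadditive)
    with add_right_mono[OF Suc.IH, of "\<mu> (?D m)"]
    have "(\<Sum>i<m. \<mu> (?D i)) + \<mu> (?D m) \<le> \<mu> ((\<Union>i<m. ?D i) \<union> ?D m)" by (rule order_trans)
    then show ?case by (simp add: lessThan_Suc Un_commute add.commute)
  qed simp
  also have "\<dots> \<le> \<mu> (G (2 * m + c))"
  proof (intro mono UN_least)
    fix i assume "i \<in> {..<m}"
    then show "?D i \<subseteq> G (2 * m + c)"
      using incseqD[OF G, of "Suc (2 * i + c)" "2 * m + c"] by auto
  qed
  finally show ?thesis .
qed

text \<open>Consecutive differences of the same parity are positively separated, so their measures add up.\<close>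

lemma suminf_differences_le:
  assumes G: "incseq G" and sep: "\<And>i. positively_separated (G i) ((\<Union>j. G j) - G (Suc i))"
  shows "(\<Sum>i. \<mu> (G (Suc i) - G i)) \<le> 2 * (SUP i. \<mu> (G i))"
  unfolding suminf_eq_SUP
proof (rule SUP_least)
  fix m
  define D where "D i = G (Suc i) - G i" for i
  have alternate: "(\<Sum>i<m. \<mu> (D (2 * i + c))) \<le> (SUP i. \<mu> (G i))" for c
  proof -
    have "(\<Sum>i<m. \<mu> (D (2 * i + c))) \<le> \<mu> (G (2 * m + c))"
      unfolding D_def by (rule sum_alternate_differences_le[OF G sep])
    also have "\<dots> \<le> (SUP i. \<mu> (G i))" by (rule SUP_upper) simp
    finally show ?thesis .
  qed
  have "(\<Sum>i<m. \<mu> (D i)) \<le> (\<Sum>i<2*m. \<mu> (D i))" by (intro sum_mono2) auto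
  also have "\<dots> = (\<Sum>i<m. \<mu> (D (2 * i + 0))) + (\<Sum>i<m. \<mu> (D (2 * i + 1)))"
    by (induction m) (simp_all add: algebra_simps)
  also have "\<dots> \<le> (SUP i. \<mu> (G i)) + (SUP i. \<mu> (G i))" by (intro add_mono alternate)
  finally show "(\<Sum>i<m. \<mu> (G (Suc i) - G i)) \<le> 2 * (SUP i. \<mu> (G i))" by (simp add: D_def mult_2)
qed

lemma UN_le_SUP_separated:
  assumes G: "incseq G" and sep: "\<And>i. positively_separated (G i) ((\<Union>j. G j) - G (Suc i))"
  shows "\<mu> (\<Union>i. G i) \<le> (SUP i. \<mu> (G i))"
proof (cases "(SUP i. \<mu> (G i)) = top")
  case True
  then show ?thesis by (simp only: top_greatest)
next
  case False
  define D where "D i = G (Suc i) - G i" for i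
  have "(\<Sum>i. \<mu> (D i)) \<le> 2 * (SUP i. \<mu> (G i))"
    unfolding D_def by (rule suminf_differences_le[OF G sep])
  also have "\<dots> < top" using False by (metis ennreal_mult_less_top ennreal_numeral_less_top less_top)
  finally have tail: "(\<lambda>m. \<Sum>i. \<mu> (D (i + m))) \<longlonglongrightarrow> 0"
    by (intro ennreal_suminf_tail_tendsto_0) simp
  have "\<mu> (\<Union>i. G i) \<le> (SUP i. \<mu> (G i)) + (\<Sum>i. \<mu> (D (i + m)))" for m
  proof -
    have "(\<Union>i. G i) \<subseteq> G m \<union> (\<Union>i. D (i + m))"
    proof (rule ccontr)
      assume "\<not> ?thesis"
      then obtain x j where x: "x \<in> G j" "x \<notin> G m" "\<And>i. x \<notin> D (i + m)" by blast
      have "x \<notin> G (i + m)" for i by (induction i) (use x in \<open>auto simp: D_def\<close>)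
      with incseqD[OF G, of j "j + m"] x(1) show False by auto
    qed
    then have "\<mu> (\<Union>i. G i) \<le> \<mu> (G m \<union> (\<Union>i. D (i + m)))" by (rule mono)
    also have "\<dots> \<le> \<mu> (G m) + \<mu> (\<Union>i. D (i + m))" by (rule subadditive)
    also have "\<dots> \<le> (SUP i. \<mu> (G i)) + (\<Sum>i. \<mu> (D (i + m)))"
      by (intro add_mono SUP_upper countably_subadditive) simp
    finally show ?thesis .
  qed
  moreover have "(\<lambda>m. (SUP i. \<mu> (G i)) + (\<Sum>i. \<mu> (D (i + m)))) \<longlonglongrightarrow> (SUP i. \<mu> (G i)) + 0"
    by (intro tendsto_add tendsto_const tail)
  ultimately show ?thesis
    by (intro LIMSEQ_le_const[where X = "\<lambda>m. (SUP i. \<mu> (G i)) + (\<Sum>i. \<mu> (D (i + m)))"]) auto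
qed

lemma closed_split_le:
  assumes F: "closed F"
  shows "\<mu> (A \<inter> F) + \<mu> (A - F) \<le> \<mu> A"
proof (cases "F = {}")
  case False
  let ?G = "far_points F A"
  have "positively_separated (?G i) ((\<Union>j. ?G j) - ?G (Suc i))" for i
    unfolding UN_far_points[OF F False]
    by (rule positively_separated_subset[OF far_points_separated_from_rest]) auto
  from UN_le_SUP_separated[OF incseq_far_points this]
  have "\<mu> (A \<inter> F) + \<mu> (A - F) \<le> (SUP i. \<mu> (A \<inter> F) + \<mu> (?G i))"
    unfolding UN_far_points[OF F False]
    by (subst ennreal_SUP_add_right[symmetric]) (auto intro: add_left_mono)
  also have "\<dots> \<le> \<mu> A"
  proof (rule SUP_least)
    fix i
    have "\<mu> (A \<inter> F) + \<mu> (?G i) \<le> \<mu> (A \<inter> F \<union> ?G i)"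
      by (intro separated_superadditive positively_separated_subset[OF far_points_separated[of F A i]]) auto
    also have "\<dots> \<le> \<mu> A" by (intro mono) (auto simp: far_points_def)
    finally show "\<mu> (A \<inter> F) + \<mu> (?G i) \<le> \<mu> A" .
  qed
  finally show ?thesis .
qed simp

lemma closed_in_lambda_system:
  assumes "closed F"
  shows "S \<inter> F \<in> lambda_system S (Pow S) \<mu>"
proof -
  interpret P: sigma_algebra S "Pow S" by (rule sigma_algebra_Pow)
  have "\<mu> (A \<inter> (S \<inter> F)) + \<mu> (A - (S \<inter> F)) = \<mu> A" if "A \<subseteq> S" for A
  proof (rule antisym)
    have "A \<inter> (S \<inter> F) = A \<inter> F" "A - (S \<inter> F) = A - F" using that by auto
    then show "\<mu> (A \<inter> (S \<inter> F)) + \<mu> (A - (S \<inter> F)) \<le> \<mu> A"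
      using closed_split_le[OF assms] by simp
    show "\<mu> A \<le> \<mu> (A \<inter> (S \<inter> F)) + \<mu> (A - (S \<inter> F))"
      using subadditive[of "A \<inter> (S \<inter> F)" "A - (S \<inter> F)"] by (simp add: Int_Diff_Un)
  qed
  then show ?thesis unfolding P.lambda_system_eq by auto
qed

lemma measure_space_lambda_system: "measure_space S (lambda_system S (Pow S) \<mu>) \<mu>"
proof -
  interpret P: sigma_algebra S "Pow S" by (rule sigma_algebra_Pow)
  have "outer_measure_space (Pow S) \<mu>"
    unfolding outer_measure_space_def positive_def increasing_def countably_subadditive_def
    by (auto intro: mono countably_subadditive)
  then show ?thesis by (rule P.caratheodory_lemma)
qed

lemma borel_in_lambda_system:
  assumes "B \<in> sets borel"
  shows "S \<inter> B \<in> lambda_system S (Pow S) \<mu>"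
proof -
  interpret L: sigma_algebra S "lambda_system S (Pow S) \<mu>"
    using measure_space_lambda_system by (simp add: measure_space_def)
  have "B \<in> sigma_sets UNIV {F::'a set. closed F}"
    using assms by (simp add: borel_eq_closed)
  then show ?thesis
  proof (induction B rule: sigma_sets.induct)
    case (Basic F)
    then show ?case by (intro closed_in_lambda_system) simp
  next
    case Empty
    then show ?case using L.empty_sets by simp
  next
    case (Compl B)
    have "S \<inter> (UNIV - B) = S - (S \<inter> B)" by auto
    then show ?case using L.compl_sets[OF Compl.IH] by simp
  next
    case (Union B)
    have "S \<inter> (\<Union>i. B i) = (\<Union>i. S \<inter> B i)" by auto
    then show ?case using L.countable_UN[of "\<lambda>i. S \<inter> B i" UNIV] Union.IH by auto
  qed
qed

theorem measure_space_borel: "measure_space S (sets (restrict_space borel S)) \<mu>"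
proof -
  have "sets (restrict_space borel S) \<subseteq> lambda_system S (Pow S) \<mu>"
    using borel_in_lambda_system by (auto simp: sets_restrict_space)
  then have "countably_additive (sets (restrict_space borel S)) \<mu>"
    using measure_space_lambda_system unfolding measure_space_def countably_additive_def by blast
  moreover have "sigma_algebra S (sets (restrict_space borel S))"
    using sets.sigma_algebra_axioms[of "restrict_space borel S"] by (simp add: space_restrict_space)
  ultimately show ?thesis unfolding measure_space_def positive_def by simp
qed

end

section \<open>Hausdorff measure\<close>

definition diameter_content :: "real \<Rightarrow> 'a::metric_space set \<Rightarrow> ennreal" where
  "diameter_content s X = ennreal (unit_ball_vol s * (diameter X / 2) powr s)"

lemma diameter_content_empty [simp]: "diameter_content s {} = 0"
  by (simp add: diameter_content_def)

definition delta_covers :: "real \<Rightarrow> 'a::metric_space set \<Rightarrow> (nat \<Rightarrow> 'a set) set" where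
  "delta_covers \<delta> A = {C. A \<subseteq> (\<Union>i. C i) \<and> (\<forall>i. bounded (C i) \<and> diameter (C i) \<le> \<delta>)}"

lemma delta_coversI:
  assumes "\<And>x. x \<in> A \<Longrightarrow> \<exists>i. x \<in> C i" "\<And>i. bounded (C i)" "\<And>i. diameter (C i) \<le> \<delta>"
  shows "C \<in> delta_covers \<delta> A"
  using assms unfolding delta_covers_def by blast

lemma delta_coversD:
  assumes "C \<in> delta_covers \<delta> A"
  shows "x \<in> A \<Longrightarrow> \<exists>i. x \<in> C i" "bounded (C i)" "diameter (C i) \<le> \<delta>"
  using assms unfolding delta_covers_def by blast+

lemma hausdorff_approx_eq_INF:
  "hausdorff_approx s \<delta> A = (INF C\<in>delta_covers \<delta> A. \<Sum>i. diameter_content s (C i))"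
  unfolding hausdorff_approx_def delta_covers_def diameter_content_def ..

lemma hausdorff_approx_le:
  "C \<in> delta_covers \<delta> A \<Longrightarrow> hausdorff_approx s \<delta> A \<le> (\<Sum>i. diameter_content s (C i))"
  unfolding hausdorff_approx_eq_INF by (rule INF_lower)

lemma hausdorff_approx_geI:
  "(\<And>C. C \<in> delta_covers \<delta> A \<Longrightarrow> c \<le> (\<Sum>i. diameter_content s (C i))) \<Longrightarrow> c \<le> hausdorff_approx s \<delta> A"
  unfolding hausdorff_approx_eq_INF by (rule INF_greatest)

lemma hausdorff_approx_antimono: "\<delta> \<le> \<delta>' \<Longrightarrow> hausdorff_approx s \<delta>' A \<le> hausdorff_approx s \<delta> A"
  unfolding hausdorff_approx_eq_INF delta_covers_def
  by (intro INF_superset_mono) (auto intro: order_trans)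

lemma hausdorff_approx_mono: "A \<subseteq> B \<Longrightarrow> hausdorff_approx s \<delta> A \<le> hausdorff_approx s \<delta> B"
  unfolding hausdorff_approx_eq_INF delta_covers_def by (intro INF_superset_mono) auto

lemma hausdorff_approx_le_outer: "0 < \<delta> \<Longrightarrow> hausdorff_approx s \<delta> A \<le> hausdorff_outer s A"
  unfolding hausdorff_outer_def by (intro SUP_upper) auto

lemma hausdorff_outer_leI:
  "(\<And>\<delta>. 0 < \<delta> \<Longrightarrow> hausdorff_approx s \<delta> A \<le> c) \<Longrightarrow> hausdorff_outer s A \<le> c"
  unfolding hausdorff_outer_def by (intro SUP_least) auto

lemma exists_delta_cover_le:
  assumes fin: "hausdorff_approx s \<delta> A < top" and e: "0 < e"
  shows "\<exists>C\<in>delta_covers \<delta> A. (\<Sum>i. diameter_content s (C i)) \<le> hausdorff_approx s \<delta> A + ennreal e"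
proof -
  have "hausdorff_approx s \<delta> A + 0 < hausdorff_approx s \<delta> A + ennreal e"
    using fin e by (subst ennreal_add_left_cancel_less) auto
  then show ?thesis
    unfolding hausdorff_approx_eq_INF by (auto simp: INF_less_iff intro: less_imp_le)
qed

lemma hausdorff_approx_countably_subadditive:
  fixes A :: "nat \<Rightarrow> 'a::metric_space set"
  shows "hausdorff_approx s \<delta> (\<Union>i. A i) \<le> (\<Sum>i. hausdorff_approx s \<delta> (A i))"
proof (rule ennreal_le_epsilon)
  fix e :: real assume e: "0 < e" and fin: "(\<Sum>i. hausdorff_approx s \<delta> (A i)) < top"
  have "hausdorff_approx s \<delta> (A i) < top" for i
    using fin ennreal_suminf_lessD[of "\<lambda>i. hausdorff_approx s \<delta> (A i)" top i] by simp
  then have "\<exists>C\<in>delta_covers \<delta> (A i).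
      (\<Sum>j. diameter_content s (C j)) \<le> hausdorff_approx s \<delta> (A i) + ennreal (e * (1/2)^Suc i)" for i
    using e by (intro exists_delta_cover_le) auto
  then obtain C where C: "\<And>i. C i \<in> delta_covers \<delta> (A i)"
    and content: "\<And>i. (\<Sum>j. diameter_content s (C i j))
      \<le> hausdorff_approx s \<delta> (A i) + ennreal (e * (1/2)^Suc i)"
    by metis
  define D where "D = (\<lambda>l. case prod_decode l of (i, j) \<Rightarrow> C i j)"
  have "D \<in> delta_covers \<delta> (\<Union>i. A i)"
  proof (rule delta_coversI)
    fix x assume "x \<in> (\<Union>i. A i)"
    then obtain i j where "x \<in> C i j" using delta_coversD(1)[OF C] by blast
    then have "x \<in> D (prod_encode (i, j))" by (simp add: D_def)
    then show "\<exists>l. x \<in> D l" by blast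
  qed (auto simp: D_def delta_coversD(2,3)[OF C] split: prod.splits)
  then have "hausdorff_approx s \<delta> (\<Union>i. A i) \<le> (\<Sum>l. diameter_content s (D l))"
    by (rule hausdorff_approx_le)
  also have "\<dots> = (\<Sum>i. \<Sum>j. diameter_content s (C i j))"
    using suminf_ennreal_2dimen[of "\<lambda>i. \<Sum>j. diameter_content s (C i j)"
        "\<lambda>(i, j). diameter_content s (C i j)"]
    by (simp add: D_def case_prod_beta)
  also have "\<dots> \<le> (\<Sum>i. hausdorff_approx s \<delta> (A i) + ennreal (e * (1/2)^Suc i))"
    by (intro suminf_le content) auto
  also have "\<dots> = (\<Sum>i. hausdorff_approx s \<delta> (A i)) + (\<Sum>i. ennreal (e * (1/2)^Suc i))"
    by (intro suminf_add[symmetric]) auto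
  also have "(\<Sum>i. ennreal (e * (1/2)^Suc i)) = ennreal e"
    using sums_mult[OF power_half_series, of e] e by (intro suminf_ennreal_eq) auto
  finally show "hausdorff_approx s \<delta> (\<Union>i. A i) \<le> (\<Sum>i. hausdorff_approx s \<delta> (A i)) + ennreal e" .
qed

text \<open>A set of diameter below the distance of A and B meets at most one of them, so a fine cover
  of the union splits.\<close>

lemma hausdorff_approx_separated_superadditive:
  assumes "\<delta> < e" and sep: "\<And>x y. x \<in> A \<Longrightarrow> y \<in> B \<Longrightarrow> e \<le> dist x y"
  shows "hausdorff_approx s \<delta> A + hausdorff_approx s \<delta> B \<le> hausdorff_approx s \<delta> (A \<union> B)"
proof (rule hausdorff_approx_geI)
  fix C assume C: "C \<in> delta_covers \<delta> (A \<union> B)"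
  have \<delta>_nonneg: "0 \<le> \<delta>"
    using diameter_ge_0[OF delta_coversD(2)[OF C]] delta_coversD(3)[OF C] order_trans by blast
  define C\<^sub>A where "C\<^sub>A = (\<lambda>i. if C i \<inter> A = {} then {} else C i)"
  define C\<^sub>B where "C\<^sub>B = (\<lambda>i. if C i \<inter> A = {} then C i else {})"
  have "C\<^sub>A \<in> delta_covers \<delta> A"
  proof (rule delta_coversI)
    fix x assume x: "x \<in> A"
    then obtain i where "x \<in> C i" using delta_coversD(1)[OF C] by blast
    with x have "x \<in> C\<^sub>A i" by (auto simp: C\<^sub>A_def)
    then show "\<exists>i. x \<in> C\<^sub>A i" ..
  qed (use delta_coversD(2,3)[OF C] \<delta>_nonneg in \<open>auto simp: C\<^sub>A_def\<close>)
  moreover have "C\<^sub>B \<in> delta_covers \<delta> B"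
  proof (rule delta_coversI)
    fix y assume y: "y \<in> B"
    then obtain i where i: "y \<in> C i" using delta_coversD(1)[OF C] by blast
    have "x \<notin> A" if "x \<in> C i" for x
    proof
      assume "x \<in> A"
      have "dist x y \<le> \<delta>"
        using diameter_bounded_bound[OF delta_coversD(2)[OF C] that i] delta_coversD(3)[OF C, of i]
        by simp
      with sep[OF \<open>x \<in> A\<close> y] \<open>\<delta> < e\<close> show False by simp
    qed
    with i have "y \<in> C\<^sub>B i" by (auto simp: C\<^sub>B_def)
    then show "\<exists>i. y \<in> C\<^sub>B i" ..
  qed (use delta_coversD(2,3)[OF C] \<delta>_nonneg in \<open>auto simp: C\<^sub>B_def\<close>)
  ultimately have "hausdorff_approx s \<delta> A + hausdorff_approx s \<delta> B
      \<le> (\<Sum>i. diameter_content s (C\<^sub>A i)) + (\<Sum>i. diameter_content s (C\<^sub>B i))"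
    by (intro add_mono hausdorff_approx_le)
  also have "\<dots> = (\<Sum>i. diameter_content s (C\<^sub>A i) + diameter_content s (C\<^sub>B i))"
    by (intro suminf_add) auto
  also have "\<dots> = (\<Sum>i. diameter_content s (C i))"
    by (intro suminf_cong) (auto simp: C\<^sub>A_def C\<^sub>B_def)
  finally show "hausdorff_approx s \<delta> A + hausdorff_approx s \<delta> B \<le> (\<Sum>i. diameter_content s (C i))" .
qed

lemma hausdorff_outer_separated_superadditive:
  assumes "positively_separated A B"
  shows "hausdorff_outer s A + hausdorff_outer s B \<le> hausdorff_outer s (A \<union> B)"
proof -
  obtain e where e: "0 < e" "\<And>x y. x \<in> A \<Longrightarrow> y \<in> B \<Longrightarrow> e \<le> dist x y"
    using assms unfolding positively_separated_def by blast
  have "hausdorff_outer s A + hausdorff_outer s B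
      = (SUP \<delta>\<in>{0<..}. hausdorff_approx s \<delta> A + hausdorff_approx s \<delta> B)"
    unfolding hausdorff_outer_def
  proof (rule SUP_add_directed_ennreal[symmetric])
    fix \<delta> \<delta>' :: real assume "\<delta> \<in> {0<..}" "\<delta>' \<in> {0<..}"
    then show "\<exists>d\<in>{0<..}. hausdorff_approx s \<delta> A + hausdorff_approx s \<delta>' B
        \<le> hausdorff_approx s d A + hausdorff_approx s d B"
      by (intro bexI[of _ "min \<delta> \<delta>'"] add_mono hausdorff_approx_antimono) auto
  qed
  also have "\<dots> \<le> hausdorff_outer s (A \<union> B)"
  proof (rule SUP_least)
    fix \<delta> :: real assume \<delta>: "\<delta> \<in> {0<..}"
    define d where "d = min \<delta> (e / 2)"
    have "0 < d" "d < e" "d \<le> \<delta>" using \<delta> e(1) by (auto simp: d_def)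
    have "hausdorff_approx s \<delta> A + hausdorff_approx s \<delta> B \<le> hausdorff_approx s d A + hausdorff_approx s d B"
      by (intro add_mono hausdorff_approx_antimono \<open>d \<le> \<delta>\<close>)
    also have "\<dots> \<le> hausdorff_approx s d (A \<union> B)"
      using \<open>d < e\<close> e(2) by (rule hausdorff_approx_separated_superadditive)
    also have "\<dots> \<le> hausdorff_outer s (A \<union> B)" by (rule hausdorff_approx_le_outer[OF \<open>0 < d\<close>])
    finally show "hausdorff_approx s \<delta> A + hausdorff_approx s \<delta> B \<le> hausdorff_outer s (A \<union> B)" .
  qed
  finally show ?thesis .
qed

interpretation hausdorff_outer: metric_outer_measure "hausdorff_outer s"
proof
  have "hausdorff_approx s \<delta> ({} :: 'a set) \<le> (\<Sum>i::nat. diameter_content s ({} :: 'a set))" if "0 < \<delta>" for \<delta>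
    by (rule hausdorff_approx_le[of "\<lambda>_. {}"]) (use that in \<open>auto simp: delta_covers_def\<close>)
  then have "hausdorff_outer s ({} :: 'a set) \<le> 0" by (intro hausdorff_outer_leI) simp
  then show "hausdorff_outer s ({} :: 'a set) = 0" by simp
next
  fix A B :: "'a set"
  show "hausdorff_outer s A \<le> hausdorff_outer s B" if "A \<subseteq> B"
    by (intro hausdorff_outer_leI order_trans[OF hausdorff_approx_mono[OF that] hausdorff_approx_le_outer])
  show "hausdorff_outer s A + hausdorff_outer s B \<le> hausdorff_outer s (A \<union> B)"
    if "positively_separated A B"
    using that by (rule hausdorff_outer_separated_superadditive)
next
  fix C :: "nat \<Rightarrow> 'a set"
  show "hausdorff_outer s (\<Union>i. C i) \<le> (\<Sum>i. hausdorff_outer s (C i))"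
  proof (rule hausdorff_outer_leI)
    fix \<delta> :: real assume "0 < \<delta>"
    have "hausdorff_approx s \<delta> (\<Union>i. C i) \<le> (\<Sum>i. hausdorff_approx s \<delta> (C i))"
      by (rule hausdorff_approx_countably_subadditive)
    also have "\<dots> \<le> (\<Sum>i. hausdorff_outer s (C i))"
      by (intro suminf_le hausdorff_approx_le_outer \<open>0 < \<delta>\<close>) auto
    finally show "hausdorff_approx s \<delta> (\<Union>i. C i) \<le> (\<Sum>i. hausdorff_outer s (C i))" .
  qed
qed

lemma sets_surface_measure: "sets (surface_measure S) = sets (restrict_space borel S)"
proof -
  have "sigma_sets S (sets (restrict_space borel S)) = sets (restrict_space borel S)"
    using sets.sigma_sets_eq[of "restrict_space borel S"] by (simp add: space_restrict_space)
  moreover have "sets (restrict_space borel S) \<subseteq> Pow S"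
    using sets.space_closed[of "restrict_space borel S"] by (simp add: space_restrict_space)
  ultimately show ?thesis unfolding surface_measure_def by (simp add: sets_measure_of)
qed

lemma space_surface_measure: "space (surface_measure S) = S"
  using sets_eq_imp_space_eq[OF sets_surface_measure, of S] by (simp add: space_restrict_space)

lemma emeasure_surface_measure:
  fixes S :: "'a::euclidean_space set"
  assumes "A \<in> sets (restrict_space borel S)"
  shows "emeasure (surface_measure S) A = hausdorff_outer (real (DIM('a) - 1)) A"
  unfolding surface_measure_def
proof (rule emeasure_measure_of_sigma)
  show "sigma_algebra S (sets (restrict_space borel S))"
    "positive (sets (restrict_space borel S)) (hausdorff_outer (real (DIM('a) - 1)))"
    "countably_additive (sets (restrict_space borel S)) (hausdorff_outer (real (DIM('a) - 1)))"
    using hausdorff_outer.measure_space_borel[of S] by (auto simp: measure_space_def)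
qed (fact assms)

section \<open>Lower and upper bounds for the Hausdorff measure of hypersurfaces\<close>

definition axis_cylinder :: "'a::euclidean_space \<Rightarrow> 'a \<Rightarrow> real \<Rightarrow> real \<Rightarrow> 'a set" where
  "axis_cylinder e p h r = {x. \<bar>(x - p) \<bullet> e\<bar> \<le> r \<and> (\<forall>b\<in>Basis - {e}. \<bar>(x - p) \<bullet> b\<bar> \<le> h)}"

lemma axis_cylinder_eq_cbox:
  assumes "e \<in> Basis"
  defines "w \<equiv> \<lambda>h r. \<Sum>b\<in>Basis. (if b = e then r else h) *\<^sub>R b"
  shows "axis_cylinder e p h r = cbox (p - w h r) (p + w h r)"
proof -
  have "(x \<in> axis_cylinder e p h r) = (\<forall>b\<in>Basis. \<bar>(x - p) \<bullet> b\<bar> \<le> w h r \<bullet> b)" for x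
    using assms(1) by (auto simp: axis_cylinder_def w_def inner_sum_left_Basis)
  then show ?thesis
    by (auto simp: mem_box inner_diff_left inner_add_left abs_le_iff algebra_simps)
qed

lemma emeasure_axis_cylinder:
  fixes p e :: "'a::euclidean_space"
  assumes e: "e \<in> Basis" and "0 \<le> h" "0 \<le> r"
  shows "emeasure lborel (axis_cylinder e p h r) = ennreal ((2 * h) ^ (DIM('a) - 1) * (2 * r))"
proof -
  let ?w = "\<Sum>b\<in>Basis. (if b = e then r else h) *\<^sub>R b"
  have w: "?w \<bullet> b = (if b = e then r else h)" if "b \<in> Basis" for b
    using that by (simp add: inner_sum_left_Basis)
  have "emeasure lborel (axis_cylinder e p h r) = ennreal (\<Prod>b\<in>Basis. ((p + ?w) - (p - ?w)) \<bullet> b)"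
    unfolding axis_cylinder_eq_cbox[OF e]
    using assms by (intro emeasure_lborel_cbox) (auto simp: inner_diff_left inner_add_left w)
  also have "(\<Prod>b\<in>Basis. ((p + ?w) - (p - ?w)) \<bullet> b) = (\<Prod>b\<in>Basis. if b = e then 2 * r else 2 * h)"
    by (intro prod.cong) (auto simp: inner_diff_left inner_add_left w)
  also have "\<dots> = (2 * h) ^ (DIM('a) - 1) * (2 * r)"
    using e by (simp add: prod.remove[of _ e] card_Diff_singleton)
  finally show ?thesis .
qed

definition axis_column :: "'a::euclidean_space \<Rightarrow> 'a set \<Rightarrow> 'a set" where
  "axis_column e X = {x. \<exists>y\<in>X. \<forall>b\<in>Basis - {e}. y \<bullet> b = x \<bullet> b}"

lemma axis_column_subset_cylinder:
  fixes X :: "'a::euclidean_space set"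
  assumes "bounded X" and e: "e \<in> Basis"
  shows "\<exists>q. axis_column e X \<inter> {x. \<bar>(x - p) \<bullet> e\<bar> \<le> r} \<subseteq> axis_cylinder e q (diameter X) r"
proof (cases "X = {}")
  case True
  then show ?thesis by (simp add: axis_column_def)
next
  case False
  then obtain y\<^sub>0 where y\<^sub>0: "y\<^sub>0 \<in> X" by blast
  define q where "q = y\<^sub>0 + ((p - y\<^sub>0) \<bullet> e) *\<^sub>R e"
  have q: "q \<bullet> e = p \<bullet> e" "\<And>b. b \<in> Basis - {e} \<Longrightarrow> q \<bullet> b = y\<^sub>0 \<bullet> b"
    using e by (auto simp: q_def inner_add_left inner_diff_left inner_Basis)
  have "axis_column e X \<inter> {x. \<bar>(x - p) \<bullet> e\<bar> \<le> r} \<subseteq> axis_cylinder e q (diameter X) r"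
  proof
    fix x assume x: "x \<in> axis_column e X \<inter> {x. \<bar>(x - p) \<bullet> e\<bar> \<le> r}"
    then obtain y where y: "y \<in> X" "\<forall>b\<in>Basis - {e}. y \<bullet> b = x \<bullet> b" by (auto simp: axis_column_def)
    have "\<bar>(x - q) \<bullet> b\<bar> \<le> diameter X" if b: "b \<in> Basis - {e}" for b
    proof -
      have "\<bar>(x - q) \<bullet> b\<bar> = \<bar>(y - y\<^sub>0) \<bullet> b\<bar>" using y(2) b q(2)[OF b] by (simp add: inner_diff_left)
      also have "\<dots> \<le> dist y y\<^sub>0" using b Basis_le_norm[of b "y - y\<^sub>0"] by (simp add: dist_norm)
      also have "\<dots> \<le> diameter X" by (rule diameter_bounded_bound[OF \<open>bounded X\<close> y(1) y\<^sub>0])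
      finally show ?thesis .
    qed
    then show "x \<in> axis_cylinder e q (diameter X) r"
      using x q(1) by (simp add: axis_cylinder_def inner_diff_left)
  qed
  then show ?thesis by blast
qed

text \<open>Thickening a cover of Y in direction e turns it into a cover of a box of full dimension,
  whose volume is known.\<close>

lemma box_power_le_suminf_delta_cover:
  fixes Y :: "'a::euclidean_space set"
  assumes e: "e \<in> Basis" and h: "0 \<le> h" and C: "C \<in> delta_covers \<delta> Y"
    and proj: "axis_cylinder e p h (1/2) \<subseteq> axis_column e Y"
  shows "ennreal ((2 * h) ^ (DIM('a) - 1)) \<le> (\<Sum>i. ennreal ((2 * diameter (C i)) ^ (DIM('a) - 1)))"
proof -
  have "\<exists>q. axis_column e (C i) \<inter> {x. \<bar>(x - p) \<bullet> e\<bar> \<le> 1/2} \<subseteq> axis_cylinder e q (diameter (C i)) (1/2)" for i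
    by (rule axis_column_subset_cylinder[OF delta_coversD(2)[OF C] e])
  then obtain q where q:
    "\<And>i. axis_column e (C i) \<inter> {x. \<bar>(x - p) \<bullet> e\<bar> \<le> 1/2} \<subseteq> axis_cylinder e (q i) (diameter (C i)) (1/2)"
    by metis
  define Q where "Q = (\<lambda>i. axis_cylinder e (q i) (diameter (C i)) (1/2))"
  have Q_sets: "range Q \<subseteq> sets lborel"
    by (auto simp: Q_def axis_cylinder_eq_cbox[OF e])
  have "axis_cylinder e p h (1/2) \<subseteq> (\<Union>i. Q i)"
  proof
    fix x assume x: "x \<in> axis_cylinder e p h (1/2)"
    then obtain y where y: "y \<in> Y" "\<forall>b\<in>Basis - {e}. y \<bullet> b = x \<bullet> b"
      using proj unfolding axis_column_def by blast
    obtain i where "y \<in> C i" using delta_coversD(1)[OF C y(1)] by blast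
    with y(2) have "x \<in> axis_column e (C i)" unfolding axis_column_def by blast
    then have "x \<in> Q i" using q[of i] x by (auto simp: Q_def axis_cylinder_def[of e p])
    then show "x \<in> (\<Union>i. Q i)" by blast
  qed
  then have "emeasure lborel (axis_cylinder e p h (1/2)) \<le> emeasure lborel (\<Union>i. Q i)"
    using Q_sets by (intro emeasure_mono) auto
  also have "\<dots> \<le> (\<Sum>i. emeasure lborel (Q i))"
    by (rule emeasure_subadditive_countably[OF Q_sets])
  also have "\<dots> = (\<Sum>i. ennreal ((2 * diameter (C i)) ^ (DIM('a) - 1)))"
    by (simp add: Q_def emeasure_axis_cylinder[OF e] diameter_ge_0[OF delta_coversD(2)[OF C]])
  finally show ?thesis by (simp add: emeasure_axis_cylinder[OF e h])
qed

lemma hausdorff_outer_ge_of_projection: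
  fixes Y :: "'a::euclidean_space set" and p e :: 'a
  assumes e: "e \<in> Basis" and h: "0 \<le> h" and dim: "2 \<le> DIM('a)"
    and proj: "axis_cylinder e p h (1/2) \<subseteq> axis_column e Y"
  shows "ennreal (unit_ball_vol (real (DIM('a) - 1)) * (h / 2) ^ (DIM('a) - 1))
    \<le> hausdorff_outer (real (DIM('a) - 1)) Y"
proof -
  let ?n = "DIM('a) - 1"
  define c where "c = unit_ball_vol (real ?n) / 4 ^ ?n"
  have c: "0 \<le> c" by (simp add: c_def)
  have scale: "unit_ball_vol (real ?n) * (d / 2) ^ ?n = c * (2 * d) ^ ?n" for d :: real
  proof -
    have "(2 * d) ^ ?n = 4 ^ ?n * (d / 2) ^ ?n" using power_mult_distrib[of 4 "d / 2" ?n] by simp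
    then show ?thesis by (simp add: c_def)
  qed
  have "ennreal (c * (2 * h) ^ ?n) \<le> hausdorff_approx (real ?n) 1 Y"
  proof (rule hausdorff_approx_geI)
    fix C assume C: "C \<in> delta_covers 1 Y"
    have content: "diameter_content (real ?n) (C i) = ennreal c * ennreal ((2 * diameter (C i)) ^ ?n)" for i
    proof -
      have d: "0 \<le> diameter (C i)" by (intro diameter_ge_0 delta_coversD[OF C])
      then have "(diameter (C i) / 2) powr real ?n = (diameter (C i) / 2) ^ ?n"
        using dim by (intro powr_realpow') auto
      then have "diameter_content (real ?n) (C i) = ennreal (c * (2 * diameter (C i)) ^ ?n)"
        unfolding diameter_content_def scale[symmetric] by (rule arg_cong)
      then show ?thesis using c d by (simp add: ennreal_mult)
    qed
    have "ennreal (c * (2 * h) ^ ?n) = ennreal c * ennreal ((2 * h) ^ ?n)"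
      using c h by (intro ennreal_mult) auto
    also have "\<dots> \<le> ennreal c * (\<Sum>i. ennreal ((2 * diameter (C i)) ^ ?n))"
      by (intro mult_left_mono box_power_le_suminf_delta_cover[OF e h C proj]) auto
    also have "\<dots> = (\<Sum>i. diameter_content (real ?n) (C i))"
      unfolding content by (rule ennreal_suminf_cmult[symmetric])
    finally show "ennreal (c * (2 * h) ^ ?n) \<le> (\<Sum>i. diameter_content (real ?n) (C i))" .
  qed
  also have "\<dots> \<le> hausdorff_outer (real ?n) Y" by (rule hausdorff_approx_le_outer) simp
  finally show ?thesis by (simp only: scale)
qed

lemma hausdorff_approx_le_finite_cover:
  fixes A :: "'a::metric_space set" and C :: "'i \<Rightarrow> 'a set"
  assumes I: "finite I" and A: "A \<subseteq> (\<Union>i\<in>I. C i)" and C: "\<And>i. i \<in> I \<Longrightarrow> bounded (C i)"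
    "\<And>i. i \<in> I \<Longrightarrow> diameter (C i) \<le> d" and d: "0 \<le> d" "d \<le> \<delta>" and s: "0 \<le> s"
  shows "hausdorff_approx s \<delta> A \<le> ennreal (real (card I) * (unit_ball_vol s * (d / 2) powr s))"
proof -
  obtain f where f: "bij_betw f {..<card I} I"
    using ex_bij_betw_nat_finite[OF I] by (auto simp: atLeast0LessThan)
  define D where "D = (\<lambda>j. if j < card I then C (f j) else {})"
  have f_in: "f j \<in> I" if "j < card I" for j using f that by (auto simp: bij_betw_def)
  have "D \<in> delta_covers \<delta> A"
  proof (rule delta_coversI)
    fix x assume "x \<in> A"
    then obtain i where i: "i \<in> I" "x \<in> C i" using A by blast
    then have "i \<in> f ` {..<card I}" by (simp only: bij_betw_imp_surj_on[OF f])
    then obtain j where "j < card I" "f j = i" by auto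
    then have "x \<in> D j" using i by (simp add: D_def)
    then show "\<exists>j. x \<in> D j" ..
  qed (use C f_in d in \<open>auto simp: D_def intro: order_trans\<close>)
  then have "hausdorff_approx s \<delta> A \<le> (\<Sum>j. diameter_content s (D j))" by (rule hausdorff_approx_le)
  also have "\<dots> = (\<Sum>j<card I. diameter_content s (D j))"
    by (rule suminf_finite) (auto simp: D_def)
  also have "\<dots> \<le> (\<Sum>j<card I. ennreal (unit_ball_vol s * (d / 2) powr s))"
    unfolding diameter_content_def using C f_in s
    by (intro sum_mono ennreal_leI mult_left_mono powr_mono2 divide_right_mono)
      (auto simp: D_def diameter_ge_0)
  also have "\<dots> = ennreal (real (card I) * (unit_ball_vol s * (d / 2) powr s))"
    using s by (simp add: ennreal_of_nat_eq_real_of_nat ennreal_mult')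
  finally show ?thesis .
qed

lemma diameter_contraction_image_le:
  fixes f :: "'a::metric_space \<Rightarrow> 'b::metric_space"
  assumes X: "bounded X" and f: "\<And>x y. x \<in> X \<Longrightarrow> y \<in> X \<Longrightarrow> dist (f x) (f y) \<le> dist x y"
  shows "bounded (f ` X)" "diameter (f ` X) \<le> diameter X"
proof -
  have le: "dist (f x) (f y) \<le> diameter X" if "x \<in> X" "y \<in> X" for x y
    using f[OF that] diameter_bounded_bound[OF X that] by (rule order_trans)
  then show "bounded (f ` X)" unfolding bounded_two_points by blast
  show "diameter (f ` X) \<le> diameter X"
  proof (cases "X = {}")
    case False
    then have "(SUP (x, y)\<in>f ` X \<times> f ` X. dist x y) \<le> diameter X"
      using le by (intro cSUP_least) auto
    then show ?thesis using False by (simp add: diameter_def[of "f ` X"])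
  qed simp
qed

lemma hausdorff_outer_contraction_image_le:
  fixes f :: "'a::metric_space \<Rightarrow> 'b::metric_space"
  assumes s: "0 \<le> s" and f: "\<And>x y. x \<in> A \<Longrightarrow> y \<in> A \<Longrightarrow> dist (f x) (f y) \<le> dist x y"
  shows "hausdorff_outer s (f ` A) \<le> hausdorff_outer s A"
proof (rule hausdorff_outer_leI)
  fix \<delta> :: real assume "0 < \<delta>"
  have "hausdorff_approx s \<delta> (f ` A) \<le> hausdorff_approx s \<delta> A"
  proof (rule hausdorff_approx_geI)
    fix C assume C: "C \<in> delta_covers \<delta> A"
    have bounded: "bounded (C i \<inter> A)" for i
      by (rule bounded_subset[OF delta_coversD(2)[OF C]]) auto
    have diam: "diameter (f ` (C i \<inter> A)) \<le> diameter (C i)" for i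
      by (rule order_trans[OF diameter_contraction_image_le(2) diameter_subset])
        (use bounded f delta_coversD(2)[OF C] in auto)
    have bounded_image: "bounded (f ` (C i \<inter> A))" for i
      by (rule diameter_contraction_image_le(1)) (use bounded f in auto)
    have "(\<lambda>i. f ` (C i \<inter> A)) \<in> delta_covers \<delta> (f ` A)"
    proof (rule delta_coversI)
      show "\<exists>i. y \<in> f ` (C i \<inter> A)" if "y \<in> f ` A" for y
        using that delta_coversD(1)[OF C] by blast
      show "diameter (f ` (C i \<inter> A)) \<le> \<delta>" for i
        using diam delta_coversD(3)[OF C] by (rule order_trans)
    qed (rule bounded_image)
    then have "hausdorff_approx s \<delta> (f ` A) \<le> (\<Sum>i. diameter_content s (f ` (C i \<inter> A)))"
      by (rule hausdorff_approx_le)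
    also have "\<dots> \<le> (\<Sum>i. diameter_content s (C i))"
      unfolding diameter_content_def using s diam diameter_ge_0[OF bounded_image]
      by (intro suminf_le ennreal_leI mult_left_mono powr_mono2 divide_right_mono) auto
    finally show "hausdorff_approx s \<delta> (f ` A) \<le> (\<Sum>i. diameter_content s (C i))" .
  qed
  also have "\<dots> \<le> hausdorff_outer s A" by (rule hausdorff_approx_le_outer[OF \<open>0 < \<delta>\<close>])
  finally show "hausdorff_approx s \<delta> (f ` A) \<le> hausdorff_outer s A" .
qed

lemma exists_nat_floor_below:
  fixes \<theta> :: real
  assumes "0 \<le> \<theta>" "\<theta> \<le> real N" "0 < N"
  shows "\<exists>j<N. real j \<le> \<theta> \<and> \<theta> \<le> real j + 1"
proof (cases "\<theta> = real N")
  case True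
  then show ?thesis using assms(3) by (intro exI[of _ "N - 1"]) auto
next
  case False
  then have "nat \<lfloor>\<theta>\<rfloor> < N" using assms by (simp add: nat_less_iff floor_less_iff)
  moreover have "real (nat \<lfloor>\<theta>\<rfloor>) \<le> \<theta>" "\<theta> \<le> real (nat \<lfloor>\<theta>\<rfloor>) + 1" using assms(1) by linarith+
  ultimately show ?thesis by blast
qed

definition cube_face :: "real \<Rightarrow> 'a::euclidean_space \<Rightarrow> real \<Rightarrow> 'a set" where
  "cube_face a b t = {x \<in> cbox (- a *\<^sub>R One) (a *\<^sub>R One). x \<bullet> b = t}"

definition face_cell :: "real \<Rightarrow> 'a::euclidean_space \<Rightarrow> real \<Rightarrow> nat \<Rightarrow> ('a \<Rightarrow> nat) \<Rightarrow> 'a set" where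
  "face_cell a b t N j = {x. x \<bullet> b = t \<and>
     (\<forall>c\<in>Basis - {b}. real (j c) \<le> (x \<bullet> c + a) * real N / (2 * a) \<and>
       (x \<bullet> c + a) * real N / (2 * a) \<le> real (j c) + 1)}"

lemma dist_face_cell_le:
  fixes b :: "'a::euclidean_space"
  assumes a: "0 < a" and N: "0 < N" and xy: "x \<in> face_cell a b t N j" "y \<in> face_cell a b t N j"
  shows "dist x y \<le> 2 * a * real DIM('a) / real N"
proof -
  have "\<bar>(x - y) \<bullet> c\<bar> \<le> 2 * a / real N" if c: "c \<in> Basis" for c
  proof (cases "c = b")
    case False
    then have "c \<in> Basis - {b}" using c by simp
    with xy have "real (j c) \<le> (x \<bullet> c + a) * real N / (2 * a)"
      "(x \<bullet> c + a) * real N / (2 * a) \<le> real (j c) + 1"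
      "real (j c) \<le> (y \<bullet> c + a) * real N / (2 * a)" "(y \<bullet> c + a) * real N / (2 * a) \<le> real (j c) + 1"
      unfolding face_cell_def by blast+
    then have "\<bar>(x \<bullet> c + a) * real N / (2 * a) - (y \<bullet> c + a) * real N / (2 * a)\<bar> \<le> 1" by linarith
    also have "(x \<bullet> c + a) * real N / (2 * a) - (y \<bullet> c + a) * real N / (2 * a)
        = (x - y) \<bullet> c * (real N / (2 * a))"
      using a by (simp add: inner_diff_left field_simps)
    finally have "\<bar>(x - y) \<bullet> c\<bar> * (real N / (2 * a)) \<le> 1" using a by (simp add: abs_mult)
    then show ?thesis using a N by (simp add: field_simps)
  qed (use xy a N in \<open>auto simp: face_cell_def inner_diff_left\<close>)
  then have "(\<Sum>c\<in>Basis. \<bar>(x - y) \<bullet> c\<bar>) \<le> real DIM('a) * (2 * a / real N)"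
    by (intro sum_bounded_above) auto
  then show ?thesis using norm_le_l1[of "x - y"] by (simp add: dist_norm mult.commute)
qed

lemma cube_face_subset_cells:
  assumes a: "0 < a" and N: "0 < N"
  shows "cube_face a b t \<subseteq> (\<Union>j\<in>PiE (Basis - {b}) (\<lambda>_. {..<N}). face_cell a b t N j)"
proof
  fix x assume x: "x \<in> cube_face a b t"
  have "\<exists>j<N. real j \<le> (x \<bullet> c + a) * real N / (2 * a) \<and> (x \<bullet> c + a) * real N / (2 * a) \<le> real j + 1"
    if c: "c \<in> Basis" for c
  proof (rule exists_nat_floor_below[OF _ _ N])
    have "- a \<le> x \<bullet> c" "x \<bullet> c \<le> a" using x c by (auto simp: cube_face_def mem_box)
    then have "0 \<le> x \<bullet> c + a" "(x \<bullet> c + a) * real N \<le> 2 * a * real N"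
      by (auto intro: mult_right_mono)
    then show "0 \<le> (x \<bullet> c + a) * real N / (2 * a)" "(x \<bullet> c + a) * real N / (2 * a) \<le> real N"
      using a by (simp_all add: pos_divide_le_eq mult.commute)
  qed
  then obtain j where j: "\<And>c. c \<in> Basis \<Longrightarrow> j c < N \<and> real (j c) \<le> (x \<bullet> c + a) * real N / (2 * a) \<and>
      (x \<bullet> c + a) * real N / (2 * a) \<le> real (j c) + 1"
    by metis
  have "restrict j (Basis - {b}) \<in> PiE (Basis - {b}) (\<lambda>_. {..<N})" using j by auto
  moreover have "x \<in> face_cell a b t N (restrict j (Basis - {b}))"
    using x j by (auto simp: face_cell_def cube_face_def)
  ultimately show "x \<in> (\<Union>j\<in>PiE (Basis - {b}) (\<lambda>_. {..<N}). face_cell a b t N j)" by blast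
qed

lemma hausdorff_outer_cube_face_finite:
  fixes b :: "'a::euclidean_space"
  assumes b: "b \<in> Basis" and a: "0 < a"
  shows "hausdorff_outer (real (DIM('a) - 1)) (cube_face a b t) < top"
proof -
  let ?n = "DIM('a) - 1"
  have "hausdorff_outer (real ?n) (cube_face a b t)
      \<le> ennreal (unit_ball_vol (real ?n) * (a * real DIM('a)) powr real ?n)"
  proof (rule hausdorff_outer_leI)
    fix \<delta> :: real assume \<delta>: "0 < \<delta>"
    obtain N :: nat where "2 * a * real DIM('a) / \<delta> < real N" using reals_Archimedean2 by blast
    moreover from this have "0 < real N" by (rule less_trans[rotated]) (use a \<delta> in simp)
    ultimately have N: "0 < N" "2 * a * real DIM('a) / real N \<le> \<delta>"
      using \<delta> by (auto simp: field_simps)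
    define I where "I = PiE (Basis - {b}) (\<lambda>_. {..<N})"
    define d where "d = 2 * a * real DIM('a) / real N"
    have card_I: "card I = N ^ ?n" using b by (simp add: I_def card_PiE card_Diff_singleton)
    have "hausdorff_approx (real ?n) \<delta> (cube_face a b t)
        \<le> ennreal (real (card I) * (unit_ball_vol (real ?n) * (d / 2) powr real ?n))"
    proof (rule hausdorff_approx_le_finite_cover)
      show "finite I" unfolding I_def by (intro finite_PiE) auto
      show "cube_face a b t \<subseteq> (\<Union>j\<in>I. face_cell a b t N j)"
        unfolding I_def by (rule cube_face_subset_cells[OF a N(1)])
      show "bounded (face_cell a b t N j)" for j
        unfolding bounded_two_points using dist_face_cell_le[OF a N(1)] by blast
      show "diameter (face_cell a b t N j) \<le> d" for j
        using dist_face_cell_le[OF a N(1)] a by (intro diameter_le) (auto simp: d_def dist_norm)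
    qed (use a N in \<open>auto simp: d_def\<close>)
    also have "real (card I) * (unit_ball_vol (real ?n) * (d / 2) powr real ?n)
        = unit_ball_vol (real ?n) * (a * real DIM('a)) powr real ?n"
    proof -
      have "real (card I) = real N powr real ?n"
        unfolding card_I using N(1) by (subst powr_realpow) auto
      then have "real (card I) * (d / 2) powr real ?n = (real N * (d / 2)) powr real ?n"
        by (simp only: powr_mult)
      then show ?thesis using N(1) by (simp add: d_def mult.left_commute)
    qed
    finally show "hausdorff_approx (real ?n) \<delta> (cube_face a b t)
        \<le> ennreal (unit_ball_vol (real ?n) * (a * real DIM('a)) powr real ?n)" .
  qed
  also have "\<dots> < top" by simp
  finally show ?thesis .
qed

lemma hausdorff_outer_frontier_cube_finite:
  assumes a: "0 < a"
  shows "hausdorff_outer (real (DIM('a) - 1))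
    (frontier (cbox (- a *\<^sub>R One) (a *\<^sub>R One :: 'a::euclidean_space))) < top"
proof -
  have "frontier (cbox (- a *\<^sub>R One) (a *\<^sub>R One)) \<subseteq> (\<Union>(b, t)\<in>(Basis :: 'a set) \<times> {a, - a}. cube_face a b t)"
  proof
    fix x :: 'a assume "x \<in> frontier (cbox (- a *\<^sub>R One) (a *\<^sub>R One))"
    then have x: "x \<in> cbox (- a *\<^sub>R One) (a *\<^sub>R One)" and "x \<notin> box (- a *\<^sub>R One) (a *\<^sub>R One)"
      by (auto simp: frontier_cbox)
    then obtain b where b: "b \<in> Basis" "\<not> (- a < x \<bullet> b \<and> x \<bullet> b < a)" by (auto simp: mem_box)
    moreover have "- a \<le> x \<bullet> b" "x \<bullet> b \<le> a" using x b(1) by (auto simp: mem_box)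
    ultimately have "x \<bullet> b \<in> {a, - a}" by auto
    then show "x \<in> (\<Union>(b, t)\<in>Basis \<times> {a, - a}. cube_face a b t)"
      using x b(1) by (auto simp: cube_face_def intro!: bexI[of _ b])
  qed
  then have "hausdorff_outer (real (DIM('a) - 1)) (frontier (cbox (- a *\<^sub>R One) (a *\<^sub>R One :: 'a)))
      \<le> hausdorff_outer (real (DIM('a) - 1)) (\<Union>(b, t)\<in>(Basis :: 'a set) \<times> {a, - a}. cube_face a b t)"
    by (rule hausdorff_outer.mono)
  also have "\<dots> < top"
    using hausdorff_outer_cube_face_finite[OF _ a] by (intro hausdorff_outer.finite_UN_less_top) auto
  finally show ?thesis .
qed

lemma closest_point_outer_normal:
  fixes y g :: "'a::euclidean_space"
  assumes K: "convex K" "closed K" "y \<in> K" and g: "\<And>z. z \<in> K \<Longrightarrow> g \<bullet> (z - y) \<le> 0" and t: "0 \<le> t"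
  shows "closest_point K (y + t *\<^sub>R g) = y"
proof -
  have "dist (y + t *\<^sub>R g) y \<le> dist (y + t *\<^sub>R g) z" if z: "z \<in> K" for z
  proof -
    have "(norm (t *\<^sub>R g))\<^sup>2 \<le> (norm (t *\<^sub>R g))\<^sup>2 - 2 * (t * (g \<bullet> (z - y))) + (norm (y - z))\<^sup>2"
      using mult_nonneg_nonpos[OF t g[OF z]] zero_le_power2[of "norm (y - z)"] by linarith
    also have "\<dots> = (norm (y + t *\<^sub>R g - z))\<^sup>2"
      unfolding power2_norm_eq_inner by (simp add: inner_simps algebra_simps inner_commute)
    finally have "norm (t *\<^sub>R g) \<le> norm (y + t *\<^sub>R g - z)" by (rule power2_le_imp_le) simp
    then show ?thesis by (simp add: dist_norm)
  qed
  then show ?thesis using closest_point_unique[OF K, of "y + t *\<^sub>R g"] by auto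
qed

text \<open>The nearest point projection onto K is a contraction from the boundary of a cube onto S.\<close>

lemma hausdorff_outer_convex_boundary_finite:
  fixes K S :: "'a::euclidean_space set"
  assumes K: "convex K" "compact K" and SK: "S \<subseteq> K"
    and normal: "\<And>y. y \<in> S \<Longrightarrow> \<exists>g. g \<noteq> 0 \<and> (\<forall>z\<in>K. g \<bullet> (z - y) \<le> 0)"
  shows "hausdorff_outer (real (DIM('a) - 1)) S < top"
proof (cases "K = {}")
  case True
  then show ?thesis using SK by simp
next
  case False
  have closed: "closed K" using K by (simp add: compact_imp_closed)
  obtain a where a: "0 < a" "\<And>x. x \<in> K \<Longrightarrow> norm x < a"
    using compact_imp_bounded[OF K(2)] unfolding bounded_pos_less by blast
  define Q :: "'a set" where "Q = cbox (- a *\<^sub>R One) (a *\<^sub>R One)"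
  have "S \<subseteq> closest_point K ` frontier Q"
  proof
    fix y assume y: "y \<in> S"
    then obtain g where g: "g \<noteq> 0" "\<And>z. z \<in> K \<Longrightarrow> g \<bullet> (z - y) \<le> 0" using normal by blast
    have y_in_K: "y \<in> K" using y SK by blast
    have "\<bar>y \<bullet> b\<bar> < a" if "b \<in> Basis" for b
      using Basis_le_norm[OF that, of y] a(2)[OF y_in_K] by linarith
    then have "y \<in> interior Q" unfolding Q_def interior_cbox mem_box by (auto simp: abs_less_iff) force
    then obtain d where "0 < d" "y + d *\<^sub>R g \<in> frontier Q"
      using ray_to_frontier[OF _ _ g(1), of Q y] by (auto simp: Q_def)
    moreover from this have "closest_point K (y + d *\<^sub>R g) = y"
      by (intro closest_point_outer_normal K(1) closed y_in_K g(2)) auto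
    ultimately show "y \<in> closest_point K ` frontier Q" by force
  qed
  then have "hausdorff_outer (real (DIM('a) - 1)) S
      \<le> hausdorff_outer (real (DIM('a) - 1)) (closest_point K ` frontier Q)"
    by (rule hausdorff_outer.mono)
  also have "\<dots> \<le> hausdorff_outer (real (DIM('a) - 1)) (frontier Q)"
    by (intro hausdorff_outer_contraction_image_le closest_point_lipschitz K(1) closed False) simp
  also have "\<dots> < top" unfolding Q_def by (rule hausdorff_outer_frontier_cube_finite[OF a(1)])
  finally show ?thesis .
qed

section \<open>Bump functions and their series\<close>

lemma max_0_power_has_real_derivative:
  "((\<lambda>t::real. (max 0 t) ^ Suc (Suc j)) has_real_derivative real (Suc (Suc j)) * (max 0 t) ^ Suc j) (at t)"
proof -
  consider (pos) "0 < t" | (neg) "t < 0" | (zero) "t = 0" by linarith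
  then show ?thesis
  proof cases
    case pos
    have "((\<lambda>t::real. t ^ Suc (Suc j)) has_real_derivative real (Suc (Suc j)) * t ^ Suc j) (at t)"
      using DERIV_pow[of "Suc (Suc j)" t UNIV] by simp
    then have
      "((\<lambda>t::real. (max 0 t) ^ Suc (Suc j)) has_real_derivative real (Suc (Suc j)) * t ^ Suc j) (at t)"
      by (rule has_field_derivative_transform_within_open[where S = "{0<..}"]) (use pos in auto)
    then show ?thesis using pos by simp
  next
    case neg
    have "((\<lambda>t::real. 0) has_real_derivative 0) (at t)" by simp
    then have "((\<lambda>t::real. (max 0 t) ^ Suc (Suc j)) has_real_derivative 0) (at t)"
      by (rule has_field_derivative_transform_within_open[where S = "{..<0}"]) (use neg in auto)
    then show ?thesis using neg by simp
  next
    case zero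
    have "((\<lambda>h::real. (max 0 h) ^ Suc j) \<longlongrightarrow> (max 0 0) ^ Suc j) (at 0)"
      by (intro tendsto_intros)
    then have "((\<lambda>h::real. (max 0 h ^ Suc (Suc j) - max 0 0 ^ Suc (Suc j)) / (h - 0)) \<longlongrightarrow> 0) (at 0)"
    proof (subst (asm) max.idem, rule_tac Lim_transform_eventually)
      show "\<forall>\<^sub>F h in at (0::real). max 0 h ^ Suc j
          = (max 0 h ^ Suc (Suc j) - max 0 0 ^ Suc (Suc j)) / (h - 0)"
        unfolding eventually_at_filter by (intro always_eventually) (auto simp: max_def)
    qed simp
    then show ?thesis using zero by (simp add: has_field_derivative_iff)
  qed
qed

definition bump_profile :: "real \<Rightarrow> 'a::euclidean_space \<Rightarrow> 'a \<Rightarrow> real" where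
  "bump_profile \<delta> p x = max 0 (1 - ((x - p) \<bullet> (x - p)) / \<delta>\<^sup>2)"

definition bump :: "real \<Rightarrow> 'a::euclidean_space \<Rightarrow> 'a \<Rightarrow> real" where
  "bump \<delta> p x = bump_profile \<delta> p x ^ 3"

definition bump_grad :: "real \<Rightarrow> 'a::euclidean_space \<Rightarrow> 'a \<Rightarrow> 'a" where
  "bump_grad \<delta> p x = (- 6 / \<delta>\<^sup>2 * (bump_profile \<delta> p x)\<^sup>2) *\<^sub>R (x - p)"

definition bump_hess :: "real \<Rightarrow> 'a::euclidean_space \<Rightarrow> 'a \<Rightarrow> 'a \<Rightarrow> 'a" where
  "bump_hess \<delta> p x v = (- 6 / \<delta>\<^sup>2 * (bump_profile \<delta> p x)\<^sup>2) *\<^sub>R v +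
     (24 / \<delta> ^ 4 * bump_profile \<delta> p x * ((x - p) \<bullet> v)) *\<^sub>R (x - p)"

lemma bump_profile_nonneg: "0 \<le> bump_profile \<delta> p x"
  by (simp add: bump_profile_def)

lemma bump_profile_le_1: "bump_profile \<delta> p x \<le> 1"
  by (simp add: bump_profile_def)

lemma bump_profile_eq_0:
  assumes "0 < \<delta>" "\<delta> \<le> norm (x - p)"
  shows "bump_profile \<delta> p x = 0"
proof -
  have "\<delta>\<^sup>2 \<le> (norm (x - p))\<^sup>2" using assms by (intro power_mono) auto
  then show ?thesis
    using assms(1) by (simp add: bump_profile_def power2_norm_eq_inner field_simps)
qed

lemma bump_profile_power_has_derivative:
  "((\<lambda>x. bump_profile \<delta> p x ^ Suc (Suc j)) has_derivative
    (\<lambda>v. real (Suc (Suc j)) * bump_profile \<delta> p x ^ Suc j * (- 2 / \<delta>\<^sup>2 * ((x - p) \<bullet> v)))) (at x)"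
proof -
  have "((\<lambda>x. (x - p) \<bullet> (x - p)) has_derivative (\<lambda>v. (x - p) \<bullet> v + v \<bullet> (x - p))) (at x)"
    by (auto intro!: derivative_eq_intros)
  then have "((\<lambda>x. (x - p) \<bullet> (x - p) / \<delta>\<^sup>2) has_derivative (\<lambda>v. ((x - p) \<bullet> v + v \<bullet> (x - p)) / \<delta>\<^sup>2)) (at x)"
    by (rule bounded_linear.has_derivative[OF bounded_linear_divide])
  from has_derivative_diff[OF has_derivative_const this, of 1]
  have inner: "((\<lambda>x. 1 - ((x - p) \<bullet> (x - p)) / \<delta>\<^sup>2) has_derivative (\<lambda>v. - 2 / \<delta>\<^sup>2 * ((x - p) \<bullet> v))) (at x)"
    by (simp add: inner_commute)
  show ?thesis
    unfolding bump_profile_def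
    using has_derivative_compose[OF inner
        max_0_power_has_real_derivative[unfolded has_field_derivative_def]]
    by simp
qed

lemma bump_has_derivative: "(bump \<delta> p has_derivative (\<lambda>v. bump_grad \<delta> p x \<bullet> v)) (at x)"
proof -
  have "(\<lambda>v. bump_grad \<delta> p x \<bullet> v) =
      (\<lambda>v. real (Suc (Suc 1)) * bump_profile \<delta> p x ^ Suc 1 * (- 2 / \<delta>\<^sup>2 * ((x - p) \<bullet> v)))"
    by (auto simp: bump_grad_def power2_eq_square)
  then show ?thesis
    using bump_profile_power_has_derivative[of \<delta> p 1 x] by (simp add: bump_def[abs_def] numeral_3_eq_3)
qed

lemma bump_grad_has_derivative: "(bump_grad \<delta> p has_derivative bump_hess \<delta> p x) (at x)"
proof -
  have "(\<lambda>v. 24 / \<delta> ^ 4 * bump_profile \<delta> p x * ((x - p) \<bullet> v)) =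
      (\<lambda>v. - 6 / \<delta>\<^sup>2 * (real (Suc (Suc 0)) * bump_profile \<delta> p x ^ Suc 0 * (- 2 / \<delta>\<^sup>2 * ((x - p) \<bullet> v))))"
    by (simp add: fun_eq_iff power4_eq_xxxx power2_eq_square)
  then have "((\<lambda>x. - 6 / \<delta>\<^sup>2 * (bump_profile \<delta> p x)\<^sup>2) has_derivative
      (\<lambda>v. 24 / \<delta> ^ 4 * bump_profile \<delta> p x * ((x - p) \<bullet> v))) (at x)"
    using has_derivative_mult_right[OF bump_profile_power_has_derivative[of \<delta> p 0 x], of "- 6 / \<delta>\<^sup>2"]
    by (simp only: numeral_2_eq_2)
  moreover have "((\<lambda>x. x - p) has_derivative (\<lambda>v. v)) (at x)"
    by (auto intro!: derivative_eq_intros)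
  ultimately have "((\<lambda>x. (- 6 / \<delta>\<^sup>2 * (bump_profile \<delta> p x)\<^sup>2) *\<^sub>R (x - p)) has_derivative
      (\<lambda>v. (- 6 / \<delta>\<^sup>2 * (bump_profile \<delta> p x)\<^sup>2) *\<^sub>R v +
        (24 / \<delta> ^ 4 * bump_profile \<delta> p x * ((x - p) \<bullet> v)) *\<^sub>R (x - p))) (at x)"
    by (rule has_derivative_scaleR)
  then show ?thesis by (simp add: bump_grad_def[abs_def] bump_hess_def[abs_def])
qed

lemma bump_hess_continuous: "\<delta> \<noteq> 0 \<Longrightarrow> continuous_on UNIV (\<lambda>x. bump_hess \<delta> p x v)"
  unfolding bump_hess_def bump_profile_def by (intro continuous_intros) auto

lemma bump_center: "bump \<delta> p p = 1"
  by (simp add: bump_def bump_profile_def)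

lemma bump_outside:
  assumes "0 < \<delta>" "\<delta> \<le> norm (x - p)"
  shows "bump \<delta> p x = 0" "bump_grad \<delta> p x = 0" "bump_hess \<delta> p x v = 0"
  by (simp_all add: bump_def bump_grad_def bump_hess_def bump_profile_eq_0[OF assms])

lemma abs_bump_le:
  assumes "0 < \<delta>" "\<delta> \<le> 1"
  shows "\<bar>bump \<delta> p x\<bar> \<le> 30 / \<delta>\<^sup>2"
proof -
  have "\<bar>bump \<delta> p x\<bar> \<le> 1"
    unfolding bump_def abs_of_nonneg[OF zero_le_power[OF bump_profile_nonneg]]
    by (intro power_le_one bump_profile_nonneg bump_profile_le_1)
  also have "\<delta>\<^sup>2 \<le> 1" using assms by (intro power_le_one) auto
  then have "1 \<le> 30 / \<delta>\<^sup>2" using assms by (simp add: field_simps)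
  finally show ?thesis .
qed

lemma norm_bump_grad_le:
  assumes \<delta>: "0 < \<delta>" "\<delta> \<le> 1"
  shows "norm (bump_grad \<delta> p x) \<le> 30 / \<delta>\<^sup>2"
proof (cases "\<delta> \<le> norm (x - p)")
  case False
  have "norm (bump_grad \<delta> p x) = 6 / \<delta>\<^sup>2 * (bump_profile \<delta> p x)\<^sup>2 * norm (x - p)"
    by (simp add: bump_grad_def abs_mult)
  also have "\<dots> \<le> 6 / \<delta>\<^sup>2 * 1 * 1"
  proof -
    have "(bump_profile \<delta> p x)\<^sup>2 \<le> 1" by (rule power_le_one[OF bump_profile_nonneg bump_profile_le_1])
    then show ?thesis using False \<delta> by (intro mult_mono) auto
  qed
  also have "\<dots> \<le> 30 / \<delta>\<^sup>2" by (simp add: divide_right_mono)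
  finally show ?thesis .
qed (simp add: bump_outside(2)[OF \<delta>(1)])

lemma norm_bump_hess_le:
  assumes \<delta>: "0 < \<delta>"
  shows "norm (bump_hess \<delta> p x v) \<le> 30 / \<delta>\<^sup>2 * norm v"
proof (cases "\<delta> \<le> norm (x - p)")
  case False
  define m where "m = bump_profile \<delta> p x"
  have m: "0 \<le> m" "m \<le> 1" "m\<^sup>2 \<le> 1"
    unfolding m_def
    by (rule bump_profile_nonneg bump_profile_le_1 power_le_one[OF bump_profile_nonneg bump_profile_le_1])+
  have "\<bar>(x - p) \<bullet> v\<bar> \<le> norm (x - p) * norm v" by (rule Cauchy_Schwarz_ineq2)
  also have "\<dots> \<le> \<delta> * norm v" using False by (intro mult_right_mono) auto
  finally have inner_le: "\<bar>(x - p) \<bullet> v\<bar> \<le> \<delta> * norm v" .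
  have "norm (bump_hess \<delta> p x v)
      \<le> norm ((- 6 / \<delta>\<^sup>2 * m\<^sup>2) *\<^sub>R v) + norm ((24 / \<delta> ^ 4 * m * ((x - p) \<bullet> v)) *\<^sub>R (x - p))"
    unfolding bump_hess_def m_def[symmetric] by (rule norm_triangle_ineq)
  also have "\<dots> = 6 / \<delta>\<^sup>2 * m\<^sup>2 * norm v + 24 / \<delta> ^ 4 * m * (\<bar>(x - p) \<bullet> v\<bar> * norm (x - p))"
    using m by (simp add: abs_mult)
  also have "\<dots> \<le> 6 / \<delta>\<^sup>2 * 1 * norm v + 24 / \<delta> ^ 4 * 1 * ((\<delta> * norm v) * \<delta>)"
    using inner_le m False \<delta> by (intro add_mono mult_mono) auto
  also have "\<dots> = 30 / \<delta>\<^sup>2 * norm v"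
    using \<delta> by (simp add: field_simps power4_eq_xxxx power2_eq_square)
  finally show ?thesis .
qed (simp add: bump_outside(3)[OF \<delta>])

definition C2_bounded ::
  "('a::euclidean_space \<Rightarrow> real) \<Rightarrow> ('a \<Rightarrow> 'a) \<Rightarrow> ('a \<Rightarrow> 'a \<Rightarrow> 'a) \<Rightarrow> real \<Rightarrow> bool" where
  "C2_bounded f g H B \<longleftrightarrow>
     (\<forall>x. (f has_derivative (\<lambda>h. g x \<bullet> h)) (at x)) \<and>
     (\<forall>x. (g has_derivative H x) (at x)) \<and>
     (\<forall>v. continuous_on UNIV (\<lambda>x. H x v)) \<and>
     (\<forall>x. \<bar>f x\<bar> \<le> B \<and> norm (g x) \<le> B \<and> (\<forall>v. norm (H x v) \<le> B * norm v))"

lemma sum_separated_eq: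
  fixes P :: "'a::real_normed_vector set" and F :: "'a \<Rightarrow> 'b::comm_monoid_add"
  assumes P: "finite P" "p \<in> P"
    and sep: "\<And>p p'. p \<in> P \<Longrightarrow> p' \<in> P \<Longrightarrow> p \<noteq> p' \<Longrightarrow> 2 * \<delta> \<le> norm (p - p')"
    and support: "\<And>p. \<delta> \<le> norm (x - p) \<Longrightarrow> F p = 0"
    and x: "norm (x - p) < \<delta>"
  shows "(\<Sum>p\<in>P. F p) = F p"
proof -
  have "F p' = 0" if p': "p' \<in> P - {p}" for p'
  proof (rule support)
    have "2 * \<delta> \<le> norm (p - p')" using sep P(2) p' by auto
    also have "\<dots> \<le> norm (x - p) + norm (x - p')"
      using norm_triangle_ineq4[of "x - p'" "x - p"] by simp
    finally show "\<delta> \<le> norm (x - p')" using x by simp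
  qed
  then show ?thesis by (simp add: sum.remove[OF P])
qed

lemma norm_sum_separated_le:
  fixes P :: "'a::real_normed_vector set" and F :: "'a \<Rightarrow> 'b::real_normed_vector"
  assumes P: "finite P"
    and sep: "\<And>p p'. p \<in> P \<Longrightarrow> p' \<in> P \<Longrightarrow> p \<noteq> p' \<Longrightarrow> 2 * \<delta> \<le> norm (p - p')"
    and support: "\<And>p. \<delta> \<le> norm (x - p) \<Longrightarrow> F p = 0"
    and bound: "\<And>p. p \<in> P \<Longrightarrow> norm (F p) \<le> B" and B: "0 \<le> B"
  shows "norm (\<Sum>p\<in>P. F p) \<le> B"
proof (cases "\<exists>p\<in>P. norm (x - p) < \<delta>")
  case True
  then obtain p where "p \<in> P" "norm (x - p) < \<delta>" by blast
  then show ?thesis using sum_separated_eq[OF P _ sep support] bound by simp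
next
  case False
  then have "(\<Sum>p\<in>P. F p) = 0" using support by (intro sum.neutral) (auto simp: not_less)
  then show ?thesis using B by simp
qed

lemma C2_bounded_bump_sum:
  fixes P :: "'a::euclidean_space set"
  assumes P: "finite P" and \<delta>: "0 < \<delta>" "\<delta> \<le> 1"
    and sep: "\<And>p p'. p \<in> P \<Longrightarrow> p' \<in> P \<Longrightarrow> p \<noteq> p' \<Longrightarrow> 2 * \<delta> \<le> norm (p - p')"
    and h: "\<And>p. p \<in> P \<Longrightarrow> \<bar>h p\<bar> \<le> \<tau>" and \<tau>: "0 \<le> \<tau>"
  shows "C2_bounded (\<lambda>x. \<Sum>p\<in>P. h p * bump \<delta> p x) (\<lambda>x. \<Sum>p\<in>P. h p *\<^sub>R bump_grad \<delta> p x)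
    (\<lambda>x v. \<Sum>p\<in>P. h p *\<^sub>R bump_hess \<delta> p x v) (\<tau> * (30 / \<delta>\<^sup>2))"
  unfolding C2_bounded_def
proof (intro conjI allI)
  fix x v :: 'a
  have local: "norm (\<Sum>p\<in>P. h p *\<^sub>R F p) \<le> \<tau> * B"
    if "\<And>p. \<delta> \<le> norm (x - p) \<Longrightarrow> F p = 0" "\<And>p. norm (F p) \<le> B" "0 \<le> B"
    for F :: "'a \<Rightarrow> 'b::real_normed_vector" and B
    by (rule norm_sum_separated_le[OF P sep, where x = x]) (use that h \<tau> in \<open>auto intro!: mult_mono\<close>)
  show "\<bar>\<Sum>p\<in>P. h p * bump \<delta> p x\<bar> \<le> \<tau> * (30 / \<delta>\<^sup>2)"
    using local[OF bump_outside(1)[OF \<delta>(1)] abs_bump_le[OF \<delta>, folded real_norm_def]] by simp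
  show "norm (\<Sum>p\<in>P. h p *\<^sub>R bump_grad \<delta> p x) \<le> \<tau> * (30 / \<delta>\<^sup>2)"
    using local[OF bump_outside(2)[OF \<delta>(1)] norm_bump_grad_le[OF \<delta>]] by simp
  show "norm (\<Sum>p\<in>P. h p *\<^sub>R bump_hess \<delta> p x v) \<le> \<tau> * (30 / \<delta>\<^sup>2) * norm v"
    using local[OF bump_outside(3)[OF \<delta>(1)] norm_bump_hess_le[OF \<delta>(1)]] by (simp add: mult.assoc)
  show "((\<lambda>x. \<Sum>p\<in>P. h p * bump \<delta> p x) has_derivative
      (\<lambda>v. (\<Sum>p\<in>P. h p *\<^sub>R bump_grad \<delta> p x) \<bullet> v)) (at x)"
    unfolding inner_sum_left inner_scaleR_left
    by (intro has_derivative_sum has_derivative_mult_right bump_has_derivative)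
  show "((\<lambda>x. \<Sum>p\<in>P. h p *\<^sub>R bump_grad \<delta> p x) has_derivative
      (\<lambda>v. \<Sum>p\<in>P. h p *\<^sub>R bump_hess \<delta> p x v)) (at x)"
    by (intro has_derivative_sum has_derivative_scaleR_right bump_grad_has_derivative)
  show "continuous_on UNIV (\<lambda>x. \<Sum>p\<in>P. h p *\<^sub>R bump_hess \<delta> p x v)"
    using \<delta>(1)
    by (intro continuous_on_sum continuous_on_scaleR continuous_on_const bump_hess_continuous) auto
qed

lemma norm_partial_sum_diff_suminf_le:
  fixes a :: "nat \<Rightarrow> 'b::banach"
  assumes a: "\<And>k. norm (a k) \<le> B k" and B: "summable B"
  shows "norm ((\<Sum>i<n. a i) - suminf a) \<le> (\<Sum>i. B (i + n))"
proof -
  have "summable a" by (rule summable_comparison_test'[OF B a])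
  then have "(\<Sum>i<n. a i) - suminf a = - (\<Sum>i. a (i + n))"
    using suminf_split_initial_segment[of a n] by simp
  also have "norm \<dots> \<le> (\<Sum>i. B (i + n))"
    unfolding norm_minus_cancel by (rule norm_suminf_le[OF a summable_ignore_initial_segment[OF B]])
  finally show ?thesis .
qed

lemma has_derivative_suminf:
  fixes f :: "nat \<Rightarrow> 'a::real_normed_vector \<Rightarrow> 'b::banach"
  assumes f: "\<And>k x. (f k has_derivative f' k x) (at x)"
    and bound: "\<And>k x. norm (f k x) \<le> B k" "\<And>k x h. norm (f' k x h) \<le> B k * norm h"
    and B: "summable B"
  shows "((\<lambda>x. \<Sum>k. f k x) has_derivative (\<lambda>h. \<Sum>k. f' k x h)) (at x)"
proof -
  have "\<exists>F. \<forall>x\<in>UNIV. (\<lambda>k. f k x) sums F x \<and> (F has_derivative (\<lambda>h. \<Sum>k. f' k x h)) (at x within UNIV)"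
  proof (rule has_derivative_series[where f' = f' and x = 0 and l = "\<Sum>k. f k 0"])
    fix e :: real assume "0 < e"
    then have "\<forall>\<^sub>F n in sequentially. (\<Sum>i. B (i + n)) < e"
      using suminf_exist_split2[OF B] by (intro order_tendstoD(2))
    then show "\<forall>\<^sub>F n in sequentially. \<forall>x\<in>UNIV. \<forall>h. norm ((\<Sum>i<n. f' i x h) - (\<Sum>k. f' k x h)) \<le> e * norm h"
    proof (rule eventually_mono, intro ballI allI)
      fix n x h assume n: "(\<Sum>i. B (i + n)) < e"
      have "norm ((\<Sum>i<n. f' i x h) - (\<Sum>k. f' k x h)) \<le> (\<Sum>i. B (i + n) * norm h)"
        by (intro norm_partial_sum_diff_suminf_le bound summable_mult2 B)
      also have "\<dots> = (\<Sum>i. B (i + n)) * norm h"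
        by (rule suminf_mult2[OF summable_ignore_initial_segment[OF B], symmetric])
      also have "\<dots> \<le> e * norm h" using n by (intro mult_right_mono) auto
      finally show "norm ((\<Sum>i<n. f' i x h) - (\<Sum>k. f' k x h)) \<le> e * norm h" .
    qed
  next
    show "(\<lambda>n. f n 0) sums (\<Sum>k. f k 0)"
      by (rule summable_sums[OF summable_comparison_test'[OF B bound(1)]])
  qed (use f in auto)
  then obtain F where F: "\<And>x. (\<lambda>k. f k x) sums F x" "\<And>x. (F has_derivative (\<lambda>h. \<Sum>k. f' k x h)) (at x)"
    by auto
  have "F = (\<lambda>x. \<Sum>k. f k x)" using sums_unique[OF F(1)] by auto
  with F(2) show ?thesis by simp
qed

lemma C2_bounded_suminf:
  fixes f :: "nat \<Rightarrow> 'a::euclidean_space \<Rightarrow> real"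
  assumes C2: "\<And>k. C2_bounded (f k) (g k) (H k) (B k)" and B: "summable B"
  shows "C2_bounded (\<lambda>x. \<Sum>k. f k x) (\<lambda>x. \<Sum>k. g k x) (\<lambda>x v. \<Sum>k. H k x v) (suminf B)"
  unfolding C2_bounded_def
proof (intro conjI allI)
  fix x v :: 'a
  have f: "norm (f k x) \<le> B k" and g: "norm (g k x) \<le> B k" and H: "norm (H k x v) \<le> B k * norm v" for k x v
    using C2[of k] by (auto simp: C2_bounded_def)
  show "\<bar>\<Sum>k. f k x\<bar> \<le> suminf B" "norm (\<Sum>k. g k x) \<le> suminf B"
    using norm_suminf_le[OF f B] norm_suminf_le[OF g B] by simp_all
  show "norm (\<Sum>k. H k x v) \<le> suminf B * norm v"
    using norm_suminf_le[OF H summable_mult2[OF B]] suminf_mult2[OF B, of "norm v"] by simp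
  have "summable (\<lambda>k. g k x)" by (rule summable_comparison_test'[OF B g])
  then have "(\<Sum>k. g k x) \<bullet> h = (\<Sum>k. g k x \<bullet> h)" for h
    by (rule bounded_linear.suminf[OF bounded_linear_inner_left])
  moreover have "((\<lambda>x. \<Sum>k. f k x) has_derivative (\<lambda>h. \<Sum>k. g k x \<bullet> h)) (at x)"
  proof (rule has_derivative_suminf[OF _ f _ B])
    show "norm (g k x \<bullet> h) \<le> B k * norm h" for k x h
      using Cauchy_Schwarz_ineq2[of "g k x" h] g[of k x] by (simp add: mult_right_mono order_trans)
  qed (use C2 in \<open>simp add: C2_bounded_def\<close>)
  ultimately show "((\<lambda>x. \<Sum>k. f k x) has_derivative (\<lambda>h. (\<Sum>k. g k x) \<bullet> h)) (at x)" by simp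
  show "((\<lambda>x. \<Sum>k. g k x) has_derivative (\<lambda>v. \<Sum>k. H k x v)) (at x)"
    by (rule has_derivative_suminf[OF _ g H B]) (use C2 in \<open>simp add: C2_bounded_def\<close>)
  show "continuous_on UNIV (\<lambda>x. \<Sum>k. H k x v)"
  proof (rule uniform_limit_theorem)
    show "uniform_limit UNIV (\<lambda>n x. \<Sum>i<n. H i x v) (\<lambda>x. \<Sum>k. H k x v) sequentially"
      using H by (rule Weierstrass_m_test) (intro summable_mult2 B)
    show "\<forall>\<^sub>F n in sequentially. continuous_on UNIV (\<lambda>x. \<Sum>i<n. H i x v)"
      using C2 by (intro always_eventually allI continuous_on_sum) (simp add: C2_bounded_def)
  qed simp
qed

section \<open>Perturbations of the unit sphere\<close>

locale perturbed_sphere =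
  fixes \<psi> :: "'a::euclidean_space \<Rightarrow> real" and G :: "'a \<Rightarrow> 'a" and H :: "'a \<Rightarrow> 'a \<Rightarrow> 'a"
  assumes C2: "C2_bounded \<psi> G H (1/2)"
begin

definition \<rho> :: "'a \<Rightarrow> real" where "\<rho> x = x \<bullet> x - 1 + \<psi> x"
definition grad :: "'a \<Rightarrow> 'a" where "grad x = 2 *\<^sub>R x + G x"
definition surf :: "'a set" where "surf = {x. \<rho> x = 0}"

lemma perturbation_C2:
  "(\<psi> has_derivative (\<lambda>h. G x \<bullet> h)) (at x)" "(G has_derivative H x) (at x)"
  "continuous_on UNIV (\<lambda>x. H x v)" "\<bar>\<psi> x\<bar> \<le> 1/2" "norm (G x) \<le> 1/2" "norm (H x v) \<le> 1/2 * norm v"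
  using C2 unfolding C2_bounded_def by auto

lemma \<rho>_has_derivative: "(\<rho> has_derivative (\<lambda>h. grad x \<bullet> h)) (at x)"
proof -
  have "((\<lambda>x. x \<bullet> x) has_derivative (\<lambda>v. x \<bullet> v + v \<bullet> x)) (at x)"
    by (auto intro!: derivative_eq_intros)
  from has_derivative_add[OF has_derivative_diff[OF this has_derivative_const[of 1]] perturbation_C2(1)]
  show ?thesis
    unfolding \<rho>_def[abs_def] grad_def by (simp add: inner_add_left inner_commute[of _ x])
qed

lemma grad_has_derivative: "(grad has_derivative (\<lambda>v. 2 *\<^sub>R v + H x v)) (at x)"
  unfolding grad_def[abs_def]
  by (intro has_derivative_add has_derivative_scaleR_right has_derivative_ident perturbation_C2(2))

lemma grad_monotone: "0 \<le> (grad x - grad y) \<bullet> (x - y)"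
proof -
  have "norm (G x - G y) \<le> 1/2 * norm (x - y)"
  proof (rule differentiable_bound[where S = UNIV])
    show "onorm (H z) \<le> 1/2" for z
      using perturbation_C2(6) by (rule onorm_le)
  qed (use perturbation_C2(2) in auto)
  then have "\<bar>(G x - G y) \<bullet> (x - y)\<bar> \<le> 1/2 * norm (x - y) * norm (x - y)"
    using Cauchy_Schwarz_ineq2[of "G x - G y" "x - y"] by (meson mult_right_mono norm_ge_zero order_trans)
  moreover have "(grad x - grad y) \<bullet> (x - y) = 2 * (norm (x - y) * norm (x - y)) + (G x - G y) \<bullet> (x - y)"
    unfolding power2_eq_square[symmetric] power2_norm_eq_inner grad_def
    by (simp add: inner_simps algebra_simps)
  moreover have "0 \<le> norm (x - y) * norm (x - y)" by simp
  ultimately show ?thesis by linarith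
qed

lemma \<rho>_first_order: "\<rho> y + grad y \<bullet> (z - y) \<le> \<rho> z"
proof -
  define \<phi> where "\<phi> = (\<lambda>t::real. \<rho> (y + t *\<^sub>R (z - y)))"
  have "(\<phi> has_derivative (\<lambda>h. grad (y + t *\<^sub>R (z - y)) \<bullet> (h *\<^sub>R (z - y)))) (at t within {0..1})" for t
  proof -
    have "((\<lambda>t. y + t *\<^sub>R (z - y)) has_derivative (\<lambda>h. h *\<^sub>R (z - y))) (at t within {0..1})"
      by (auto intro!: derivative_eq_intros)
    from has_derivative_compose[OF this \<rho>_has_derivative] show ?thesis by (simp add: \<phi>_def)
  qed
  then obtain t where t: "t \<in> {0<..<1}" "\<phi> 1 - \<phi> 0 = grad (y + t *\<^sub>R (z - y)) \<bullet> ((1 - 0) *\<^sub>R (z - y))"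
    using mvt_simple[of 0 1 \<phi> "\<lambda>t h. grad (y + t *\<^sub>R (z - y)) \<bullet> (h *\<^sub>R (z - y))"] by auto
  have "0 \<le> (grad (y + t *\<^sub>R (z - y)) - grad y) \<bullet> (t *\<^sub>R (z - y))"
    using grad_monotone[of "y + t *\<^sub>R (z - y)" y] by simp
  then have "0 \<le> (grad (y + t *\<^sub>R (z - y)) - grad y) \<bullet> (z - y)"
    using t(1) by (simp add: zero_le_mult_iff)
  then show ?thesis using t(2) by (simp add: \<phi>_def inner_diff_left)
qed

lemma convex_sublevel: "convex {x. \<rho> x \<le> 0}"
proof (rule convexI, clarify)
  fix x y and u v :: real
  assume a: "\<rho> x \<le> 0" "\<rho> y \<le> 0" "0 \<le> u" "0 \<le> v" "u + v = 1"
  define z where "z = u *\<^sub>R x + v *\<^sub>R y"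
  have "u * (\<rho> z + grad z \<bullet> (x - z)) + v * (\<rho> z + grad z \<bullet> (y - z)) \<le> u * \<rho> x + v * \<rho> y"
    by (intro add_mono mult_left_mono \<rho>_first_order a)
  moreover have "u * (\<rho> z + grad z \<bullet> (x - z)) + v * (\<rho> z + grad z \<bullet> (y - z))
      = (u + v) * \<rho> z + grad z \<bullet> (u *\<^sub>R x + v *\<^sub>R y - (u + v) *\<^sub>R z)"
    by (simp add: inner_simps algebra_simps)
  moreover have "u * \<rho> x + v * \<rho> y \<le> 0"
    using a by (intro add_nonpos_nonpos mult_nonneg_nonpos)
  ultimately have "\<rho> z \<le> 0" using a(5) by (simp add: z_def[symmetric])
  then show "\<rho> (u *\<^sub>R x + v *\<^sub>R y) \<le> 0" by (simp add: z_def)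
qed

lemma continuous_\<rho>: "continuous_on S \<rho>"
  using has_derivative_continuous[OF \<rho>_has_derivative] by (simp add: continuous_at_imp_continuous_on)

lemma power2_norm_le_of_sublevel: "\<rho> x \<le> 0 \<Longrightarrow> (norm x)\<^sup>2 \<le> 3/2"
  using perturbation_C2(4)[of x] by (simp add: \<rho>_def power2_norm_eq_inner abs_le_iff)

lemma compact_sublevel: "compact {x. \<rho> x \<le> 0}"
proof (rule compact_eq_bounded_closed[THEN iffD2], rule conjI)
  show "bounded {x. \<rho> x \<le> 0}"
  proof (rule boundedI[of _ 2], clarify)
    fix x assume "\<rho> x \<le> 0"
    then have "(norm x)\<^sup>2 \<le> 2\<^sup>2" using power2_norm_le_of_sublevel[of x] by simp
    then show "norm x \<le> 2" by (rule power2_le_imp_le) simp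
  qed
  show "closed {x. \<rho> x \<le> 0}"
    by (intro closed_Collect_le continuous_\<rho> continuous_on_const)
qed

lemma grad_nonzero: assumes "x \<in> surf" shows "grad x \<noteq> 0"
proof
  assume "grad x = 0"
  then have "norm (2 *\<^sub>R x) = norm (G x)" by (simp add: grad_def eq_neg_iff_add_eq_0[symmetric])
  then have "norm x \<le> 1/4" using perturbation_C2(5)[of x] by simp
  then have "(norm x)\<^sup>2 \<le> (1/4)\<^sup>2" by (intro power_mono) auto
  moreover have "(norm x)\<^sup>2 \<ge> 1/2"
    using assms perturbation_C2(4)[of x] by (simp add: surf_def \<rho>_def power2_norm_eq_inner abs_le_iff)
  ultimately show False by (simp add: power2_eq_square)
qed

lemma surf_nonempty: "surf \<noteq> {}"
proof -
  obtain b :: 'a where b: "b \<in> Basis" using nonempty_Basis by blast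
  have "\<exists>t::real. 0 \<le> t \<and> t \<le> 2 \<and> \<rho> (t *\<^sub>R b) = 0"
  proof (rule IVT')
    show "\<rho> (0 *\<^sub>R b) \<le> 0" "0 \<le> \<rho> (2 *\<^sub>R b)"
      using perturbation_C2(4)[of 0] perturbation_C2(4)[of "2 *\<^sub>R b"] b by (auto simp: \<rho>_def abs_le_iff)
    show "continuous_on {0..2} (\<lambda>t. \<rho> (t *\<^sub>R b))"
      by (intro continuous_on_compose2[OF continuous_\<rho>[of UNIV]] continuous_intros) auto
  qed simp
  then show ?thesis by (auto simp: surf_def)
qed

lemma strictly_convex_surf: "strictly_convex_compact_C2_hypersurface surf"
  unfolding strictly_convex_compact_C2_hypersurface_def
proof (intro exI conjI)
  show "\<forall>x. (\<rho> has_derivative (\<lambda>h. grad x \<bullet> h)) (at x)" using \<rho>_has_derivative by blast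
  show "\<forall>x. (grad has_derivative (\<lambda>v. 2 *\<^sub>R v + H x v)) (at x)" using grad_has_derivative by blast
  show "\<forall>v. continuous_on UNIV (\<lambda>x. 2 *\<^sub>R v + H x v)" by (intro allI continuous_intros perturbation_C2)
  show "surf = {x. \<rho> x = 0}" by (rule surf_def)
  show "\<forall>x\<in>surf. \<forall>v. v \<noteq> 0 \<and> grad x \<bullet> v = 0 \<longrightarrow> (2 *\<^sub>R v + H x v) \<bullet> v > 0"
  proof (intro ballI allI impI)
    fix x v :: 'a assume "v \<noteq> 0 \<and> grad x \<bullet> v = 0"
    then have v: "0 < norm v * norm v" by simp
    have "\<bar>H x v \<bullet> v\<bar> \<le> norm (H x v) * norm v" by (rule Cauchy_Schwarz_ineq2)
    also have "\<dots> \<le> 1/2 * norm v * norm v" by (intro mult_right_mono perturbation_C2) auto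
    finally have "\<bar>H x v \<bullet> v\<bar> \<le> 1/2 * norm v * norm v" .
    moreover have "(2 *\<^sub>R v + H x v) \<bullet> v = 2 * (norm v * norm v) + H x v \<bullet> v"
      by (simp add: inner_add_left power2_norm_eq_inner[symmetric] power2_eq_square)
    ultimately show "(2 *\<^sub>R v + H x v) \<bullet> v > 0" using v by linarith
  qed
qed (use surf_nonempty compact_sublevel convex_sublevel grad_nonzero in auto)

lemma hausdorff_surf_finite: "hausdorff_outer (real (DIM('a) - 1)) surf < top"
proof (rule hausdorff_outer_convex_boundary_finite[OF convex_sublevel compact_sublevel])
  show "surf \<subseteq> {x. \<rho> x \<le> 0}" by (auto simp: surf_def)
  fix y assume y: "y \<in> surf"
  have "grad y \<bullet> (z - y) \<le> 0" if "\<rho> z \<le> 0" for z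
    using \<rho>_first_order[of y z] y that by (simp add: surf_def)
  then show "\<exists>g. g \<noteq> 0 \<and> (\<forall>z\<in>{x. \<rho> x \<le> 0}. g \<bullet> (z - y) \<le> 0)"
    using grad_nonzero[OF y] by blast
qed

lemma norm_surf_le:
  assumes "p \<in> surf"
  shows "norm p \<le> 5/4"
proof (rule power2_le_imp_le)
  show "(norm p)\<^sup>2 \<le> (5/4)\<^sup>2"
    using power2_norm_le_of_sublevel[of p] assms by (simp add: surf_def power2_eq_square)
qed simp

lemma norm_grad_near_surf_le:
  assumes "p \<in> surf" "norm (x - p) \<le> 1/4"
  shows "norm (grad x) \<le> 4"
proof -
  have "norm x \<le> 3/2" using norm_triangle_ineq[of "x - p" p] norm_surf_le[OF assms(1)] assms(2) by simp
  then show ?thesis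
    using norm_triangle_ineq[of "2 *\<^sub>R x" "G x"] perturbation_C2(5)[of x] by (simp add: grad_def)
qed

lemma grad_component_ge:
  assumes e: "e \<in> Basis" and p: "3/4 \<le> p \<bullet> e" and x: "norm (x - p) \<le> 9/64"
  shows "5/8 \<le> grad x \<bullet> e"
proof -
  have "\<bar>(x - p) \<bullet> e\<bar> \<le> 9/64" using Basis_le_norm[OF e, of "x - p"] x by simp
  moreover have "\<bar>G x \<bullet> e\<bar> \<le> 1/2" using Basis_le_norm[OF e, of "G x"] perturbation_C2(5)[of x] by simp
  ultimately show ?thesis
    using p unfolding abs_le_iff by (simp add: grad_def inner_add_left inner_diff_left)
qed

text \<open>Along the line through \<open>p + d\<close> in direction \<open>e\<close> the defining function changes sign: by convexity
  it lies above its tangent at \<open>p\<close>, and the tangent at the lower endpoint lies below \<open>0\<close> at \<open>p\<close>.\<close>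

lemma exists_vertical_shift_in_surf:
  fixes d e p :: 'a
  assumes e: "e \<in> Basis" and p: "p \<in> surf" "3/4 \<le> p \<bullet> e" and r: "0 < r" "r \<le> 1/4" and d: "norm d \<le> r/16"
  shows "\<exists>s. \<bar>s\<bar> \<le> r/2 \<and> p + d + s *\<^sub>R e \<in> surf"
proof -
  define y where "y = (\<lambda>s. p + d + s *\<^sub>R e)"
  have near: "norm (y s - p) \<le> 9/64" if "\<bar>s\<bar> \<le> r/2" for s
    using norm_triangle_ineq[of d "s *\<^sub>R e"] d e that r by (simp add: y_def)
  have inner_d: "\<bar>grad x \<bullet> d\<bar> \<le> r/4" if "norm (x - p) \<le> 1/4" for x
  proof -
    have "\<bar>grad x \<bullet> d\<bar> \<le> norm (grad x) * norm d" by (rule Cauchy_Schwarz_ineq2)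
    also have "\<dots> \<le> 4 * (r/16)" using norm_grad_near_surf_le[OF p(1) that] d by (intro mult_mono) auto
    finally show ?thesis by simp
  qed
  have inner_e: "5/16 * r \<le> r/2 * (grad x \<bullet> e)" if "norm (x - p) \<le> 9/64" for x
    using mult_left_mono[OF grad_component_ge[OF e p(2) that], of "r/2"] r by simp
  have level: "\<rho> p = 0" using p(1) by (simp add: surf_def)
  have upper: "0 \<le> \<rho> (y (r/2))"
  proof -
    have "grad p \<bullet> (y (r/2) - p) = grad p \<bullet> d + r/2 * (grad p \<bullet> e)"
      by (simp add: y_def inner_add_right)
    then show ?thesis
      using \<rho>_first_order[of p "y (r/2)"] inner_d[of p] inner_e[of p] level r
      unfolding diff_self norm_zero by linarith
  qed
  have lower: "\<rho> (y (- (r/2))) \<le> 0"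
  proof -
    let ?y = "y (- (r/2))"
    have n: "norm (?y - p) \<le> 9/64" using r by (intro near) simp
    have "grad ?y \<bullet> (p - ?y) = - (grad ?y \<bullet> d) + r/2 * (grad ?y \<bullet> e)"
      by (simp add: y_def inner_simps)
    then show ?thesis
      using \<rho>_first_order[of ?y p] inner_d[of ?y] inner_e[OF n] n level r by linarith
  qed
  have "continuous_on {- (r/2)..r/2} (\<lambda>s. \<rho> (y s))"
    unfolding y_def by (intro continuous_on_compose2[OF continuous_\<rho>[of UNIV]] continuous_intros) auto
  then obtain s where "- (r/2) \<le> s" "s \<le> r/2" "\<rho> (y s) = 0"
    using IVT'[of "\<lambda>s. \<rho> (y s)" "- (r/2)" 0 "r/2"] r lower upper by auto
  then show ?thesis by (intro exI[of _ s]) (auto simp: surf_def y_def)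
qed

lemma hausdorff_outer_cap_ge:
  fixes e p :: 'a
  assumes dim: "2 \<le> DIM('a)" and e: "e \<in> Basis" and p: "p \<in> surf" "3/4 \<le> p \<bullet> e" and r: "0 < r" "r \<le> 1/4"
  shows "ennreal (unit_ball_vol (real (DIM('a) - 1)) * (r / (32 * real DIM('a))) ^ (DIM('a) - 1))
    \<le> hausdorff_outer (real (DIM('a) - 1)) (surf \<inter> ball p r)"
proof -
  define h where "h = r / (16 * real DIM('a))"
  have h: "0 \<le> h" using r by (simp add: h_def)
  have "axis_cylinder e p h (1/2) \<subseteq> axis_column e (surf \<inter> ball p r)"
  proof
    fix x assume x: "x \<in> axis_cylinder e p h (1/2)"
    define d where "d = (x - p) - ((x - p) \<bullet> e) *\<^sub>R e"
    have d: "d \<bullet> b = (if b = e then 0 else (x - p) \<bullet> b)" if "b \<in> Basis" for b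
      using that e by (auto simp: d_def inner_diff_left inner_Basis)
    have "(\<Sum>b\<in>Basis. \<bar>d \<bullet> b\<bar>) \<le> real DIM('a) * h"
      using x h by (intro sum_bounded_above) (auto simp: d axis_cylinder_def)
    also have "\<dots> = r/16" by (simp add: h_def)
    finally have norm_d: "norm d \<le> r/16" using norm_le_l1[of d] by linarith
    then obtain s where s: "\<bar>s\<bar> \<le> r/2" "p + d + s *\<^sub>R e \<in> surf"
      using exists_vertical_shift_in_surf[OF e p r] by blast
    have "norm (d + s *\<^sub>R e) < r"
      using norm_triangle_ineq[of d "s *\<^sub>R e"] norm_d s(1) e r(1) by simp
    then have "p + d + s *\<^sub>R e \<in> ball p r"
      using norm_minus_cancel[of "d + s *\<^sub>R e"] by (simp add: dist_norm)
    moreover have "(p + d + s *\<^sub>R e) \<bullet> b = x \<bullet> b" if "b \<in> Basis - {e}" for b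
      using that e d[of b] by (auto simp: inner_add_left inner_diff_left inner_Basis)
    ultimately show "x \<in> axis_column e (surf \<inter> ball p r)"
      using s(2) unfolding axis_column_def by blast
  qed
  from hausdorff_outer_ge_of_projection[OF e h dim this] show ?thesis by (simp add: h_def)
qed

end

lemma exists_perturbed_sphere_through:
  fixes P :: "nat \<Rightarrow> 'a::euclidean_space set" and \<delta> :: "nat \<Rightarrow> real"
  assumes fin: "\<And>k. finite (P k)" and \<delta>: "\<And>k. 0 < \<delta> k" "\<And>k. \<delta> k \<le> 1"
    and sep: "\<And>k p p'. p \<in> P k \<Longrightarrow> p' \<in> P k \<Longrightarrow> p \<noteq> p' \<Longrightarrow> 2 * \<delta> k \<le> norm (p - p')"
    and far: "\<And>k k' p p'. k \<noteq> k' \<Longrightarrow> p \<in> P k \<Longrightarrow> p' \<in> P k' \<Longrightarrow> \<delta> k' \<le> norm (p - p')"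
    and height: "\<And>k p. p \<in> P k \<Longrightarrow> \<bar>1 - p \<bullet> p\<bar> \<le> (1/2) ^ k * (\<delta> k)\<^sup>2 / 120"
  shows "\<exists>\<psi> G H. perturbed_sphere \<psi> G H \<and> (\<forall>k. P k \<subseteq> perturbed_sphere.surf \<psi>)"
proof -
  define \<tau> where "\<tau> = (\<lambda>k. (1/2) ^ k * (\<delta> k)\<^sup>2 / 120)"
  define f where "f = (\<lambda>k x. \<Sum>p\<in>P k. (1 - p \<bullet> p) * bump (\<delta> k) p x)"
  define G where "G = (\<lambda>k x. \<Sum>p\<in>P k. (1 - p \<bullet> p) *\<^sub>R bump_grad (\<delta> k) p x)"
  define H where "H = (\<lambda>k x v. \<Sum>p\<in>P k. (1 - p \<bullet> p) *\<^sub>R bump_hess (\<delta> k) p x v)"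
  define B where "B = (\<lambda>k::nat. (1/2) ^ k * (1/4 :: real))"
  define \<psi> where "\<psi> = (\<lambda>x. \<Sum>k. f k x)"
  have "C2_bounded (f k) (G k) (H k) (\<tau> k * (30 / (\<delta> k)\<^sup>2))" for k
    unfolding f_def G_def H_def
    by (rule C2_bounded_bump_sum) (use fin \<delta> sep height in \<open>auto simp: \<tau>_def\<close>)
  moreover have "\<tau> k * (30 / (\<delta> k)\<^sup>2) = B k" for k using \<delta>(1)[of k] by (simp add: \<tau>_def B_def)
  ultimately have C2: "C2_bounded (f k) (G k) (H k) (B k)" for k by simp
  have B: "B sums (1/2)"
    using sums_mult2[OF geometric_sums[of "1/2::real"], of "1/4"] by (simp add: B_def)
  have "C2_bounded \<psi> (\<lambda>x. \<Sum>k. G k x) (\<lambda>x v. \<Sum>k. H k x v) (1/2)"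
    unfolding \<psi>_def sums_unique[OF B] by (rule C2_bounded_suminf[OF C2 sums_summable[OF B]])
  then interpret perturbed_sphere \<psi> "\<lambda>x. \<Sum>k. G k x" "\<lambda>x v. \<Sum>k. H k x v" by unfold_locales
  have "p \<in> surf" if p: "p \<in> P k" for k p
  proof -
    have "f j p = 0" if "j \<noteq> k" for j
      unfolding f_def
    proof (rule sum.neutral, intro ballI)
      fix p' assume "p' \<in> P j"
      then have "\<delta> j \<le> norm (p - p')" using far[of k j p p'] p that by auto
      then show "(1 - p' \<bullet> p') * bump (\<delta> j) p' p = 0" by (simp add: bump_outside(1)[OF \<delta>(1)])
    qed
    then have "\<psi> p = (\<Sum>j\<in>{k}. f j p)" unfolding \<psi>_def by (intro suminf_finite) auto
    also have "\<dots> = (1 - p \<bullet> p) * bump (\<delta> k) p p"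
      using sum_separated_eq[OF fin p sep, where x = p and F = "\<lambda>p'. (1 - p' \<bullet> p') * bump (\<delta> k) p' p"]
        \<delta>(1)[of k] by (simp add: f_def bump_outside(1))
    finally show ?thesis by (simp add: surf_def \<rho>_def bump_center)
  qed
  then show ?thesis using perturbed_sphere_axioms by blast
qed

section \<open>Bohr sets\<close>

definition bohr_set :: "'j set \<Rightarrow> ('j \<Rightarrow> 'a::euclidean_space) \<Rightarrow> real \<Rightarrow> 'a set" where
  "bohr_set J u \<epsilon> = {x. \<forall>j\<in>J. \<exists>k::int. \<bar>x \<bullet> u j - of_int k\<bar> \<le> \<epsilon>}"

lemma bohr_set_borel [measurable]:
  assumes "finite J"
  shows "bohr_set J u \<epsilon> \<in> sets borel"
proof -
  have "closed {x. \<bar>x \<bullet> u j - of_int k\<bar> \<le> \<epsilon>}" for j and k :: int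
    by (intro closed_Collect_le continuous_intros)
  then have "(\<Union>k::int. {x. \<bar>x \<bullet> u j - of_int k\<bar> \<le> \<epsilon>}) \<in> sets borel" for j
    by (intro sets.countable_UN'') auto
  then have "(\<Inter>j\<in>J. \<Union>k::int. {x. \<bar>x \<bullet> u j - of_int k\<bar> \<le> \<epsilon>}) \<in> sets borel" if "J \<noteq> {}"
    using assms that by (intro sets.finite_INT) auto
  moreover have "bohr_set J u \<epsilon> = (\<Inter>j\<in>J. \<Union>k::int. {x. \<bar>x \<bullet> u j - of_int k\<bar> \<le> \<epsilon>})"
    by (auto simp: bohr_set_def)
  ultimately show ?thesis by (cases "J = {}") auto
qed

lemma ball_subset_bohr_set:
  assumes "finite J" "0 < \<epsilon>"
  shows "\<exists>r>0. ball 0 r \<subseteq> bohr_set J u \<epsilon>"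
proof -
  define s where "s = 1 + (\<Sum>j\<in>J. norm (u j))"
  have "1 \<le> s" by (simp add: s_def sum_nonneg)
  have le: "norm (u j) \<le> s" if "j \<in> J" for j
    using member_le_sum[of j J "\<lambda>j. norm (u j)"] assms(1) that by (simp add: s_def)
  have "x \<in> bohr_set J u \<epsilon>" if "x \<in> ball 0 (\<epsilon> / s)" for x
  proof -
    have "\<bar>x \<bullet> u j - of_int 0\<bar> \<le> \<epsilon>" if j: "j \<in> J" for j
    proof -
      have "\<bar>x \<bullet> u j\<bar> \<le> norm x * norm (u j)" by (rule Cauchy_Schwarz_ineq2)
      also have "\<dots> \<le> \<epsilon> / s * s"
        using \<open>x \<in> ball 0 (\<epsilon> / s)\<close> le[OF j] assms(2) \<open>1 \<le> s\<close> by (intro mult_mono) auto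
      finally show ?thesis using \<open>1 \<le> s\<close> by simp
    qed
    then show ?thesis unfolding bohr_set_def by blast
  qed
  then show ?thesis using assms(2) \<open>1 \<le> s\<close> by (intro exI[of _ "\<epsilon> / s"]) auto
qed

definition integer_combinations :: "'j set \<Rightarrow> ('j \<Rightarrow> 'a::euclidean_space) \<Rightarrow> int \<Rightarrow> 'a set" where
  "integer_combinations J u K = {(\<Sum>j\<in>J. of_int (a j) *\<^sub>R u j) | a. (\<Sum>j\<in>J. \<bar>a j\<bar>) \<le> K}"

lemma bohr_set_inner_integer_combination:
  assumes x: "x \<in> bohr_set J u \<epsilon>" and \<epsilon>: "0 \<le> \<epsilon>" and v: "v \<in> integer_combinations J u K"
  shows "\<exists>k::int. \<bar>x \<bullet> v - of_int k\<bar> \<le> of_int K * \<epsilon>"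
proof -
  obtain a where a: "v = (\<Sum>j\<in>J. of_int (a j) *\<^sub>R u j)" "(\<Sum>j\<in>J. \<bar>a j\<bar>) \<le> K"
    using v by (auto simp: integer_combinations_def)
  have "\<forall>j\<in>J. \<exists>k::int. \<bar>x \<bullet> u j - of_int k\<bar> \<le> \<epsilon>" using x by (simp add: bohr_set_def)
  then obtain k :: "_ \<Rightarrow> int" where k: "\<And>j. j \<in> J \<Longrightarrow> \<bar>x \<bullet> u j - of_int (k j)\<bar> \<le> \<epsilon>" by metis
  have "x \<bullet> v - of_int (\<Sum>j\<in>J. a j * k j) = (\<Sum>j\<in>J. of_int (a j) * (x \<bullet> u j - of_int (k j)))"
    unfolding a(1) by (simp add: inner_sum_right right_diff_distrib sum_subtractf)
  also have "\<bar>\<dots>\<bar> \<le> (\<Sum>j\<in>J. of_int \<bar>a j\<bar> * \<epsilon>)"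
    using k by (intro order_trans[OF sum_abs] sum_mono) (auto simp: abs_mult intro: mult_left_mono)
  also have "\<dots> = of_int (\<Sum>j\<in>J. \<bar>a j\<bar>) * \<epsilon>" by (simp add: sum_distrib_right)
  also have "\<dots> \<le> of_int K * \<epsilon>" using a(2) \<epsilon> by (intro mult_right_mono) (simp only: of_int_le_iff, simp)
  finally show ?thesis by blast
qed

lemma exists_measure_ge_average:
  assumes K: "finite K" "K \<noteq> {}" and S: "S \<in> fmeasurable M" and E: "\<And>i. i \<in> K \<Longrightarrow> E i \<in> fmeasurable M"
    and cover: "S \<subseteq> (\<Union>i\<in>K. E i)"
  shows "\<exists>i\<in>K. measure M S / real (card K) \<le> measure M (E i)"
proof (rule ccontr)
  assume "\<not> ?thesis"
  then have "(\<Sum>i\<in>K. measure M (E i)) < (\<Sum>i\<in>K. measure M S / real (card K))"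
    using K by (intro sum_strict_mono) auto
  also have "\<dots> = measure M S" using K by simp
  also have "\<dots> \<le> measure M (\<Union>i\<in>K. E i)"
    using K E S cover by (intro measure_mono_fmeasurable fmeasurable.finite_UN fmeasurableD) auto
  also have "\<dots> \<le> (\<Sum>i\<in>K. measure M (E i))"
    using K E by (intro measure_UNION_le) (auto simp: fmeasurable_def)
  finally show False by simp
qed

definition torus_cell :: "nat \<Rightarrow> 'j set \<Rightarrow> ('j \<Rightarrow> 'a::euclidean_space) \<Rightarrow> 'a \<Rightarrow> 'j \<Rightarrow> nat" where
  "torus_cell N J u x = (\<lambda>j\<in>J. nat \<lfloor>real N * frac (x \<bullet> u j)\<rfloor>)"

lemma torus_cell_in_PiE:
  assumes "0 < N"
  shows "torus_cell N J u x \<in> PiE J (\<lambda>_. {..<N})"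
proof -
  have "nat \<lfloor>real N * frac (x \<bullet> u j)\<rfloor> < N" for j
    using assms frac_lt_1[of "x \<bullet> u j"] by (simp add: nat_less_iff floor_less_iff)
  then show ?thesis by (simp add: torus_cell_def)
qed

lemma diff_in_bohr_set_if_torus_cell_eq:
  assumes N: "0 < N" and eq: "torus_cell N J u x = torus_cell N J u y"
  shows "x - y \<in> bohr_set J u (1 / real N)"
proof -
  have "\<bar>(x - y) \<bullet> u j - of_int (\<lfloor>x \<bullet> u j\<rfloor> - \<lfloor>y \<bullet> u j\<rfloor>)\<bar> \<le> 1 / real N" if j: "j \<in> J" for j
  proof -
    let ?f = "frac (x \<bullet> u j)" and ?g = "frac (y \<bullet> u j)"
    have "nat \<lfloor>real N * ?f\<rfloor> = nat \<lfloor>real N * ?g\<rfloor>"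
      using fun_cong[OF eq, of j] j by (simp add: torus_cell_def)
    then have "\<lfloor>real N * ?f\<rfloor> = \<lfloor>real N * ?g\<rfloor>" by (simp add: eq_nat_nat_iff)
    then have "\<bar>real N * ?f - real N * ?g\<bar> \<le> 1" by linarith
    then have "real N * \<bar>?f - ?g\<bar> \<le> 1" by (simp add: right_diff_distrib[symmetric] abs_mult)
    then have "\<bar>?f - ?g\<bar> \<le> 1 / real N" using N by (simp add: field_simps)
    moreover have "(x - y) \<bullet> u j - of_int (\<lfloor>x \<bullet> u j\<rfloor> - \<lfloor>y \<bullet> u j\<rfloor>) = ?f - ?g"
      by (simp add: frac_def inner_diff_left)
    ultimately show ?thesis by simp
  qed
  then show ?thesis unfolding bohr_set_def by blast
qed

lemma torus_cell_fiber_lmeasurable: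
  fixes u :: "'j \<Rightarrow> 'a::euclidean_space"
  assumes J: "finite J" and \<kappa>: "\<kappa> \<in> PiE J A"
  shows "{x \<in> ball 0 r. torus_cell N J u x = \<kappa>} \<in> lmeasurable"
proof (rule bounded_set_imp_lmeasurable)
  show "bounded {x \<in> ball 0 r. torus_cell N J u x = \<kappa>}"
    by (rule bounded_subset[OF bounded_ball[of 0 r]]) auto
  have "{x \<in> ball 0 r. torus_cell N J u x = \<kappa>}
      = ball 0 r \<inter> {x \<in> space borel. \<forall>j\<in>J. nat \<lfloor>real N * frac (x \<bullet> u j)\<rfloor> = \<kappa> j}"
    using PiE_arb[OF \<kappa>] by (auto simp: torus_cell_def fun_eq_iff)
  also have "\<dots> \<in> sets borel" using J unfolding frac_def by measurable
  finally show "{x \<in> ball 0 r. torus_cell N J u x = \<kappa>} \<in> sets lebesgue" by simp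
qed

text \<open>Pigeonhole: one cell of the torus contains a fraction of at least \<open>N\<close> to the power
  minus \<open>card J\<close> of the ball, and differences of points of a cell lie in the Bohr set.\<close>

lemma measure_bohr_ball_ge:
  fixes u :: "'j \<Rightarrow> 'a::euclidean_space"
  assumes J: "finite J" and N: "0 < N"
  shows "measure lborel (ball (0::'a) (R / 2)) / real N ^ card J
    \<le> measure lborel (bohr_set J u (1 / real N) \<inter> ball 0 R)"
proof -
  define E where "E = (\<lambda>\<kappa>. {x \<in> ball (0::'a) (R / 2). torus_cell N J u x = \<kappa>})"
  define X where "X = bohr_set J u (1 / real N) \<inter> ball 0 R"
  let ?K = "PiE J (\<lambda>_. {..<N})"
  have K: "finite ?K" "?K \<noteq> {}" using J N by (auto simp: PiE_eq_empty_iff intro: finite_PiE)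
  have ball: "ball (0::'a) (R / 2) \<in> lmeasurable" by simp
  have X: "X \<in> lmeasurable" "X \<in> sets borel"
    unfolding X_def using J by (auto intro!: bounded_set_imp_lmeasurable bounded_Int)
  have E: "E \<kappa> \<in> lmeasurable" if "\<kappa> \<in> ?K" for \<kappa>
    unfolding E_def using J that by (rule torus_cell_fiber_lmeasurable)
  have cover: "ball 0 (R / 2) \<subseteq> (\<Union>\<kappa>\<in>?K. E \<kappa>)"
  proof
    fix x :: 'a assume "x \<in> ball 0 (R / 2)"
    then have "x \<in> E (torus_cell N J u x)" by (simp add: E_def)
    then show "x \<in> (\<Union>\<kappa>\<in>?K. E \<kappa>)" by (rule UN_I[OF torus_cell_in_PiE[OF N]])
  qed
  obtain \<kappa> where \<kappa>: "\<kappa> \<in> ?K"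
    "measure lebesgue (ball (0::'a) (R / 2)) / real (card ?K) \<le> measure lebesgue (E \<kappa>)"
    using exists_measure_ge_average[OF K ball E cover] by blast
  note \<kappa>(2)
  also have "measure lebesgue (E \<kappa>) \<le> measure lebesgue X"
  proof (cases "E \<kappa> = {}")
    case False
    then obtain y where y: "y \<in> E \<kappa>" by blast
    have "x - y \<in> X" if "x \<in> E \<kappa>" for x
      using that y norm_triangle_ineq4[of x y] diff_in_bohr_set_if_torus_cell_eq[OF N, of J u x y]
      by (auto simp: E_def X_def)
    then have "E \<kappa> \<subseteq> (+) y ` X" by (force intro: image_eqI[of _ _ "_ - y"])
    then have "measure lebesgue (E \<kappa>) \<le> measure lebesgue ((+) y ` X)"
      using E[OF \<kappa>(1)] X(1) by (intro measure_mono_fmeasurable measurable_translation) auto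
    then show ?thesis by (simp add: measure_translation)
  qed simp
  finally show ?thesis using J X(2) by (simp add: X_def[symmetric] card_PiE)
qed

section \<open>Exponential sums\<close>

definition trig_sum :: "'j set \<Rightarrow> nat \<Rightarrow> ('j \<Rightarrow> 'a::euclidean_space) \<Rightarrow> 'a \<Rightarrow> complex" where
  "trig_sum J L u x = (\<Sum>a\<in>PiE J (\<lambda>_. {..<L}). cis (2 * pi * (\<Sum>j\<in>J. real (a j) * (x \<bullet> u j))))"

lemma trig_sum_continuous: "continuous_on UNIV (trig_sum J L u)"
  unfolding trig_sum_def[abs_def] by (intro continuous_intros)

lemma prod_cis: "finite J \<Longrightarrow> (\<Prod>j\<in>J. cis (f j)) = cis (\<Sum>j\<in>J. f j)"
  by (induction J rule: finite_induct) (auto simp: cis_mult)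

lemma trig_sum_prod:
  assumes "finite J"
  shows "trig_sum J L u x = (\<Prod>j\<in>J. \<Sum>t<L. cis (2 * pi * (real t * (x \<bullet> u j))))"
proof -
  have "(\<Prod>j\<in>J. \<Sum>t<L. cis (2 * pi * (real t * (x \<bullet> u j)))) =
      (\<Sum>a\<in>PiE J (\<lambda>_. {..<L}). \<Prod>j\<in>J. cis (2 * pi * (real (a j) * (x \<bullet> u j))))"
    using assms by (intro prod_sum_PiE) auto
  then show ?thesis using assms by (simp add: trig_sum_def prod_cis sum_distrib_left)
qed

lemma cos_ge_half_near_int:
  fixes k :: int
  assumes "\<bar>y - of_int k\<bar> \<le> 1 / 6"
  shows "1 / 2 \<le> cos (2 * pi * y)"
proof -
  have "cos (pi / 3) \<le> cos \<bar>2 * pi * (y - of_int k)\<bar>"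
    using assms by (intro cos_monotone_0_pi_le) (auto simp: abs_mult)
  also have "\<dots> = cos (2 * pi * y - 2 * pi * of_int k)" by (simp add: right_diff_distrib)
  also have "\<dots> = cos (2 * pi * y)"
    using cos_int_2pin[of k] sin_int_2pin[of k] by (simp add: cos_diff)
  finally show ?thesis by (simp add: cos_60)
qed

lemma norm_cis_sum_ge:
  fixes k :: int
  assumes y: "\<bar>y - of_int k\<bar> \<le> \<epsilon>" and \<epsilon>: "6 * real L * \<epsilon> \<le> 1"
  shows "real L / 2 \<le> cmod (\<Sum>t<L. cis (2 * pi * (real t * y)))"
proof -
  have "real L / 2 = (\<Sum>t<L. 1/2)" by simp
  also have "\<dots> \<le> (\<Sum>t<L. Re (cis (2 * pi * (real t * y))))"
  proof (rule sum_mono)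
    fix t assume t: "t \<in> {..<L}"
    have "\<bar>real t * (y - of_int k)\<bar> \<le> real L * \<epsilon>"
      unfolding abs_mult using t y by (intro mult_mono) auto
    then have "\<bar>real t * y - of_int (int t * k)\<bar> \<le> 1 / 6" using \<epsilon> by (simp add: right_diff_distrib)
    then show "1 / 2 \<le> Re (cis (2 * pi * (real t * y)))" by (simp only: cos_ge_half_near_int cis.sel)
  qed
  also have "\<dots> = Re (\<Sum>t<L. cis (2 * pi * (real t * y)))" by simp
  also have "\<dots> \<le> cmod (\<Sum>t<L. cis (2 * pi * (real t * y)))" by (rule complex_Re_le_cmod)
  finally show ?thesis .
qed

lemma norm_trig_sum_ge_on_bohr_set:
  assumes J: "finite J" and x: "x \<in> bohr_set J u \<epsilon>" and \<epsilon>: "6 * real L * \<epsilon> \<le> 1"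
  shows "(real L / 2) ^ card J \<le> cmod (trig_sum J L u x)"
proof -
  have "(real L / 2) ^ card J = (\<Prod>j\<in>J. real L / 2)" by simp
  also have "\<dots> \<le> (\<Prod>j\<in>J. cmod (\<Sum>t<L. cis (2 * pi * (real t * (x \<bullet> u j)))))"
  proof (rule prod_mono)
    fix j assume "j \<in> J"
    then obtain k :: int where "\<bar>x \<bullet> u j - of_int k\<bar> \<le> \<epsilon>" using x by (auto simp: bohr_set_def)
    from norm_cis_sum_ge[OF this \<epsilon>]
    show "0 \<le> real L / 2 \<and> real L / 2 \<le> cmod (\<Sum>t<L. cis (2 * pi * (real t * (x \<bullet> u j))))" by simp
  qed
  also have "\<dots> = cmod (trig_sum J L u x)" using J by (simp add: trig_sum_prod prod_norm)
  finally show ?thesis .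
qed

section \<open>Gaussian averages along lines\<close>

abbreviation gauss :: "real measure" where "gauss \<equiv> std_normal_distribution"

interpretation gauss: prob_space gauss by (rule prob_space_normal_density) simp

lemma measure_gauss_central_ge: "3 / 4 \<le> measure gauss {-2..2}"
proof -
  have second_moment: "integrable gauss (\<lambda>z. z\<^sup>2)" "(LINT z|gauss. z\<^sup>2) = 1"
    using std_normal_distribution_even_moments[of 1] by (simp_all add: fact_2)
  have "measure gauss {z \<in> space gauss. 4 \<le> z\<^sup>2} \<le> (LINT z|gauss. z\<^sup>2) / 4"
    by (rule integral_Markov_inequality_measure[OF second_moment(1) sets.empty_sets]) auto
  moreover have "measure gauss (space gauss - {z \<in> space gauss. 4 \<le> z\<^sup>2})
      = 1 - measure gauss {z \<in> space gauss. 4 \<le> z\<^sup>2}"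
    by (rule gauss.prob_compl) measurable
  moreover have "measure gauss (space gauss - {z \<in> space gauss. 4 \<le> z\<^sup>2}) \<le> measure gauss {-2..2}"
  proof (rule gauss.finite_measure_mono)
    show "space gauss - {z \<in> space gauss. 4 \<le> z\<^sup>2} \<subseteq> {-2..2}"
    proof
      fix z assume "z \<in> space gauss - {z \<in> space gauss. 4 \<le> z\<^sup>2}"
      then have "\<bar>z\<bar>\<^sup>2 < 2\<^sup>2" by simp
      then have "\<bar>z\<bar> < 2" by (rule power2_less_imp_less) simp
      then show "z \<in> {-2..2}" by auto
    qed
  qed simp
  ultimately show ?thesis using second_moment(2) by simp
qed

lemma integrable_gauss_cis: "integrable gauss (\<lambda>z. cis (\<alpha> + t * z))"
proof (rule gauss.integrable_const_bound[where B = 1])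
  have "continuous_on UNIV (\<lambda>z. cis (\<alpha> + t * z))" by (intro continuous_intros)
  then show "(\<lambda>z. cis (\<alpha> + t * z)) \<in> borel_measurable gauss"
    by (simp add: borel_measurable_continuous_onI)
qed simp

lemma norm_gauss_cis_integral: "cmod (LINT z|gauss. cis (\<alpha> + t * z)) = exp (- t\<^sup>2 / 2)"
proof -
  have "(LINT z|gauss. cis (\<alpha> + t * z)) = cis \<alpha> * (LINT z|gauss. cis (t * z))"
    by (simp flip: cis_mult)
  also have "(LINT z|gauss. cis (t * z)) = char gauss t"
    unfolding char_def by (intro Bochner_Integration.integral_cong) (auto simp: cis_conv_exp)
  finally show ?thesis by (simp add: char_std_normal_distribution norm_mult)
qed

lemma gauss_average_exponential_sum:
  fixes A :: "'i set" and \<phi> \<theta> :: "'i \<Rightarrow> real"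
  defines "F \<equiv> \<lambda>z. (cmod (\<Sum>a\<in>A. cis (\<phi> a + \<theta> a * z)))\<^sup>2"
  shows "integrable gauss F" "(LINT z|gauss. F z) \<le> (\<Sum>a\<in>A. \<Sum>a'\<in>A. exp (- (\<theta> a - \<theta> a')\<^sup>2 / 2))"
proof -
  have F: "complex_of_real (F z) = (\<Sum>a\<in>A. \<Sum>a'\<in>A. cis ((\<phi> a - \<phi> a') + (\<theta> a - \<theta> a') * z))" for z
  proof -
    have "complex_of_real (F z) = (\<Sum>a\<in>A. cis (\<phi> a + \<theta> a * z)) * cnj (\<Sum>a\<in>A. cis (\<phi> a + \<theta> a * z))"
      unfolding F_def by (rule complex_norm_square)
    also have "\<dots> = (\<Sum>a\<in>A. \<Sum>a'\<in>A. cis (\<phi> a + \<theta> a * z) * cis (- (\<phi> a' + \<theta> a' * z)))"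
      by (simp add: sum_product cis_cnj)
    also have "\<dots> = (\<Sum>a\<in>A. \<Sum>a'\<in>A. cis ((\<phi> a - \<phi> a') + (\<theta> a - \<theta> a') * z))"
      by (intro sum.cong refl) (simp add: cis_mult algebra_simps)
    finally show ?thesis .
  qed
  have "integrable gauss (\<lambda>z. complex_of_real (F z))"
    unfolding F by (intro Bochner_Integration.integrable_sum integrable_gauss_cis)
  then show "integrable gauss F" using integrable_Re by fastforce
  have "(LINT z|gauss. F z) = Re (LINT z|gauss. complex_of_real (F z))"
    by (subst integral_complex_of_real) simp
  also have "\<dots> \<le> cmod (LINT z|gauss. complex_of_real (F z))" by (rule complex_Re_le_cmod)
  also have "(LINT z|gauss. complex_of_real (F z))
      = (\<Sum>a\<in>A. \<Sum>a'\<in>A. (LINT z|gauss. cis ((\<phi> a - \<phi> a') + (\<theta> a - \<theta> a') * z)))"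
    unfolding F
    by (simp add: Bochner_Integration.integral_sum integrable_gauss_cis Bochner_Integration.integrable_sum)
  also have "cmod \<dots> \<le> (\<Sum>a\<in>A. \<Sum>a'\<in>A. exp (- (\<theta> a - \<theta> a')\<^sup>2 / 2))"
    by (rule order_trans[OF norm_sum sum_mono[OF order_trans[OF norm_sum sum_mono]]])
      (simp only: norm_gauss_cis_integral order_refl)
  finally show "(LINT z|gauss. F z) \<le> (\<Sum>a\<in>A. \<Sum>a'\<in>A. exp (- (\<theta> a - \<theta> a')\<^sup>2 / 2))" .
qed

lemma sum_gaussian_le_count:
  assumes A: "finite A" and \<eta>: "0 \<le> \<eta>" and t: "0 \<le> t"
    and count: "card {a \<in> A. \<bar>\<theta> a - \<theta>\<^sub>0\<bar> \<le> \<eta>} \<le> N"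
  shows "(\<Sum>a\<in>A. exp (- (2 * pi * t * (\<theta>\<^sub>0 - \<theta> a))\<^sup>2 / 2)) \<le> real N + real (card A) * exp (- (t * \<eta>)\<^sup>2)"
proof -
  have "exp (- (2 * pi * t * (\<theta>\<^sub>0 - \<theta> a))\<^sup>2 / 2)
      \<le> (if \<bar>\<theta> a - \<theta>\<^sub>0\<bar> \<le> \<eta> then 1 else 0) + exp (- (t * \<eta>)\<^sup>2)" for a
  proof (cases "\<bar>\<theta> a - \<theta>\<^sub>0\<bar> \<le> \<eta>")
    case True
    have "exp (- (2 * pi * t * (\<theta>\<^sub>0 - \<theta> a))\<^sup>2 / 2) \<le> 1" by simp
    then show ?thesis using exp_gt_zero[of "- (t * \<eta>)\<^sup>2"] unfolding if_P[OF True] by linarith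
  next
    case False
    have "(t * \<eta>)\<^sup>2 \<le> (t * \<bar>\<theta>\<^sub>0 - \<theta> a\<bar>)\<^sup>2"
      using False t \<eta> by (intro power_mono mult_left_mono) auto
    also have "\<dots> = 1 * (t * (\<theta>\<^sub>0 - \<theta> a))\<^sup>2" by (simp add: power_mult_distrib)
    also have "\<dots> \<le> (2 * pi\<^sup>2) * (t * (\<theta>\<^sub>0 - \<theta> a))\<^sup>2"
    proof (rule mult_right_mono)
      have "1\<^sup>2 \<le> pi\<^sup>2" using pi_gt3 by (intro power_mono) auto
      then show "1 \<le> 2 * pi\<^sup>2" by simp
    qed simp
    also have "\<dots> = (2 * pi * t * (\<theta>\<^sub>0 - \<theta> a))\<^sup>2 / 2" by (simp add: power_mult_distrib)
    finally show ?thesis using False by simp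
  qed
  then have "(\<Sum>a\<in>A. exp (- (2 * pi * t * (\<theta>\<^sub>0 - \<theta> a))\<^sup>2 / 2))
      \<le> (\<Sum>a\<in>A. (if \<bar>\<theta> a - \<theta>\<^sub>0\<bar> \<le> \<eta> then 1 else 0) + exp (- (t * \<eta>)\<^sup>2))"
    by (rule sum_mono)
  also have "\<dots> = real (card {a \<in> A. \<bar>\<theta> a - \<theta>\<^sub>0\<bar> \<le> \<eta>}) + real (card A) * exp (- (t * \<eta>)\<^sup>2)"
    using A by (simp add: sum.distrib sum.If_cases Int_def)
  finally show ?thesis using count by simp
qed

definition resonances ::
  "'j set \<Rightarrow> nat \<Rightarrow> ('j \<Rightarrow> 'a::euclidean_space) \<Rightarrow> real \<Rightarrow> 'a \<Rightarrow> real \<Rightarrow> ('j \<Rightarrow> nat) set" where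
  "resonances J L u \<eta> \<nu> \<theta> =
     {a \<in> PiE J (\<lambda>_. {..<L}). \<bar>(\<Sum>j\<in>J. real (a j) * (\<nu> \<bullet> u j)) - \<theta>\<bar> \<le> \<eta>}"

definition nonresonant ::
  "'j set \<Rightarrow> nat \<Rightarrow> ('j \<Rightarrow> 'a::euclidean_space) \<Rightarrow> real \<Rightarrow> nat \<Rightarrow> bool" where
  "nonresonant J L u \<eta> N \<longleftrightarrow> (\<forall>\<nu> \<theta>. norm \<nu> = 1 \<longrightarrow> card (resonances J L u \<eta> \<nu> \<theta>) \<le> N)"

lemma gauss_average_trig_sum_le:
  fixes \<nu> x :: "'a::euclidean_space"
  assumes J: "finite J" and count: "\<And>\<theta>. card (resonances J L u \<eta> \<nu> \<theta>) \<le> N"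
    and R: "0 \<le> R" and \<eta>: "0 \<le> \<eta>"
  shows "(\<integral>\<^sup>+z. ennreal ((cmod (trig_sum J L u (x + (R * z) *\<^sub>R \<nu>)))\<^sup>2) \<partial>gauss)
    \<le> ennreal (real L ^ card J * (real N + real L ^ card J * exp (- (R * \<eta>)\<^sup>2)))"
proof -
  define A where "A = PiE J (\<lambda>_. {..<L})"
  define \<phi> where "\<phi> = (\<lambda>a::'b \<Rightarrow> nat. 2 * pi * (\<Sum>j\<in>J. real (a j) * (x \<bullet> u j)))"
  define \<theta> where "\<theta> = (\<lambda>a::'b \<Rightarrow> nat. \<Sum>j\<in>J. real (a j) * (\<nu> \<bullet> u j))"
  have A: "finite A" "card A = L ^ card J"
    unfolding A_def using J by (auto simp: card_PiE intro: finite_PiE)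
  have phase: "2 * pi * (\<Sum>j\<in>J. real (a j) * ((x + (R * z) *\<^sub>R \<nu>) \<bullet> u j))
      = \<phi> a + (2 * pi * R * \<theta> a) * z" for a z
  proof -
    have "(\<Sum>j\<in>J. real (a j) * ((x + (R * z) *\<^sub>R \<nu>) \<bullet> u j)) = (\<Sum>j\<in>J. real (a j) * (x \<bullet> u j)) + R * z * \<theta> a"
      unfolding \<theta>_def by (simp add: inner_add_left sum.distrib sum_distrib_left algebra_simps)
    then show ?thesis by (simp add: \<phi>_def algebra_simps)
  qed
  have trig: "trig_sum J L u (x + (R * z) *\<^sub>R \<nu>) = (\<Sum>a\<in>A. cis (\<phi> a + (2 * pi * R * \<theta> a) * z))" for z
    unfolding trig_sum_def A_def[symmetric] phase ..
  have "(LINT z|gauss. (cmod (trig_sum J L u (x + (R * z) *\<^sub>R \<nu>)))\<^sup>2)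
      \<le> (\<Sum>a\<in>A. \<Sum>a'\<in>A. exp (- (2 * pi * R * \<theta> a - 2 * pi * R * \<theta> a')\<^sup>2 / 2))"
    unfolding trig by (rule gauss_average_exponential_sum(2))
  also have "\<dots> \<le> (\<Sum>a\<in>A. real N + real (card A) * exp (- (R * \<eta>)\<^sup>2))"
    unfolding right_diff_distrib[symmetric]
    using count by (intro sum_mono sum_gaussian_le_count A(1) R \<eta>) (simp add: resonances_def A_def \<theta>_def)
  also have "\<dots> = real L ^ card J * (real N + real L ^ card J * exp (- (R * \<eta>)\<^sup>2))" by (simp add: A(2))
  finally show ?thesis
    using gauss_average_exponential_sum(1)[where A = A and \<phi> = \<phi> and \<theta> = "\<lambda>a. 2 * pi * R * \<theta> a"]
    by (subst nn_integral_eq_integral) (auto simp: trig intro: ennreal_leI)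
qed

section \<open>Tubes\<close>

lemma open_tube: "open (tube a \<nu>)"
  unfolding tube_def by (intro open_Collect_less continuous_intros)

lemma tube_borel [measurable]: "tube a \<nu> \<in> sets borel"
  using open_tube by (rule borel_open)

lemma add_scaleR_axis_mem_tube_iff:
  assumes "norm \<nu> = 1"
  shows "t *\<^sub>R \<nu> + x \<in> tube a \<nu> \<longleftrightarrow> x \<in> tube a \<nu>"
proof -
  have "\<nu> \<bullet> \<nu> = 1" using assms by (simp add: norm_eq_1)
  then have "(t *\<^sub>R \<nu> + x - a) - ((t *\<^sub>R \<nu> + x - a) \<bullet> \<nu>) *\<^sub>R \<nu> = (x - a) - ((x - a) \<bullet> \<nu>) *\<^sub>R \<nu>"
    by (simp add: inner_simps algebra_simps)
  then show ?thesis by (simp only: tube_def mem_Collect_eq)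
qed

lemma tube_ball_subset_balls:
  fixes \<nu> :: "'a::euclidean_space"
  assumes \<nu>: "norm \<nu> = 1" and R: "0 < R"
  shows "tube a \<nu> \<inter> ball 0 R \<subseteq> (\<Union>j\<in>{- \<lceil>R\<rceil>..\<lceil>R\<rceil>}. ball (a - (a \<bullet> \<nu>) *\<^sub>R \<nu> + of_int j *\<^sub>R \<nu>) 2)"
proof
  fix x assume x: "x \<in> tube a \<nu> \<inter> ball 0 R"
  define j where "j = \<lfloor>x \<bullet> \<nu>\<rfloor>"
  define c where "c = a - (a \<bullet> \<nu>) *\<^sub>R \<nu> + of_int j *\<^sub>R \<nu>"
  have "\<bar>x \<bullet> \<nu>\<bar> < R" using Cauchy_Schwarz_ineq2[of x \<nu>] x \<nu> by simp
  then have j: "j \<in> {- \<lceil>R\<rceil>..\<lceil>R\<rceil>}" unfolding j_def by (auto; linarith)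
  have "x - c = ((x - a) - ((x - a) \<bullet> \<nu>) *\<^sub>R \<nu>) + (x \<bullet> \<nu> - of_int j) *\<^sub>R \<nu>"
    by (simp add: c_def algebra_simps)
  also have "norm \<dots> \<le> norm ((x - a) - ((x - a) \<bullet> \<nu>) *\<^sub>R \<nu>) + norm ((x \<bullet> \<nu> - of_int j) *\<^sub>R \<nu>)"
    by (rule norm_triangle_ineq)
  also have "\<dots> < 1 + 1"
  proof (rule add_less_le_mono)
    show "norm ((x - a) - ((x - a) \<bullet> \<nu>) *\<^sub>R \<nu>) < 1" using x by (simp add: tube_def)
    show "norm ((x \<bullet> \<nu> - of_int j) *\<^sub>R \<nu>) \<le> 1" unfolding j_def using \<nu> by simp linarith
  qed
  finally have "x \<in> ball c 2" by (simp add: dist_norm norm_minus_commute)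
  with j show "x \<in> (\<Union>j\<in>{- \<lceil>R\<rceil>..\<lceil>R\<rceil>}. ball (a - (a \<bullet> \<nu>) *\<^sub>R \<nu> + of_int j *\<^sub>R \<nu>) 2)"
    by (auto simp: c_def)
qed

lemma emeasure_tube_ball_le:
  fixes \<nu> :: "'a::euclidean_space"
  assumes \<nu>: "norm \<nu> = 1" and R: "1 \<le> R"
  shows "emeasure lborel (tube a \<nu> \<inter> ball 0 R) \<le> ennreal (5 * R * measure lborel (ball (0::'a) 2))"
proof -
  define c where "c = (\<lambda>j::int. a - (a \<bullet> \<nu>) *\<^sub>R \<nu> + of_int j *\<^sub>R \<nu>)"
  have ball: "emeasure lborel (ball c 2) = ennreal (measure lborel (ball (0::'a) 2))" for c :: 'a
    by (simp add: emeasure_ball content_ball)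
  have "emeasure lborel (tube a \<nu> \<inter> ball 0 R) \<le> emeasure lborel (\<Union>j\<in>{- \<lceil>R\<rceil>..\<lceil>R\<rceil>}. ball (c j) 2)"
    using tube_ball_subset_balls[OF \<nu>, of R a] R unfolding c_def by (intro emeasure_mono) auto
  also have "\<dots> \<le> (\<Sum>j\<in>{- \<lceil>R\<rceil>..\<lceil>R\<rceil>}. emeasure lborel (ball (c j) 2))"
    by (intro emeasure_subadditive_finite) auto
  also have "\<dots> = ennreal (real (nat (2 * \<lceil>R\<rceil> + 1)) * measure lborel (ball (0::'a) 2))"
    unfolding ball by (simp add: ennreal_mult' ennreal_of_nat_eq_real_of_nat)
  also have "\<dots> \<le> ennreal (5 * R * measure lborel (ball (0::'a) 2))"
  proof (intro ennreal_leI mult_right_mono)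
    have "real (nat (2 * \<lceil>R\<rceil> + 1)) = 2 * of_int \<lceil>R\<rceil> + 1" using R by simp
    also have "of_int \<lceil>R\<rceil> \<le> R + 1" by linarith
    finally show "real (nat (2 * \<lceil>R\<rceil> + 1)) \<le> 5 * R" using R by simp
  qed simp
  finally show ?thesis .
qed

lemma nn_integral_tube_le_translate:
  fixes \<nu> :: "'a::euclidean_space" and h :: "'a \<Rightarrow> ennreal"
  assumes \<nu>: "norm \<nu> = 1" and h [measurable]: "h \<in> borel_measurable borel" and t: "\<bar>t\<bar> \<le> 2 * R"
  shows "(\<integral>\<^sup>+x. indicator (tube a \<nu> \<inter> ball 0 R) x * h x \<partial>lborel)
    \<le> (\<integral>\<^sup>+x. indicator (tube a \<nu> \<inter> ball 0 (3 * R)) x * h (x + t *\<^sub>R \<nu>) \<partial>lborel)"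
proof -
  have [measurable]: "tube a \<nu> \<inter> ball 0 r \<in> sets borel" for r by (intro sets.Int tube_borel borel_open) auto
  have "(\<integral>\<^sup>+x. indicator (tube a \<nu> \<inter> ball 0 R) x * h x \<partial>lborel)
      = (\<integral>\<^sup>+x. indicator (tube a \<nu> \<inter> ball 0 R) x * h x \<partial>distr lborel borel ((+) (t *\<^sub>R \<nu>)))"
    by (simp add: lborel_distr_plus)
  also have "\<dots> = (\<integral>\<^sup>+x. indicator (tube a \<nu> \<inter> ball 0 R) (t *\<^sub>R \<nu> + x) * h (t *\<^sub>R \<nu> + x) \<partial>lborel)"
    by (subst nn_integral_distr) auto
  also have "\<dots> \<le> (\<integral>\<^sup>+x. indicator (tube a \<nu> \<inter> ball 0 (3 * R)) x * h (x + t *\<^sub>R \<nu>) \<partial>lborel)"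
  proof (rule nn_integral_mono)
    fix x
    have "x \<in> ball 0 (3 * R)" if "t *\<^sub>R \<nu> + x \<in> ball 0 R"
      using that t \<nu> norm_triangle_ineq4[of "t *\<^sub>R \<nu> + x" "t *\<^sub>R \<nu>"] by simp
    then show "indicator (tube a \<nu> \<inter> ball 0 R) (t *\<^sub>R \<nu> + x) * h (t *\<^sub>R \<nu> + x)
        \<le> indicator (tube a \<nu> \<inter> ball 0 (3 * R)) x * h (x + t *\<^sub>R \<nu>)"
      using add_scaleR_axis_mem_tube_iff[OF \<nu>] by (auto simp: indicator_def add.commute)
  qed
  finally show ?thesis .
qed

text \<open>The tube is invariant under translation along its axis, so averaging over Gaussian
  translates reduces the integral over the tube to an integral along lines.\<close>

lemma nn_integral_tube_le_gauss_average:
  fixes \<nu> :: "'a::euclidean_space" and h :: "'a \<Rightarrow> ennreal"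
  assumes \<nu>: "norm \<nu> = 1" and h [measurable]: "h \<in> borel_measurable borel" and R: "0 \<le> R"
    and average: "\<And>x. (\<integral>\<^sup>+z. h (x + (R * z) *\<^sub>R \<nu>) \<partial>gauss) \<le> B"
  shows "ennreal (3 / 4) * (\<integral>\<^sup>+x. indicator (tube a \<nu> \<inter> ball 0 R) x * h x \<partial>lborel)
    \<le> B * emeasure lborel (tube a \<nu> \<inter> ball 0 (3 * R))"
proof -
  let ?T = "\<lambda>R. tube a \<nu> \<inter> ball (0::'a) R"
  define I where "I = (\<integral>\<^sup>+x. indicator (?T R) x * h x \<partial>lborel)"
  have [measurable]: "?T r \<in> sets borel" for r by (intro sets.Int tube_borel borel_open) auto
  have joint [measurable]: "(\<lambda>(z, x). indicator (?T (3 * R)) x * h (x + (R * z) *\<^sub>R \<nu>)) \<in>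
      borel_measurable (gauss \<Otimes>\<^sub>M lborel)"
    by measurable
  interpret pair_sigma_finite gauss "lborel :: 'a measure" ..
  have "ennreal (3 / 4) * I \<le> emeasure gauss {-2..2} * I"
    using measure_gauss_central_ge unfolding gauss.emeasure_eq_measure
    by (intro mult_right_mono ennreal_leI) auto
  also have "\<dots> = (\<integral>\<^sup>+z. indicator {-2..2} z * I \<partial>gauss)"
    by (subst nn_integral_multc) auto
  also have "\<dots> \<le> (\<integral>\<^sup>+z. (\<integral>\<^sup>+x. indicator (?T (3 * R)) x * h (x + (R * z) *\<^sub>R \<nu>) \<partial>lborel) \<partial>gauss)"
  proof (rule nn_integral_mono)
    fix z :: real
    have "\<bar>R * z\<bar> \<le> 2 * R" if "z \<in> {-2..2}"
      using that R mult_left_mono[of "\<bar>z\<bar>" 2 R] by (auto simp: abs_mult abs_le_iff)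
    then show "indicator {-2..2} z * I \<le> (\<integral>\<^sup>+x. indicator (?T (3 * R)) x * h (x + (R * z) *\<^sub>R \<nu>) \<partial>lborel)"
      using nn_integral_tube_le_translate[OF \<nu> h] by (auto simp: indicator_def[of "{-2..2}"] I_def)
  qed
  also have "\<dots> = (\<integral>\<^sup>+x. (\<integral>\<^sup>+z. indicator (?T (3 * R)) x * h (x + (R * z) *\<^sub>R \<nu>) \<partial>gauss) \<partial>lborel)"
    using Fubini[OF joint] by simp
  also have "\<dots> \<le> (\<integral>\<^sup>+x. B * indicator (?T (3 * R)) x \<partial>lborel)"
  proof (rule nn_integral_mono)
    fix x
    show "(\<integral>\<^sup>+z. indicator (?T (3 * R)) x * h (x + (R * z) *\<^sub>R \<nu>) \<partial>gauss) \<le> B * indicator (?T (3 * R)) x"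
      using average[of x] by (cases "x \<in> ?T (3 * R)") auto
  qed
  also have "\<dots> = B * emeasure lborel (?T (3 * R))" by (intro nn_integral_cmult_indicator) simp
  finally show ?thesis by (simp only: I_def)
qed

lemma emeasure_bohr_set_le_nn_integral_trig_sum:
  fixes u :: "'j \<Rightarrow> 'a::euclidean_space"
  assumes J: "finite J" and \<epsilon>: "6 * real L * \<epsilon> \<le> 1" and T: "T \<in> sets borel"
  shows "ennreal (((real L / 2) ^ card J)\<^sup>2) * emeasure lborel (bohr_set J u \<epsilon> \<inter> T)
    \<le> (\<integral>\<^sup>+x. indicator T x * ennreal ((cmod (trig_sum J L u x))\<^sup>2) \<partial>lborel)"
proof -
  let ?c = "(real L / 2) ^ card J"
  have "ennreal (?c\<^sup>2) * emeasure lborel (bohr_set J u \<epsilon> \<inter> T)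
      = (\<integral>\<^sup>+x. ennreal (?c\<^sup>2) * indicator (bohr_set J u \<epsilon> \<inter> T) x \<partial>lborel)"
    using J T by (intro nn_integral_cmult_indicator[symmetric]) auto
  also have "\<dots> \<le> (\<integral>\<^sup>+x. indicator T x * ennreal ((cmod (trig_sum J L u x))\<^sup>2) \<partial>lborel)"
  proof (rule nn_integral_mono)
    fix x
    have "?c\<^sup>2 \<le> (cmod (trig_sum J L u x))\<^sup>2" if "x \<in> bohr_set J u \<epsilon>"
      using norm_trig_sum_ge_on_bohr_set[OF J that \<epsilon>] by (intro power_mono) auto
    then show "ennreal (?c\<^sup>2) * indicator (bohr_set J u \<epsilon> \<inter> T) x
        \<le> indicator T x * ennreal ((cmod (trig_sum J L u x))\<^sup>2)"
      by (auto simp: indicator_def intro: ennreal_leI)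
  qed
  finally show ?thesis .
qed

definition bohr_tube_bound :: "real \<Rightarrow> nat \<Rightarrow> nat \<Rightarrow> nat \<Rightarrow> real \<Rightarrow> real \<Rightarrow> real" where
  "bohr_tube_bound V M L N R \<eta> =
     20 * V * R * 4 ^ M / real L ^ M * (real N + real L ^ M * exp (- (R * \<eta>)\<^sup>2))"

lemma emeasure_bohr_tube_le:
  fixes u :: "'j \<Rightarrow> 'a::euclidean_space"
  assumes J: "finite J" and \<nu>: "norm \<nu> = 1" and R: "1 \<le> R" and \<eta>: "0 \<le> \<eta>" and L: "1 \<le> L"
    and \<epsilon>: "6 * real L * \<epsilon> \<le> 1" and count: "\<And>\<theta>. card (resonances J L u \<eta> \<nu> \<theta>) \<le> N"
  shows "emeasure lborel (bohr_set J u \<epsilon> \<inter> (tube a \<nu> \<inter> ball 0 R))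
    \<le> ennreal (bohr_tube_bound (measure lborel (ball (0::'a) 2)) (card J) L N R \<eta>)"
proof -
  let ?T = "\<lambda>r. tube a \<nu> \<inter> ball (0::'a) r"
  define V where "V = measure lborel (ball (0::'a) 2)"
  define W where "W = real N + real L ^ card J * exp (- (R * \<eta>)\<^sup>2)"
  define \<mu> where "\<mu> = emeasure lborel (bohr_set J u \<epsilon> \<inter> ?T R)"
  define c where "c = (real L / 2) ^ card J"
  have c: "0 < c" using L by (simp add: c_def)
  have W: "0 \<le> W" by (simp add: W_def)
  have trig_meas: "(\<lambda>x. ennreal ((cmod (trig_sum J L u x))\<^sup>2)) \<in> borel_measurable borel"
    using borel_measurable_continuous_onI[OF trig_sum_continuous[of J L u]] by measurable
  have "ennreal (3/4 * c\<^sup>2) * \<mu> = ennreal (3/4) * (ennreal (c\<^sup>2) * \<mu>)"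
    by (subst ennreal_mult) (auto simp: mult.assoc)
  also have "\<dots> \<le> ennreal (3/4) * (\<integral>\<^sup>+x. indicator (?T R) x * ennreal ((cmod (trig_sum J L u x))\<^sup>2) \<partial>lborel)"
    unfolding c_def \<mu>_def
    by (intro mult_left_mono emeasure_bohr_set_le_nn_integral_trig_sum[OF J \<epsilon>]) auto
  also have "\<dots> \<le> ennreal (real L ^ card J * W) * emeasure lborel (?T (3 * R))"
    using gauss_average_trig_sum_le[OF J count _ \<eta>] R unfolding W_def
    by (intro nn_integral_tube_le_gauss_average[OF \<nu> trig_meas]) auto
  also have "\<dots> \<le> ennreal (real L ^ card J * W) * ennreal (5 * (3 * R) * V)"
    unfolding V_def using R by (intro mult_left_mono emeasure_tube_ball_le \<nu>) auto
  also have "\<dots> = ennreal (real L ^ card J * W * (15 * R * V))"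
    using R W by (subst ennreal_mult[symmetric]) (auto simp: V_def)
  finally have bound: "ennreal (3/4 * c\<^sup>2) * \<mu> \<le> ennreal (real L ^ card J * W * (15 * R * V))" .
  have "\<mu> = ennreal (1 / (3/4 * c\<^sup>2)) * (ennreal (3/4 * c\<^sup>2) * \<mu>)"
    using c by (simp add: mult.assoc[symmetric] ennreal_mult[symmetric])
  also have "\<dots> \<le> ennreal (1 / (3/4 * c\<^sup>2)) * ennreal (real L ^ card J * W * (15 * R * V))"
    by (intro mult_left_mono bound) simp
  also have "\<dots> = ennreal (1 / (3/4 * c\<^sup>2) * (real L ^ card J * W * (15 * R * V)))"
    using W R by (subst ennreal_mult) (auto simp: V_def)
  also have "1 / (3/4 * c\<^sup>2) * (real L ^ card J * W * (15 * R * V))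
      = 20 * V * R * 4 ^ card J / real L ^ card J * W"
  proof -
    have "c\<^sup>2 = real L ^ card J * real L ^ card J / 4 ^ card J"
      unfolding c_def by (simp add: power2_eq_square power_divide flip: power_mult_distrib)
    then show ?thesis using L by simp
  qed
  finally show ?thesis by (simp only: bohr_tube_bound_def \<mu>_def V_def W_def)
qed

section \<open>Counting in finite product sets\<close>

text \<open>Swapping the \<open>i\<close>-th coordinate of V with an independent copy is an involution.\<close>

lemma card_PiE_fiber_eq:
  fixes D :: "'i \<Rightarrow> 'd set" and Q R :: "('i \<Rightarrow> 'd) \<Rightarrow> bool"
  assumes i: "i \<in> I" and R: "\<And>V z. R (V(i := z)) = R V"
  shows "card {V \<in> PiE I D. R V \<and> Q V} * card (D i)
    = card (SIGMA V : {V \<in> PiE I D. R V}. {z \<in> D i. Q (V(i := z))})"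
proof -
  define W where "W = {V \<in> PiE I D. R V}"
  define swap where "swap = (\<lambda>(V :: 'i \<Rightarrow> 'd, z). (V(i := z), V i))"
  have W: "V(i := z) \<in> W" "V i \<in> D i" if "V \<in> W" "z \<in> D i" for V z
    using that i R by (auto simp: W_def PiE_def Pi_def extensional_def)
  have "bij_betw swap ({V \<in> W. Q V} \<times> D i) (SIGMA V : W. {z \<in> D i. Q (V(i := z))})"
    by (rule bij_betw_byWitness[where f' = swap]) (auto simp: swap_def W)
  then have "card ({V \<in> W. Q V} \<times> D i) = card (SIGMA V : W. {z \<in> D i. Q (V(i := z))})"
    by (rule bij_betw_same_card)
  moreover have "{V \<in> W. Q V} = {V \<in> PiE I D. R V \<and> Q V}" by (auto simp: W_def)
  ultimately show ?thesis by (simp add: card_cartesian_product W_def)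
qed

lemma card_PiE_fiber_le:
  fixes D :: "'i \<Rightarrow> 'd set" and Q R :: "('i \<Rightarrow> 'd) \<Rightarrow> bool"
  assumes I: "finite I" "i \<in> I" and D: "\<And>i. i \<in> I \<Longrightarrow> finite (D i)"
    and R: "\<And>V z. R (V(i := z)) = R V"
    and Q: "\<And>V. real (card {z \<in> D i. Q (V(i := z))}) \<le> c * real (card (D i))"
  shows "real (card {V \<in> PiE I D. R V \<and> Q V}) \<le> c * real (card {V \<in> PiE I D. R V})"
proof (cases "D i = {}")
  case True
  then have "PiE I D = {}" using I(2) by (auto simp: PiE_eq_empty_iff)
  then show ?thesis by simp
next
  case False
  let ?W = "{V \<in> PiE I D. R V}"
  have W: "finite ?W" using finite_PiE[OF I(1), of D] D by simp
  have "real (card {V \<in> PiE I D. R V \<and> Q V}) * real (card (D i))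
      = real (\<Sum>V\<in>?W. card {z \<in> D i. Q (V(i := z))})"
    unfolding of_nat_mult[symmetric] card_PiE_fiber_eq[where R = R and Q = Q and D = D, OF I(2) R]
    using W D I(2) by (subst card_SigmaI) auto
  also have "\<dots> \<le> (\<Sum>V\<in>?W. c * real (card (D i)))"
    unfolding of_nat_sum by (intro sum_mono Q)
  also have "\<dots> = c * real (card ?W) * real (card (D i))" by simp
  finally show ?thesis using False D[OF I(2)] by (simp add: card_gt_0_iff)
qed

definition branching_levels :: "(nat \<Rightarrow> 'b) set \<Rightarrow> nat set" where
  "branching_levels S = {j. \<exists>a\<in>S. \<exists>a'\<in>S. (\<forall>i<j. a i = a' i) \<and> a j \<noteq> a' j}"

lemma branching_levels_subset:
  assumes "S \<subseteq> PiE {..<m} B"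
  shows "branching_levels S \<subseteq> {..<m}"
proof
  fix j assume "j \<in> branching_levels S"
  then obtain a a' where "a \<in> S" "a' \<in> S" "a j \<noteq> a' j" by (auto simp: branching_levels_def)
  then show "j \<in> {..<m}" using assms by (metis PiE_arb subsetD)
qed

text \<open>Two elements of S first differ at a branching level, so an element is determined by its
  values at the branching levels.\<close>

lemma card_le_power_branching_levels:
  assumes S: "S \<subseteq> PiE {..<m} (\<lambda>_. B)" and B: "finite B"
  shows "card S \<le> card B ^ card (branching_levels S)"
proof -
  let ?J = "branching_levels S"
  have J: "?J \<subseteq> {..<m}" "finite ?J"
    using branching_levels_subset[OF S] finite_subset by auto
  have "inj_on (\<lambda>a. restrict a ?J) S"
  proof (rule inj_onI, rule ccontr)
    fix a a' assume a: "a \<in> S" "a' \<in> S" "restrict a ?J = restrict a' ?J" "a \<noteq> a'"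
    define j where "j = (LEAST j. a j \<noteq> a' j)"
    have "\<exists>j. a j \<noteq> a' j" using a(4) by (auto simp: fun_eq_iff)
    then have j: "a j \<noteq> a' j" unfolding j_def by (rule LeastI_ex)
    have "\<forall>i<j. a i = a' i" unfolding j_def by (blast dest: not_less_Least)
    then have "j \<in> ?J" using a(1,2) j unfolding branching_levels_def by blast
    then show False using fun_cong[OF a(3), of j] j by simp
  qed
  then have "card S \<le> card (PiE ?J (\<lambda>_. B))"
  proof (rule card_inj_on_le)
    show "(\<lambda>a. restrict a ?J) ` S \<subseteq> PiE ?J (\<lambda>_. B)" using S J(1) by fastforce
  qed (use J(2) B in \<open>auto intro: finite_PiE\<close>)
  then show ?thesis using J(2) by (simp add: card_PiE)
qed

lemma sum_indicator_eq_card: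
  assumes "finite U" "B \<subseteq> U"
  shows "(\<Sum>V\<in>U. indicator B V) = real (card B)"
  using assms by (simp add: indicator_def sum.If_cases Int_absorb1)

lemma sum_incidences:
  assumes U: "finite U" and E: "\<And>a. a \<in> A \<Longrightarrow> E a \<subseteq> U"
  shows "(\<Sum>V\<in>U. \<Sum>a\<in>A. indicator (E a) V) = (\<Sum>a\<in>A. real (card (E a)))"
proof -
  have "(\<Sum>V\<in>U. \<Sum>a\<in>A. indicator (E a) V) = (\<Sum>a\<in>A. \<Sum>V\<in>U. indicator (E a) V :: real)" by (rule sum.swap)
  also have "\<dots> = (\<Sum>a\<in>A. real (card (E a)))" using U E by (intro sum.cong refl sum_indicator_eq_card)
  finally show ?thesis .
qed

lemma sum_power2_incidences:
  assumes U: "finite U" and E: "\<And>a. a \<in> A \<Longrightarrow> E a \<subseteq> U"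
  shows "(\<Sum>V\<in>U. (\<Sum>a\<in>A. indicator (E a) V)\<^sup>2) = (\<Sum>a\<in>A. \<Sum>a'\<in>A. real (card (E a \<inter> E a')))"
proof -
  have "(\<Sum>V\<in>U. (\<Sum>a\<in>A. indicator (E a) V)\<^sup>2)
      = (\<Sum>V\<in>U. \<Sum>a\<in>A. \<Sum>a'\<in>A. indicator (E a \<inter> E a') V :: real)"
    unfolding power2_eq_square by (simp add: sum_product indicator_inter_arith)
  also have "\<dots> = (\<Sum>a\<in>A. \<Sum>a'\<in>A. \<Sum>V\<in>U. indicator (E a \<inter> E a') V)" by (simp add: sum.swap[of _ U])
  also have "\<dots> = (\<Sum>a\<in>A. \<Sum>a'\<in>A. real (card (E a \<inter> E a')))"
    using E by (intro sum.cong refl sum_indicator_eq_card[OF U]) blast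
  finally show ?thesis .
qed

lemma card_UN_ge_second_moment:
  fixes E :: "'a \<Rightarrow> 'g set"
  assumes fin: "finite G" "finite A" and E: "\<And>a. a \<in> A \<Longrightarrow> E a \<subseteq> G"
    and single: "\<And>a. a \<in> A \<Longrightarrow> real (card (E a)) = p * real (card G)"
    and pair: "\<And>a a'. a \<in> A \<Longrightarrow> a' \<in> A \<Longrightarrow> a \<noteq> a' \<Longrightarrow> real (card (E a \<inter> E a')) \<le> p\<^sup>2 * real (card G)"
    and mean: "1 \<le> p * real (card A)"
  shows "card G \<le> 2 * card (\<Union>a\<in>A. E a)"
proof -
  define U where "U = (\<Union>a\<in>A. E a)"
  define g where "g = real (card G)"
  define s where "s = p * real (card A)"
  have s: "1 \<le> s" using mean by (simp only: s_def)
  have U: "finite U" "\<And>a. a \<in> A \<Longrightarrow> E a \<subseteq> U" using finite_subset[of U G] fin(1) E by (auto simp: U_def)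
  have first: "(\<Sum>V\<in>U. \<Sum>a\<in>A. indicator (E a) V) = s * g"
    using sum_incidences[OF U, of A "\<lambda>a. a"] single by (simp add: s_def g_def)
  have "(\<Sum>V\<in>U. (\<Sum>a\<in>A. indicator (E a) V)\<^sup>2) = (\<Sum>a\<in>A. \<Sum>a'\<in>A. real (card (E a \<inter> E a')))"
    by (rule sum_power2_incidences[OF U])
  also have "\<dots> \<le> (\<Sum>a\<in>A. \<Sum>a'\<in>A. (if a = a' then p * g else 0) + p\<^sup>2 * g)"
    using single pair by (intro sum_mono) (auto simp: g_def)
  also have "\<dots> = real (card A) * (p * g) + real (card A) * (real (card A) * (p\<^sup>2 * g))"
    using fin(2) by (simp add: sum.distrib distrib_left)
  also have "\<dots> = s * g + s\<^sup>2 * g" by (simp add: s_def power2_eq_square mult_ac)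
  finally have second: "(\<Sum>V\<in>U. (\<Sum>a\<in>A. indicator (E a) V)\<^sup>2) \<le> s * g + s\<^sup>2 * g" .
  have "(s * g)\<^sup>2 \<le> (\<Sum>V\<in>U. (\<Sum>a\<in>A. indicator (E a) V)\<^sup>2) * real (card U)"
    unfolding first[symmetric] by (rule sum_squared_le_sum_of_squares)
  also have "\<dots> \<le> (s * g + s\<^sup>2 * g) * real (card U)" by (intro mult_right_mono second) simp
  also have "\<dots> \<le> (s\<^sup>2 * g + s\<^sup>2 * g) * real (card U)"
  proof (intro mult_right_mono add_right_mono)
    show "s \<le> s\<^sup>2" using s mult_left_mono[of 1 s s] by (simp add: power2_eq_square)
  qed (simp_all add: g_def)
  finally have "s\<^sup>2 * g * g \<le> s\<^sup>2 * g * (2 * real (card U))"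
    by (simp add: power2_eq_square mult_ac)
  then have "g \<le> 2 * real (card U)" if "g \<noteq> 0"
    using that s by (subst (asm) mult_le_cancel_left_pos) (auto simp: g_def)
  then have "real (card G) \<le> real (2 * card U)" by (cases "g = 0") (auto simp: g_def)
  then show ?thesis unfolding U_def by (simp only: of_nat_le_iff)
qed

lemma exists_good_with_many_hits:
  fixes H :: "'g \<Rightarrow> 'i \<Rightarrow> bool"
  assumes fin: "finite G" "finite I" and G: "G \<noteq> {}"
    and hits: "\<And>i. i \<in> I \<Longrightarrow> card G \<le> 2 * card {V \<in> G. H V i}"
    and bad: "4 * card {V \<in> G. \<not> good V} \<le> card G"
  shows "\<exists>V\<in>G. good V \<and> card I \<le> 4 * card {i \<in> I. H V i}"
proof (rule ccontr)
  assume "\<not> ?thesis"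
  then have few: "4 * card {i \<in> I. H V i} < card I" if "V \<in> G" "good V" for V
    using that by (meson not_le)
  let ?good = "{V \<in> G. good V}" and ?bad = "{V \<in> G. \<not> good V}"
  have split: "G = ?good \<union> ?bad" "?good \<inter> ?bad = {}" by auto
  have card_G: "card G = card ?good + card ?bad"
    using fin(1) by (subst split(1), subst card_Un_disjoint) auto
  have "card I * card G \<le> (\<Sum>i\<in>I. 2 * card {V \<in> G. H V i})"
    using hits sum_mono[of I "\<lambda>_. card G" "\<lambda>i. 2 * card {V \<in> G. H V i}"] by simp
  also have "\<dots> = 2 * (\<Sum>V\<in>G. card {i \<in> I. H V i})"
    using sum_multicount_gen[of G I H "\<lambda>i. card {V \<in> G. H V i}"] fin by (simp add: sum_distrib_left)
  also have "(\<Sum>V\<in>G. card {i \<in> I. H V i}) = (\<Sum>V\<in>?good. card {i \<in> I. H V i}) + (\<Sum>V\<in>?bad. card {i \<in> I. H V i})"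
    using fin(1) by (subst split(1), subst sum.union_disjoint) auto
  finally have total: "card I * card G
      \<le> 2 * ((\<Sum>V\<in>?good. card {i \<in> I. H V i}) + (\<Sum>V\<in>?bad. card {i \<in> I. H V i}))" .
  have hits_bad: "(\<Sum>V\<in>?bad. card {i \<in> I. H V i}) \<le> card I * card ?bad"
    using fin(2) sum_bounded_above[of ?bad "\<lambda>V. card {i \<in> I. H V i}" "card I"]
    by (simp add: card_mono mult.commute)
  have "?good \<noteq> {}"
  proof
    assume "?good = {}"
    then have "card G = card ?bad" using card_G by (simp only: card.empty)
    with bad have "card G = 0" by linarith
    then show False using G fin(1) by simp
  qed
  then have hits_good: "4 * (\<Sum>V\<in>?good. card {i \<in> I. H V i}) < card I * card ?good"
    using fin(1) few sum_strict_mono[of ?good "\<lambda>V. 4 * card {i \<in> I. H V i}" "\<lambda>_. card I"]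
    by (simp add: sum_distrib_left mult.commute)
  have "2 * (card I * card G)
      \<le> 4 * (\<Sum>V\<in>?good. card {i \<in> I. H V i}) + 4 * (\<Sum>V\<in>?bad. card {i \<in> I. H V i})"
    using total by simp
  also have "\<dots> < card I * card ?good + 4 * (card I * card ?bad)"
    using hits_good hits_bad by (intro add_less_le_mono mult_le_mono2)
  also have "\<dots> \<le> card I * card G + card I * card G"
    using mult_le_mono2[OF bad, of "card I"] card_G by (intro add_mono) (auto simp: mult.left_commute)
  finally show False by simp
qed

section \<open>Random generalised arithmetic progressions\<close>

definition grid :: "nat \<Rightarrow> ('a::euclidean_space \<Rightarrow> nat) set" where
  "grid q = PiE Basis (\<lambda>_. {..<q})"

definition grid_vector :: "nat \<Rightarrow> ('a::euclidean_space \<Rightarrow> nat) \<Rightarrow> 'a" where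
  "grid_vector q v = (\<Sum>c\<in>Basis. (real (v c) / real q) *\<^sub>R c)"

lemma finite_grid: "finite (grid q)"
  unfolding grid_def by (intro finite_PiE) auto

lemma card_grid: "card (grid q :: ('a::euclidean_space \<Rightarrow> nat) set) = q ^ DIM('a)"
  by (simp add: grid_def card_PiE)

lemma grid_less: "v \<in> grid q \<Longrightarrow> c \<in> Basis \<Longrightarrow> v c < q"
  by (auto simp: grid_def)

lemma grid_vector_inner_Basis: "c \<in> Basis \<Longrightarrow> grid_vector q v \<bullet> c = real (v c) / real q"
  by (simp add: grid_vector_def inner_sum_left_Basis)

text \<open>For \<open>j < m\<close> the vector \<open>grid_vector q (V j)\<close> is the generator \<open>u\<^sub>j\<close> of the progression;
  \<open>grid_vector q (V m)\<close> is a random translation.\<close>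

definition grid_families :: "nat \<Rightarrow> nat \<Rightarrow> (nat \<Rightarrow> 'a::euclidean_space \<Rightarrow> nat) set" where
  "grid_families m q = PiE {..m} (\<lambda>_. grid q)"

lemma finite_grid_families: "finite (grid_families m q)"
  unfolding grid_families_def by (intro finite_PiE finite_grid) auto

lemma card_grid_families:
  "card (grid_families m q :: (nat \<Rightarrow> 'a::euclidean_space \<Rightarrow> nat) set)
      = card (grid q :: ('a \<Rightarrow> nat) set) ^ Suc m"
  by (simp add: grid_families_def card_PiE)

lemma grid_families_mem: "V \<in> grid_families m q \<Longrightarrow> i \<le> m \<Longrightarrow> V i \<in> grid q"
  by (auto simp: grid_families_def)

definition grid_point :: "nat \<Rightarrow> nat \<Rightarrow> (nat \<Rightarrow> 'a::euclidean_space \<Rightarrow> nat) \<Rightarrow> (nat \<Rightarrow> nat) \<Rightarrow> 'a \<Rightarrow> nat" where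
  "grid_point m q V a = (\<lambda>c\<in>Basis. (V m c + (\<Sum>i<m. a i * V i c)) mod q)"

lemma grid_point_in_grid: "0 < q \<Longrightarrow> grid_point m q V a \<in> grid q"
  by (simp add: grid_point_def grid_def)

lemma nat_eq_of_dvd_diff:
  fixes x y q :: nat
  assumes "int q dvd int x - int y" "x < q" "y < q"
  shows "x = y"
  using assms zdvd_imp_le[of "int q" "\<bar>int x - int y\<bar>"] by (cases "x = y") auto

lemma grid_point_eq_imp_dvd:
  assumes eq: "grid_point m q V a = grid_point m q V' a" and c: "c \<in> Basis"
  shows "int q dvd (int (V m c) - int (V' m c)) + (\<Sum>i<m. int (a i) * (int (V i c) - int (V' i c)))"
proof -
  have "(V m c + (\<Sum>i<m. a i * V i c)) mod q = (V' m c + (\<Sum>i<m. a i * V' i c)) mod q"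
    using fun_cong[OF eq, of c] c by (simp add: grid_point_def)
  then have "int (V m c + (\<Sum>i<m. a i * V i c)) mod int q = int (V' m c + (\<Sum>i<m. a i * V' i c)) mod int q"
    by (simp only: zmod_int[symmetric])
  then have "int q dvd int (V m c + (\<Sum>i<m. a i * V i c)) - int (V' m c + (\<Sum>i<m. a i * V' i c))"
    by (simp only: mod_eq_dvd_iff)
  then show ?thesis by (simp add: right_diff_distrib sum_subtractf algebra_simps)
qed

lemma card_grid_families_restricted:
  fixes Q :: "('a::euclidean_space \<Rightarrow> nat) set"
  assumes "Q \<subseteq> grid q" "M \<subseteq> {..m}"
  shows "card {V \<in> grid_families m q. \<forall>i\<in>M. V i \<in> Q}
    = card Q ^ card M * card (grid q :: ('a \<Rightarrow> nat) set) ^ (Suc m - card M)"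
proof -
  have "{V \<in> grid_families m q. \<forall>i\<in>M. V i \<in> Q} = PiE {..m} (\<lambda>i. if i \<in> M then Q else grid q)"
  proof (intro equalityI subsetI)
    fix V assume V: "V \<in> PiE {..m} (\<lambda>i. if i \<in> M then Q else grid q)"
    have "V i \<in> (if i \<in> M then Q else grid q)" if "i \<le> m" for i using PiE_mem[OF V, of i] that by simp
    then show "V \<in> {V \<in> grid_families m q. \<forall>i\<in>M. V i \<in> Q}"
      using assms PiE_arb[OF V] by (fastforce simp: grid_families_def intro!: PiE_I split: if_splits)
  qed (auto simp: grid_families_def)
  also have "card \<dots> = (\<Prod>i\<le>m. if i \<in> M then card Q else card (grid q :: ('a \<Rightarrow> nat) set))"
    by (simp add: card_PiE if_distrib cong: if_cong)
  also have "\<dots> = card Q ^ card M * card (grid q :: ('a \<Rightarrow> nat) set) ^ (Suc m - card M)"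
  proof -
    have "card ({..m} \<inter> - M) = Suc m - card M"
      using card_Diff_subset[OF finite_subset[OF assms(2)] assms(2)] by (simp add: Diff_eq)
    then show ?thesis using assms(2) by (simp add: prod.If_cases Int_absorb1)
  qed
  finally show ?thesis .
qed

lemma card_grid_point_in:
  fixes Q :: "('a::euclidean_space \<Rightarrow> nat) set"
  assumes q: "0 < q" and Q: "Q \<subseteq> grid q"
  shows "card {V \<in> grid_families m q. grid_point m q V a \<in> Q}
    = card Q * card (grid q :: ('a \<Rightarrow> nat) set) ^ m"
proof -
  let ?G = "grid_families m q :: (nat \<Rightarrow> 'a \<Rightarrow> nat) set"
  define f where "f = (\<lambda>V :: nat \<Rightarrow> 'a \<Rightarrow> nat. V(m := grid_point m q V a))"
  have "inj_on f ?G"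
  proof (rule inj_onI)
    fix V V' assume V: "V \<in> ?G" "V' \<in> ?G" and eq: "f V = f V'"
    have low: "V i = V' i" if "i < m" for i using fun_cong[OF eq, of i] that by (simp add: f_def)
    have point: "grid_point m q V a = grid_point m q V' a" using fun_cong[OF eq, of m] by (simp add: f_def)
    have "(\<Sum>i<m. int (a i) * (int (V i c) - int (V' i c))) = 0" for c
      using low by (intro sum.neutral) auto
    then have "int q dvd int (V m c) - int (V' m c)" if "c \<in> Basis" for c
      using grid_point_eq_imp_dvd[OF point that] by simp
    then have "V m c = V' m c" if "c \<in> Basis" for c
      using grid_less[OF grid_families_mem[OF V(1)]] grid_less[OF grid_families_mem[OF V(2)]] that
      by (intro nat_eq_of_dvd_diff[of q]) auto
    then have "V m = V' m"
      using grid_families_mem[OF V(1), of m] grid_families_mem[OF V(2), of m]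
      by (intro PiE_ext[of _ Basis "\<lambda>_. {..<q}"]) (auto simp: grid_def)
    with low show "V = V'" using V by (intro PiE_ext) (auto simp: grid_families_def le_less)
  qed
  moreover have f_in: "f V \<in> ?G" if "V \<in> ?G" for V
    using that grid_point_in_grid[OF q] by (auto simp: f_def grid_families_def PiE_iff extensional_def)
  ultimately have surj: "f ` ?G = ?G"
    by (intro endo_inj_surj finite_grid_families) auto
  have "f ` {V \<in> ?G. grid_point m q V a \<in> Q} = {V \<in> ?G. \<forall>i\<in>{m}. V i \<in> Q}"
  proof (intro equalityI subsetI)
    fix V assume V: "V \<in> {V \<in> ?G. \<forall>i\<in>{m}. V i \<in> Q}"
    then obtain V' where "V' \<in> ?G" "V = f V'" using surj by blast
    then show "V \<in> f ` {V \<in> ?G. grid_point m q V a \<in> Q}" using V by (auto simp: f_def)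
  qed (use f_in in \<open>auto simp: f_def\<close>)
  then have "card {V \<in> ?G. grid_point m q V a \<in> Q} = card {V \<in> ?G. \<forall>i\<in>{m}. V i \<in> Q}"
    using card_image[OF inj_on_subset[OF \<open>inj_on f ?G\<close>], of "{V \<in> ?G. grid_point m q V a \<in> Q}"] by auto
  also have "\<dots> = card Q * card (grid q :: ('a \<Rightarrow> nat) set) ^ m"
    using card_grid_families_restricted[OF Q, of "{m}" m] by simp
  finally show ?thesis .
qed

lemma inj_on_two_grid_points:
  assumes q: "prime q" and j: "j < m" "a j \<noteq> a' j" "a j < q" "a' j < q"
  shows "inj_on (\<lambda>V. V(m := grid_point m q V a, j := grid_point m q V a')) (grid_families m q)"
proof (rule inj_onI)
  fix V V' :: "nat \<Rightarrow> 'a \<Rightarrow> nat"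
  assume V: "V \<in> grid_families m q" "V' \<in> grid_families m q"
    and eq: "V(m := grid_point m q V a, j := grid_point m q V a')
        = V'(m := grid_point m q V' a, j := grid_point m q V' a')"
  have other: "V i = V' i" if "i \<noteq> m" "i \<noteq> j" for i using fun_cong[OF eq, of i] that by simp
  have points: "grid_point m q V a = grid_point m q V' a" "grid_point m q V a' = grid_point m q V' a'"
    using fun_cong[OF eq, of m] fun_cong[OF eq, of j] j(1) by auto
  have less: "V i c < q" "V' i c < q" if "i \<le> m" "c \<in> Basis" for i c
    using grid_less[OF grid_families_mem[OF V(1)]] grid_less[OF grid_families_mem[OF V(2)]] that by auto
  have coordinates: "V j c = V' j c \<and> V m c = V' m c" if c: "c \<in> Basis" for c
  proof -
    define x where "x = int (V m c) - int (V' m c)"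
    define y where "y = int (V j c) - int (V' j c)"
    have sum: "(\<Sum>i<m. int (b i) * (int (V i c) - int (V' i c))) = int (b j) * y" for b
      using j(1) other by (subst sum.remove[of _ j]) (auto simp: y_def intro!: sum.neutral)
    have dvd: "int q dvd x + int (a j) * y" "int q dvd x + int (a' j) * y"
      using grid_point_eq_imp_dvd[OF points(1) c] grid_point_eq_imp_dvd[OF points(2) c]
      unfolding sum x_def by auto
    then have "int q dvd (int (a j) - int (a' j)) * y"
      using dvd_diff[OF dvd] by (simp add: algebra_simps)
    moreover have "\<not> int q dvd int (a j) - int (a' j)"
      using nat_eq_of_dvd_diff[of q "a j" "a' j"] j by blast
    ultimately have y: "int q dvd y" using q by (simp add: prime_dvd_mult_iff)
    then have "int q dvd x" using dvd(1) by (simp add: dvd_add_left_iff)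
    with y show ?thesis
      using nat_eq_of_dvd_diff less c j(1) unfolding x_def y_def by (metis le_refl less_imp_le)
  qed
  have "V i = V' i" if "i \<le> m" for i
  proof (cases "i \<in> {j, m}")
    case True
    then show ?thesis
      using coordinates grid_families_mem[OF V(1) that] grid_families_mem[OF V(2) that]
      by (intro PiE_ext[of _ Basis "\<lambda>_. {..<q}"]) (auto simp: grid_def)
  qed (use other in auto)
  then show "V = V'" using V by (intro PiE_ext) (auto simp: grid_families_def)
qed

lemma card_two_grid_points_in_le:
  fixes Q :: "('a::euclidean_space \<Rightarrow> nat) set"
  assumes q: "prime q" and Q: "Q \<subseteq> grid q" and j: "j < m" "a j \<noteq> a' j" "a j < q" "a' j < q"
  shows "card {V \<in> grid_families m q. grid_point m q V a \<in> Q \<and> grid_point m q V a' \<in> Q}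
    \<le> (card Q)\<^sup>2 * card (grid q :: ('a \<Rightarrow> nat) set) ^ (m - 1)"
proof -
  let ?G = "grid_families m q :: (nat \<Rightarrow> 'a \<Rightarrow> nat) set"
  let ?f = "\<lambda>V. V(m := grid_point m q V a, j := grid_point m q V a')"
  have "card {V \<in> ?G. grid_point m q V a \<in> Q \<and> grid_point m q V a' \<in> Q} \<le> card {V \<in> ?G. \<forall>i\<in>{m, j}. V i \<in> Q}"
  proof (rule card_inj_on_le)
    show "inj_on ?f {V \<in> ?G. grid_point m q V a \<in> Q \<and> grid_point m q V a' \<in> Q}"
      by (rule inj_on_subset[OF inj_on_two_grid_points[of q j m a a', OF q j]]) auto
    show "?f ` {V \<in> ?G. grid_point m q V a \<in> Q \<and> grid_point m q V a' \<in> Q} \<subseteq> {V \<in> ?G. \<forall>i\<in>{m, j}. V i \<in> Q}"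
      using Q j(1) by (auto simp: grid_families_def PiE_iff extensional_def)
  qed (simp add: finite_grid_families)
  also have "\<dots> = (card Q)\<^sup>2 * card (grid q :: ('a \<Rightarrow> nat) set) ^ (m - 1)"
    using card_grid_families_restricted[OF Q, of "{m, j}" m] j(1) by (simp add: power2_eq_square)
  finally show ?thesis .
qed

lemma half_of_grid_families_hit:
  fixes Q :: "('a::euclidean_space \<Rightarrow> nat) set"
  assumes q: "prime q" "L \<le> q" and Q: "Q \<subseteq> grid q" and big: "q ^ DIM('a) \<le> L ^ m * card Q"
  shows "card (grid_families m q :: (nat \<Rightarrow> 'a \<Rightarrow> nat) set) \<le>
    2 * card {V \<in> grid_families m q. \<exists>a\<in>PiE {..<m} (\<lambda>_. {..<L}). grid_point m q V a \<in> Q}"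
proof -
  let ?G = "grid_families m q :: (nat \<Rightarrow> 'a \<Rightarrow> nat) set" and ?A = "PiE {..<m} (\<lambda>_. {..<L})"
  define g where "g = real (card (grid q :: ('a \<Rightarrow> nat) set))"
  define p where "p = real (card Q) / g"
  define E where "E = (\<lambda>a. {V \<in> ?G. grid_point m q V a \<in> Q})"
  have q_pos: "0 < q" using q(1) by (rule prime_gt_0_nat)
  have g: "0 < g" using q_pos by (simp add: g_def card_grid)
  have "card ?G \<le> 2 * card (\<Union>a\<in>?A. E a)"
  proof (rule card_UN_ge_second_moment[where p = p])
    show "real (card (E a)) = p * real (card ?G)" for a
      using card_grid_point_in[OF q_pos Q] g by (simp add: E_def p_def card_grid_families g_def)
    show "real (card (E a \<inter> E a')) \<le> p\<^sup>2 * real (card ?G)" if a: "a \<in> ?A" "a' \<in> ?A" "a \<noteq> a'" for a a'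
    proof -
      obtain j where j: "j < m" "a j \<noteq> a' j" using PiE_ext[OF a(1,2)] a(3) by auto
      then have less: "a j < q" "a' j < q" using a q(2) by (auto simp: PiE_iff intro: less_le_trans)
      have "E a \<inter> E a' = {V \<in> ?G. grid_point m q V a \<in> Q \<and> grid_point m q V a' \<in> Q}" by (auto simp: E_def)
      then have "real (card (E a \<inter> E a')) \<le> real ((card Q)\<^sup>2 * card (grid q :: ('a \<Rightarrow> nat) set) ^ (m - 1))"
        using card_two_grid_points_in_le[of q Q j m a a', OF q(1) Q j less] by (simp only: of_nat_le_iff)
      also have "\<dots> = p\<^sup>2 * real (card ?G)"
      proof -
        have "Suc m = m - 1 + 2" using j(1) by simp
        then have "real (card ?G) = g ^ (m - 1) * g\<^sup>2"
          by (simp only: card_grid_families of_nat_power of_nat_mult power_add g_def)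
        then show ?thesis using g by (simp add: p_def power_divide g_def[symmetric])
      qed
      finally show ?thesis .
    qed
    have "g \<le> real (L ^ m * card Q)"
      using big by (simp only: g_def card_grid of_nat_le_iff)
    then show "1 \<le> p * real (card ?A)" using g by (simp add: p_def card_PiE mult.commute)
  qed (auto simp: E_def finite_grid_families intro: finite_PiE)
  also have "(\<Union>a\<in>?A. E a) = {V \<in> ?G. \<exists>a\<in>?A. grid_point m q V a \<in> Q}" by (auto simp: E_def)
  finally show ?thesis .
qed

section \<open>Few resonances\<close>

definition progression_index :: "nat \<Rightarrow> (nat + 'a::euclidean_space) set" where
  "progression_index m = {..<m} <+> Basis"

text \<open>The basis vectors are frequencies too, since the progression is reduced modulo integer vectors.\<close>

definition progression_freq :: "nat \<Rightarrow> (nat \<Rightarrow> 'a::euclidean_space \<Rightarrow> nat) \<Rightarrow> nat + 'a \<Rightarrow> 'a" where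
  "progression_freq q V = case_sum (\<lambda>i. grid_vector q (V i)) id"

lemma finite_progression_index: "finite (progression_index m)"
  by (simp add: progression_index_def)

lemma card_progression_index: "card (progression_index m :: (nat + 'a::euclidean_space) set) = m + DIM('a)"
  by (simp add: progression_index_def card_Plus)

lemma sum_progression_index:
  "(\<Sum>k\<in>progression_index m. f k) = (\<Sum>i<m. f (Inl i)) + (\<Sum>c\<in>Basis. f (Inr c))"
  by (simp add: progression_index_def sum.Plus comp_def)

lemma card_affine_near_0_le:
  fixes x y \<eta> :: real
  assumes "y \<noteq> 0" "0 \<le> \<eta>" "finite Z"
  shows "real (card {z \<in> Z. \<bar>x + y * real z\<bar> \<le> \<eta>}) \<le> 2 * \<eta> / \<bar>y\<bar> + 1"
proof (cases "{z \<in> Z. \<bar>x + y * real z\<bar> \<le> \<eta>} = {}")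
  case True
  then show ?thesis using assms by (simp only: card.empty) simp
next
  case False
  define S where "S = {z \<in> Z. \<bar>x + y * real z\<bar> \<le> \<eta>}"
  have S: "finite S" "S \<noteq> {}" using assms(3) False by (simp_all add: S_def)
  then have extremes: "Min S \<in> S" "Max S \<in> S" "Min S \<le> Max S" by simp_all
  have "S \<subseteq> {Min S..Max S}" using S by auto
  then have "card S \<le> card {Min S..Max S}" by (intro card_mono) auto
  then have "real (card S) \<le> real (Max S) - real (Min S) + 1" using extremes(3) by simp
  also have "real (Max S) - real (Min S) \<le> 2 * \<eta> / \<bar>y\<bar>"
  proof -
    have "\<bar>x + y * real (Min S)\<bar> \<le> \<eta>" "\<bar>x + y * real (Max S)\<bar> \<le> \<eta>"
      using extremes(1,2) by (simp_all add: S_def)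
    then have "\<bar>y * (real (Max S) - real (Min S))\<bar> \<le> 2 * \<eta>"
      unfolding right_diff_distrib by linarith
    then have "(real (Max S) - real (Min S)) * \<bar>y\<bar> \<le> 2 * \<eta>"
      using extremes(3) by (simp add: abs_mult mult.commute)
    then show ?thesis using assms(1) by (simp add: pos_le_divide_eq)
  qed
  finally show ?thesis by (simp add: S_def)
qed

lemma grid_vector_fun_upd:
  assumes "c \<in> Basis"
  shows "grid_vector q (v(c := z)) = grid_vector q (v(c := 0)) + (real z / real q) *\<^sub>R c"
proof (rule euclidean_eqI)
  fix b :: 'a assume "b \<in> Basis"
  then show "grid_vector q (v(c := z)) \<bullet> b = (grid_vector q (v(c := 0)) + (real z / real q) *\<^sub>R c) \<bullet> b"
    using assms by (auto simp: inner_add_left grid_vector_inner_Basis inner_Basis)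
qed

lemma card_grid_vector_inner_near_le:
  fixes \<nu> :: "'a::euclidean_space"
  assumes q: "0 < q" and \<eta>: "0 \<le> \<eta>" and \<kappa>: "0 < \<kappa>" and c: "c \<in> Basis" "\<kappa> \<le> \<bar>\<nu> \<bullet> c\<bar>" and s: "1 \<le> \<bar>s\<bar>"
  shows "real (card {v \<in> grid q. \<bar>t + s * (\<nu> \<bullet> grid_vector q v)\<bar> \<le> \<eta>})
    \<le> (2 * \<eta> / \<kappa> + 1 / real q) * real (card (grid q :: ('a \<Rightarrow> nat) set))"
proof -
  define y where "y = s * (\<nu> \<bullet> c) / real q"
  have "1 * \<kappa> \<le> \<bar>s\<bar> * \<bar>\<nu> \<bullet> c\<bar>" using s c(2) \<kappa> by (intro mult_mono) auto
  then have y: "\<kappa> / real q \<le> \<bar>y\<bar>" using q by (simp add: y_def abs_mult divide_right_mono)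
  have \<kappa>_q: "0 < \<kappa> / real q" using \<kappa> q by simp
  have fiber: "real (card {z \<in> {..<q}. \<bar>t + s * (\<nu> \<bullet> grid_vector q (v(c := z)))\<bar> \<le> \<eta>})
      \<le> (2 * \<eta> / \<kappa> + 1 / real q) * real (card {..<q})" for v
  proof -
    have affine: "t + s * (\<nu> \<bullet> grid_vector q (v(c := z)))
        = (t + s * (\<nu> \<bullet> grid_vector q (v(c := 0)))) + y * real z" for z
      by (simp add: grid_vector_fun_upd[OF c(1), of q v z] y_def inner_add_right algebra_simps)
    have "real (card {z \<in> {..<q}. \<bar>t + s * (\<nu> \<bullet> grid_vector q (v(c := z)))\<bar> \<le> \<eta>}) \<le> 2 * \<eta> / \<bar>y\<bar> + 1"
      by (subst affine, rule card_affine_near_0_le) (use y \<kappa>_q \<eta> in auto)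
    also have "\<dots> \<le> 2 * \<eta> / (\<kappa> / real q) + 1"
      using y \<kappa>_q \<eta> by (intro add_right_mono divide_left_mono mult_pos_pos) auto
    also have "\<dots> = (2 * \<eta> / \<kappa> + 1 / real q) * real (card {..<q})"
      using q \<kappa> by (simp add: field_simps)
    finally show ?thesis .
  qed
  show ?thesis
    using card_PiE_fiber_le[where I = Basis and i = c and D = "\<lambda>_. {..<q}" and R = "\<lambda>_. True"
        and Q = "\<lambda>v. \<bar>t + s * (\<nu> \<bullet> grid_vector q v)\<bar> \<le> \<eta>", OF finite_Basis c(1) _ refl fiber]
    by (simp add: grid_def)
qed

definition progression_form ::
  "nat \<Rightarrow> nat \<Rightarrow> 'a::euclidean_space \<Rightarrow> (nat \<Rightarrow> 'a \<Rightarrow> nat) \<Rightarrow> (nat + 'a \<Rightarrow> int) \<Rightarrow> real" where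
  "progression_form m q \<nu> V A = (\<Sum>k\<in>progression_index m. of_int (A k) * (\<nu> \<bullet> progression_freq q V k))"

lemma progression_form_fun_upd:
  assumes "b < m"
  shows "progression_form m q \<nu> (V(b := v)) A
    = progression_form m q \<nu> (V(b := \<lambda>_. 0)) A + of_int (A (Inl b)) * (\<nu> \<bullet> grid_vector q v)"
proof -
  have zero: "grid_vector q (\<lambda>_. 0) = 0" by (simp add: grid_vector_def)
  have split: "(\<Sum>i<m. of_int (A (Inl i)) * (\<nu> \<bullet> grid_vector q ((V(b := w)) i)))
      = of_int (A (Inl b)) * (\<nu> \<bullet> grid_vector q w) +
          (\<Sum>i\<in>{..<m} - {b}. of_int (A (Inl i)) * (\<nu> \<bullet> grid_vector q (V i)))" for w
    using assms by (subst sum.remove[of _ b]) auto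
  show ?thesis
    unfolding progression_form_def sum_progression_index progression_freq_def sum.case split zero by simp
qed

text \<open>In echelon form the \<open>j\<close>-th form depends on the generator \<open>V j\<close> but on no earlier one, so the
  conditions can be imposed one at a time, from the last to the first.\<close>

lemma card_echelon_near_0_le:
  fixes \<nu> :: "'a::euclidean_space" and A :: "nat \<Rightarrow> nat + 'a \<Rightarrow> int"
  assumes J: "finite J" "J \<subseteq> {..<m}" and q: "0 < q" and \<eta>: "0 \<le> \<eta>" and \<kappa>: "0 < \<kappa>"
    and c: "c \<in> Basis" "\<kappa> \<le> \<bar>\<nu> \<bullet> c\<bar>"
    and A: "\<And>j. j \<in> J \<Longrightarrow> A j (Inl j) \<noteq> 0" "\<And>i j. j \<in> J \<Longrightarrow> i < j \<Longrightarrow> A j (Inl i) = 0"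
  shows "real (card {V \<in> grid_families m q. \<forall>j\<in>J. \<bar>progression_form m q \<nu> V (A j)\<bar> \<le> \<eta>})
    \<le> (2 * \<eta> / \<kappa> + 1 / real q) ^ card J * real (card (grid_families m q :: (nat \<Rightarrow> 'a \<Rightarrow> nat) set))"
  using J A
proof (induction J rule: finite_linorder_min_induct)
  case empty
  then show ?case by simp
next
  case (insert b J)
  let ?near = "\<lambda>j V. \<bar>progression_form m q \<nu> V (A j)\<bar> \<le> \<eta>"
  let ?G = "grid_families m q :: (nat \<Rightarrow> 'a \<Rightarrow> nat) set" and ?r = "2 * \<eta> / \<kappa> + 1 / real q"
  have b: "b < m" using insert.prems by auto
  have independent: "(\<forall>j\<in>J. ?near j (V(b := v))) \<longleftrightarrow> (\<forall>j\<in>J. ?near j V)" for V v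
  proof -
    have "progression_form m q \<nu> (V(b := w)) (A j) = progression_form m q \<nu> (V(b := \<lambda>_. 0)) (A j)"
      if "j \<in> J" for j w
      using progression_form_fun_upd[OF b, of q \<nu> V w "A j"] insert.prems(3) insert.hyps that by simp
    from this[of _ v] this[of _ "V b"] show ?thesis by simp
  qed
  have leading: "1 \<le> \<bar>real_of_int (A b (Inl b))\<bar>"
    using insert.prems(2)[of b] by (simp flip: of_int_abs)
  have fiber: "real (card {v \<in> grid q. ?near b (V(b := v))})
      \<le> ?r * real (card (grid q :: ('a \<Rightarrow> nat) set))" for V
    by (subst progression_form_fun_upd[OF b]) (rule card_grid_vector_inner_near_le[OF q \<eta> \<kappa> c leading])
  have "real (card {V \<in> ?G. (\<forall>j\<in>J. ?near j V) \<and> ?near b V}) \<le> ?r * real (card {V \<in> ?G. \<forall>j\<in>J. ?near j V})"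
    unfolding grid_families_def
    by (rule card_PiE_fiber_le[OF _ _ finite_grid independent fiber]) (use b in auto)
  also have "\<dots> \<le> ?r * (?r ^ card J * real (card ?G))"
    using insert.prems \<eta> \<kappa> by (intro mult_left_mono insert.IH) auto
  also have "\<dots> = ?r ^ card (insert b J) * real (card ?G)"
    using insert.hyps by (subst card_insert_disjoint) auto
  finally show ?case by (simp add: conj_commute)
qed

definition direction_net :: "nat \<Rightarrow> 'a::euclidean_space set" where
  "direction_net Z = (\<lambda>z. \<Sum>c\<in>Basis. (of_int (z c) / real Z) *\<^sub>R c) ` PiE Basis (\<lambda>_. {- int Z..int Z})"

lemma finite_direction_net: "finite (direction_net Z)"
  unfolding direction_net_def by (intro finite_imageI finite_PiE) auto

lemma card_direction_net_le: "card (direction_net Z :: 'a::euclidean_space set) \<le> (2 * Z + 1) ^ DIM('a)"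
proof -
  have "card (direction_net Z :: 'a set) \<le> card (PiE (Basis :: 'a set) (\<lambda>_. {- int Z..int Z}))"
    unfolding direction_net_def by (intro card_image_le finite_PiE) auto
  then show ?thesis by (simp add: card_PiE nat_add_distrib nat_mult_distrib)
qed

lemma exists_direction_net_near:
  fixes \<nu> :: "'a::euclidean_space"
  assumes \<nu>: "norm \<nu> \<le> 1" and Z: "0 < Z"
  shows "\<exists>\<nu>'\<in>direction_net Z. \<forall>c\<in>Basis. \<bar>(\<nu> - \<nu>') \<bullet> c\<bar> \<le> 1 / real Z"
proof -
  define z where "z = (\<lambda>c\<in>Basis. \<lfloor>(\<nu> \<bullet> c) * real Z\<rfloor>)"
  define \<nu>' where "\<nu>' = (\<Sum>c\<in>Basis. (of_int (z c) / real Z) *\<^sub>R c)"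
  have "z \<in> PiE Basis (\<lambda>_. {- int Z..int Z})"
  proof (rule PiE_I)
    fix c :: 'a assume c: "c \<in> Basis"
    have "\<bar>(\<nu> \<bullet> c) * real Z\<bar> \<le> 1 * real Z"
      unfolding abs_mult using Basis_le_norm[OF c, of \<nu>] \<nu> by (intro mult_mono) auto
    then have "- real Z \<le> (\<nu> \<bullet> c) * real Z" "(\<nu> \<bullet> c) * real Z \<le> real Z" by linarith+
    then have "- int Z \<le> \<lfloor>(\<nu> \<bullet> c) * real Z\<rfloor>" "\<lfloor>(\<nu> \<bullet> c) * real Z\<rfloor> \<le> int Z"
      using floor_mono[of _ "real Z"] by (simp_all add: le_floor_iff)
    then show "z c \<in> {- int Z..int Z}" using c by (simp add: z_def)
  qed (simp add: z_def)
  moreover have "\<bar>(\<nu> - \<nu>') \<bullet> c\<bar> \<le> 1 / real Z" if c: "c \<in> Basis" for c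
  proof -
    have "(\<nu> - \<nu>') \<bullet> c = ((\<nu> \<bullet> c) * real Z - of_int (z c)) / real Z"
      using c Z by (simp add: \<nu>'_def inner_diff_left inner_sum_left_Basis diff_divide_distrib)
    moreover have "\<bar>(\<nu> \<bullet> c) * real Z - of_int (z c)\<bar> \<le> 1" using c by (simp add: z_def) linarith
    ultimately show ?thesis by (simp add: divide_right_mono)
  qed
  ultimately show ?thesis unfolding direction_net_def \<nu>'_def by blast
qed

lemma exists_Basis_inner_ge:
  fixes \<nu> :: "'a::euclidean_space"
  shows "\<exists>c\<in>Basis. norm \<nu> / real DIM('a) \<le> \<bar>\<nu> \<bullet> c\<bar>"
proof (rule ccontr)
  assume "\<not> ?thesis"
  then have "(\<Sum>c\<in>Basis. \<bar>\<nu> \<bullet> c\<bar>) < (\<Sum>c\<in>(Basis :: 'a set). norm \<nu> / real DIM('a))"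
    by (intro sum_strict_mono) auto
  then show False using norm_le_l1[of \<nu>] by simp
qed

lemma exists_direction_net_near_large:
  fixes \<nu> :: "'a::euclidean_space"
  assumes \<nu>: "norm \<nu> = 1" and Z: "2 * DIM('a) \<le> Z"
  shows "\<exists>\<nu>'\<in>direction_net Z. (\<forall>c\<in>Basis. \<bar>(\<nu> - \<nu>') \<bullet> c\<bar> \<le> 1 / real Z) \<and>
    (\<exists>c\<in>Basis. 1 / (2 * real DIM('a)) \<le> \<bar>\<nu>' \<bullet> c\<bar>)"
proof -
  have Z_pos: "0 < Z" using Z DIM_positive[where 'a = 'a] by linarith
  obtain \<nu>' where \<nu>': "\<nu>' \<in> direction_net Z" "\<And>c. c \<in> Basis \<Longrightarrow> \<bar>(\<nu> - \<nu>') \<bullet> c\<bar> \<le> 1 / real Z"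
    using exists_direction_net_near[of \<nu> Z] \<nu> Z_pos by auto
  obtain c where c: "c \<in> Basis" "1 / real DIM('a) \<le> \<bar>\<nu> \<bullet> c\<bar>" using exists_Basis_inner_ge[of \<nu>] \<nu> by auto
  have "1 / real Z \<le> 1 / (2 * real DIM('a))" using Z Z_pos by (intro divide_left_mono mult_pos_pos) auto
  moreover have "1 / real DIM('a) = 1 / (2 * real DIM('a)) + 1 / (2 * real DIM('a))" by simp
  ultimately have "1 / (2 * real DIM('a)) \<le> \<bar>\<nu>' \<bullet> c\<bar>"
    using c(2) \<nu>'(2)[OF c(1)] by (simp add: inner_diff_left)
  then show ?thesis using c(1) \<nu>' by blast
qed

lemma abs_inner_progression_freq_le:
  fixes w :: "'a::euclidean_space"
  assumes V: "V \<in> grid_families m q" and q: "0 < q" and w: "\<And>c. c \<in> Basis \<Longrightarrow> \<bar>w \<bullet> c\<bar> \<le> \<zeta>"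
  shows "i < m \<Longrightarrow> \<bar>w \<bullet> progression_freq q V (Inl i)\<bar> \<le> real DIM('a) * \<zeta>"
    and "c \<in> Basis \<Longrightarrow> \<bar>w \<bullet> progression_freq q V (Inr c)\<bar> \<le> \<zeta>"
proof -
  assume i: "i < m"
  have "\<bar>w \<bullet> grid_vector q (V i)\<bar> \<le> (\<Sum>c\<in>Basis. \<bar>(real (V i c) / real q) * (w \<bullet> c)\<bar>)"
    unfolding grid_vector_def inner_sum_right inner_scaleR_right by (rule sum_abs)
  also have "\<dots> \<le> (\<Sum>c\<in>(Basis :: 'a set). \<zeta>)"
  proof (rule sum_mono)
    fix c :: 'a assume c: "c \<in> Basis"
    have "real (V i c) / real q \<le> 1" using grid_less[OF grid_families_mem[OF V, of i] c] i by simp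
    then have "real (V i c) / real q * \<bar>w \<bullet> c\<bar> \<le> 1 * \<zeta>" using w[OF c] by (intro mult_mono) auto
    then show "\<bar>(real (V i c) / real q) * (w \<bullet> c)\<bar> \<le> \<zeta>" by (simp add: abs_mult)
  qed
  finally show "\<bar>w \<bullet> progression_freq q V (Inl i)\<bar> \<le> real DIM('a) * \<zeta>" by (simp add: progression_freq_def)
next
  assume "c \<in> Basis"
  then show "\<bar>w \<bullet> progression_freq q V (Inr c)\<bar> \<le> \<zeta>" using w by (simp add: progression_freq_def)
qed

lemma abs_progression_form_diff_le:
  fixes \<nu> \<nu>' :: "'a::euclidean_space"
  assumes V: "V \<in> grid_families m q" and q: "0 < q" and \<nu>: "\<And>c. c \<in> Basis \<Longrightarrow> \<bar>(\<nu> - \<nu>') \<bullet> c\<bar> \<le> \<zeta>"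
    and A: "\<And>k. k \<in> progression_index m \<Longrightarrow> \<bar>A k\<bar> \<le> int L"
  shows "\<bar>progression_form m q \<nu> V A - progression_form m q \<nu>' V A\<bar>
    \<le> real DIM('a) * ((real m + 1) * real L) * \<zeta>"
proof -
  have A_le: "\<bar>of_int (A k)\<bar> \<le> real L" if "k \<in> progression_index m" for k
    using A[OF that]
    by (simp flip: of_int_abs add: of_int_le_iff[of _ "int L", where 'a = real, simplified])
  have "progression_form m q \<nu> V A - progression_form m q \<nu>' V A
      = (\<Sum>k\<in>progression_index m. of_int (A k) * ((\<nu> - \<nu>') \<bullet> progression_freq q V k))"
    by (simp add: progression_form_def inner_diff_left right_diff_distrib sum_subtractf)
  also have "\<bar>\<dots>\<bar> \<le> (\<Sum>k\<in>progression_index m. \<bar>of_int (A k)\<bar> * \<bar>(\<nu> - \<nu>') \<bullet> progression_freq q V k\<bar>)"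
    by (rule order_trans[OF sum_abs]) (simp add: abs_mult)
  also have "\<dots> \<le> (\<Sum>i<m. real L * (real DIM('a) * \<zeta>)) + (\<Sum>c\<in>(Basis :: 'a set). real L * \<zeta>)"
    unfolding sum_progression_index
    by (intro add_mono sum_mono mult_mono A_le abs_inner_progression_freq_le[OF V q \<nu>])
      (auto simp: progression_index_def)
  also have "\<dots> = real DIM('a) * ((real m + 1) * real L) * \<zeta>" by (simp add: algebra_simps)
  finally show ?thesis .
qed

definition echelon_systems ::
  "nat \<Rightarrow> nat \<Rightarrow> nat \<Rightarrow> (nat set \<times> (nat \<Rightarrow> nat + 'a::euclidean_space \<Rightarrow> int)) set" where
  "echelon_systems m L d = {(J, A). J \<subseteq> {..<m} \<and> card J = d \<and>
     A \<in> PiE J (\<lambda>_. PiE (progression_index m) (\<lambda>_. {- int L<..<int L})) \<and>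
     (\<forall>j\<in>J. A j (Inl j) \<noteq> 0 \<and> (\<forall>i<j. A j (Inl i) = 0))}"

lemma card_echelon_systems_le:
  shows finite_echelon_systems:
      "finite (echelon_systems m L d :: (nat set \<times> (nat \<Rightarrow> nat + 'a::euclidean_space \<Rightarrow> int)) set)"
    and "real (card (echelon_systems m L d :: (nat set \<times> (nat \<Rightarrow> nat + 'a \<Rightarrow> int)) set))
      \<le> 2 ^ m * ((2 * real L) ^ (m + DIM('a))) ^ d"
proof -
  let ?E = "echelon_systems m L d :: (nat set \<times> (nat \<Rightarrow> nat + 'a \<Rightarrow> int)) set"
  define U where "U = PiE (progression_index m :: (nat + 'a) set) (\<lambda>_. {- int L<..<int L})"
  define W where "W = (SIGMA J : {J. J \<subseteq> {..<m} \<and> card J = d}. PiE J (\<lambda>_. U))"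
  have U: "finite U" unfolding U_def by (intro finite_PiE finite_progression_index) auto
  have J: "finite {J. J \<subseteq> {..<m} \<and> card J = d}" by (rule finite_subset[of _ "Pow {..<m}"]) auto
  have PiE_J: "finite (PiE J (\<lambda>_. U))" "card (PiE J (\<lambda>_. U)) = card U ^ d"
    if "J \<subseteq> {..<m}" "card J = d" for J
    using U that finite_subset[OF that(1)] by (auto simp: card_PiE intro: finite_PiE)
  have W: "finite W" unfolding W_def using J PiE_J(1) by (intro finite_SigmaI) auto
  have E_subset: "?E \<subseteq> W" by (auto simp: echelon_systems_def W_def U_def)
  show "finite ?E" using E_subset W by (rule finite_subset)
  have "card W = (\<Sum>J | J \<subseteq> {..<m} \<and> card J = d. card U ^ d)"
    unfolding W_def using J PiE_J by (subst card_SigmaI) auto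
  also have "\<dots> = card {J. J \<subseteq> {..<m} \<and> card J = d} * card U ^ d" by simp
  also have "\<dots> \<le> 2 ^ m * card U ^ d"
    using card_mono[of "Pow {..<m}" "{J. J \<subseteq> {..<m} \<and> card J = d}"] by (auto simp: card_Pow)
  finally have "real (card ?E) \<le> real (2 ^ m * card U ^ d)"
    using card_mono[OF W E_subset] by (simp only: of_nat_le_iff)
  also have "\<dots> = 2 ^ m * real (card U) ^ d" by simp
  also have "\<dots> \<le> 2 ^ m * ((2 * real L) ^ (m + DIM('a))) ^ d"
  proof (intro mult_left_mono power_mono)
    have "real (card U) = real (card {- int L<..<int L}) ^ (m + DIM('a))"
      unfolding U_def by (simp add: card_PiE finite_progression_index card_progression_index)
    also have "\<dots> \<le> (2 * real L) ^ (m + DIM('a))" by (intro power_mono) auto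
    finally show "real (card U) \<le> (2 * real L) ^ (m + DIM('a))" .
  qed simp_all
  finally show "real (card ?E) \<le> 2 ^ m * ((2 * real L) ^ (m + DIM('a))) ^ d" .
qed

lemma card_prefixes_of_many:
  fixes S :: "(nat + 'a::euclidean_space \<Rightarrow> nat) set"
  assumes S: "S \<subseteq> PiE (progression_index m) (\<lambda>_. {..<L})"
  shows "card S \<le> card ((\<lambda>a. \<lambda>i\<in>{..<m}. a (Inl i)) ` S) * L ^ DIM('a)"
proof -
  let ?prefix = "\<lambda>a. \<lambda>i\<in>{..<m}. a (Inl i)" and ?B = "PiE (Basis :: 'a set) (\<lambda>_. {..<L})"
  let ?split = "\<lambda>a. (?prefix a, \<lambda>c\<in>(Basis :: 'a set). a (Inr c))"
  have finite_S: "finite S"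
    using S by (rule finite_subset) (intro finite_PiE finite_progression_index; simp)
  have "inj_on ?split S"
  proof (rule inj_onI)
    fix a a' assume a: "a \<in> S" "a' \<in> S" and eq: "?split a = ?split a'"
    show "a = a'"
    proof (rule PiE_ext[OF subsetD[OF S a(1)] subsetD[OF S a(2)]])
      fix k :: "nat + 'a" assume k: "k \<in> progression_index m"
      have "?prefix a = ?prefix a'" "(\<lambda>c\<in>(Basis :: 'a set). a (Inr c)) = (\<lambda>c\<in>Basis. a' (Inr c))"
        using eq by simp_all
      from fun_cong[OF this(1), of "projl k"] fun_cong[OF this(2), of "projr k"] k
      show "a k = a' k" by (auto simp: progression_index_def)
    qed
  qed
  moreover have "?split ` S \<subseteq> ?prefix ` S \<times> ?B"
    using S by (fastforce simp: progression_index_def)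
  ultimately have "card S \<le> card (?prefix ` S \<times> ?B)"
    using finite_S by (intro card_inj_on_le finite_cartesian_product finite_PiE) auto
  then show ?thesis by (simp add: card_cartesian_product card_PiE)
qed

lemma exists_echelon_system_of_many_resonances:
  fixes u :: "nat + 'a::euclidean_space \<Rightarrow> 'a"
  assumes L: "1 \<le> L" and many: "L ^ (DIM('a) + d) < card (resonances (progression_index m) L u \<eta> \<nu> \<theta>)"
  shows "\<exists>(J, A)\<in>echelon_systems m L d.
    \<forall>j\<in>J. \<bar>\<Sum>k\<in>progression_index m. of_int (A j k) * (\<nu> \<bullet> u k)\<bar> \<le> 2 * \<eta>"
proof -
  let ?I = "progression_index m :: (nat + 'a) set"
  define S where "S = resonances ?I L u \<eta> \<nu> \<theta>"
  define prefix :: "(nat + 'a \<Rightarrow> nat) \<Rightarrow> nat \<Rightarrow> nat" where "prefix = (\<lambda>a. \<lambda>i\<in>{..<m}. a (Inl i))"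
  have S: "S \<subseteq> PiE ?I (\<lambda>_. {..<L})" by (auto simp: S_def resonances_def)
  have less: "a k < L" if "a \<in> S" "k \<in> ?I" for a k using subsetD[OF S that(1)] that(2) by auto
  have prefixes: "prefix ` S \<subseteq> PiE {..<m} (\<lambda>_. {..<L})"
    using less by (auto simp: prefix_def progression_index_def InlI split: if_splits)
  have "L ^ d * L ^ DIM('a) = L ^ (DIM('a) + d)" by (simp add: power_add mult.commute)
  also have "\<dots> < card S" using many by (simp only: S_def)
  also have "\<dots> \<le> card (prefix ` S) * L ^ DIM('a)"
    using card_prefixes_of_many[OF S] by (simp only: prefix_def)
  finally have "L ^ d < card (prefix ` S)" by simp
  also have "\<dots> \<le> L ^ card (branching_levels (prefix ` S))"
    using card_le_power_branching_levels[OF prefixes] by simp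
  finally have "d \<le> card (branching_levels (prefix ` S))"
    using L power_increasing[of _ d L] by (metis less_le_not_le linear)
  then obtain J where J: "J \<subseteq> branching_levels (prefix ` S)" "card J = d"
    by (rule obtain_subset_with_card_n)
  have Jm: "J \<subseteq> {..<m}" using J(1) branching_levels_subset[OF prefixes] by blast
  have "\<forall>j\<in>J. \<exists>a a'. a \<in> S \<and> a' \<in> S \<and> (\<forall>i<j. prefix a i = prefix a' i) \<and> prefix a j \<noteq> prefix a' j"
    using J(1) unfolding branching_levels_def by blast
  then obtain a a' where a: "\<And>j. j \<in> J \<Longrightarrow> a j \<in> S" "\<And>j. j \<in> J \<Longrightarrow> a' j \<in> S"
    "\<And>i j. j \<in> J \<Longrightarrow> i < j \<Longrightarrow> prefix (a j) i = prefix (a' j) i" "\<And>j. j \<in> J \<Longrightarrow> prefix (a j) j \<noteq> prefix (a' j) j"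
    by metis
  define A where "A = (\<lambda>j\<in>J. \<lambda>k\<in>?I. int (a j k) - int (a' j k))"
  have "A j \<in> PiE ?I (\<lambda>_. {- int L<..<int L})" if "j \<in> J" for j
    using less[OF a(1)[OF that]] less[OF a(2)[OF that]] that by (fastforce simp: A_def)
  moreover have "A j (Inl j) \<noteq> 0 \<and> (\<forall>i<j. A j (Inl i) = 0)" if "j \<in> J" for j
    using a(3,4)[OF that] Jm that by (auto simp: A_def prefix_def progression_index_def subset_iff)
  ultimately have "(J, A) \<in> echelon_systems m L d"
    using Jm J(2) by (auto simp: echelon_systems_def A_def[symmetric]) (simp add: A_def)
  moreover have "\<bar>\<Sum>k\<in>?I. of_int (A j k) * (\<nu> \<bullet> u k)\<bar> \<le> 2 * \<eta>" if j: "j \<in> J" for j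
  proof -
    have "(\<Sum>k\<in>?I. of_int (A j k) * (\<nu> \<bullet> u k))
        = (\<Sum>k\<in>?I. real (a j k) * (\<nu> \<bullet> u k)) - (\<Sum>k\<in>?I. real (a' j k) * (\<nu> \<bullet> u k))"
      unfolding sum_subtractf[symmetric] using j by (intro sum.cong) (auto simp: A_def left_diff_distrib)
    moreover have "\<bar>(\<Sum>k\<in>?I. real (b k) * (\<nu> \<bullet> u k)) - \<theta>\<bar> \<le> \<eta>" if "b \<in> S" for b
      using that by (simp add: S_def resonances_def)
    from this[OF a(1)[OF j]] this[OF a(2)[OF j]] calculation show ?thesis by linarith
  qed
  ultimately show ?thesis by blast
qed

definition net_error :: "nat \<Rightarrow> nat \<Rightarrow> nat \<Rightarrow> nat \<Rightarrow> real" where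
  "net_error n m L Z = real n * ((real m + 1) * real L) / real Z"

text \<open>The factors count the directions of the net, the row sets of an echelon system and, for each of its
  \<open>d\<close> rows, the coefficient vectors; the last one bounds the probability that the form of a row is small.\<close>

definition union_bound :: "nat \<Rightarrow> nat \<Rightarrow> nat \<Rightarrow> nat \<Rightarrow> nat \<Rightarrow> real \<Rightarrow> real" where
  "union_bound n m L Z d \<eta> = real ((2 * Z + 1) ^ n) * 2 ^ m * ((2 * real L) ^ (m + n) * (13 * real n * \<eta>)) ^ d"

lemma resonant_imp_net_form_near_0:
  fixes V :: "nat \<Rightarrow> 'a::euclidean_space \<Rightarrow> nat"
  assumes V: "V \<in> grid_families m q" and q: "0 < q" and L: "1 \<le> L" and Z: "2 * DIM('a) \<le> Z"
    and fine: "net_error DIM('a) m L Z \<le> \<eta>"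
    and resonant: "\<not> nonresonant (progression_index m) L (progression_freq q V) \<eta> (L ^ (DIM('a) + d))"
  shows "\<exists>\<nu>\<in>{\<nu> \<in> direction_net Z. \<exists>c\<in>Basis. 1 / (2 * real DIM('a)) \<le> \<bar>\<nu> \<bullet> c\<bar>}.
    \<exists>(J, A)\<in>echelon_systems m L d. \<forall>j\<in>J. \<bar>progression_form m q \<nu> V (A j)\<bar> \<le> 3 * \<eta>"
proof -
  obtain \<nu> \<theta> where \<nu>: "norm \<nu> = 1" and many:
    "L ^ (DIM('a) + d) < card (resonances (progression_index m) L (progression_freq q V) \<eta> \<nu> \<theta>)"
    using resonant by (auto simp: nonresonant_def not_le)
  obtain J A where JA: "(J, A) \<in> echelon_systems m L d"
    "\<And>j. j \<in> J \<Longrightarrow> \<bar>progression_form m q \<nu> V (A j)\<bar> \<le> 2 * \<eta>"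
    using exists_echelon_system_of_many_resonances[OF L many] unfolding progression_form_def by blast
  obtain \<nu>' where \<nu>': "\<nu>' \<in> direction_net Z" "\<And>c. c \<in> Basis \<Longrightarrow> \<bar>(\<nu> - \<nu>') \<bullet> c\<bar> \<le> 1 / real Z"
    "\<exists>c\<in>Basis. 1 / (2 * real DIM('a)) \<le> \<bar>\<nu>' \<bullet> c\<bar>"
    using exists_direction_net_near_large[OF \<nu> Z] by blast
  have "\<bar>progression_form m q \<nu>' V (A j)\<bar> \<le> 3 * \<eta>" if j: "j \<in> J" for j
  proof -
    have "A j k \<in> {- int L<..<int L}" if "k \<in> progression_index m" for k
      using JA(1) j that by (auto simp: echelon_systems_def PiE_iff)
    then have "\<bar>A j k\<bar> \<le> int L" if "k \<in> progression_index m" for k using that by fastforce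
    then have "\<bar>progression_form m q \<nu> V (A j) - progression_form m q \<nu>' V (A j)\<bar>
        \<le> real DIM('a) * ((real m + 1) * real L) * (1 / real Z)"
      by (intro abs_progression_form_diff_le V q \<nu>'(2))
    then show ?thesis using JA(2)[OF j] fine by (simp add: net_error_def abs_le_iff)
  qed
  then show ?thesis using \<nu>'(1,3) JA(1) by blast
qed

lemma card_system_near_0_le:
  fixes c :: "'a::euclidean_space"
  assumes q: "0 < q" "1 / \<eta> \<le> real q" and \<eta>: "0 < \<eta>" and JA: "(J, A) \<in> echelon_systems m L d"
    and c: "c \<in> Basis" "1 / (2 * real DIM('a)) \<le> \<bar>\<nu> \<bullet> c\<bar>"
  shows "real (card {V \<in> grid_families m q. \<forall>j\<in>J. \<bar>progression_form m q \<nu> V (A j)\<bar> \<le> 3 * \<eta>})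
    \<le> (13 * real DIM('a) * \<eta>) ^ d * real (card (grid_families m q :: (nat \<Rightarrow> 'a \<Rightarrow> nat) set))"
proof -
  let ?G = "grid_families m q :: (nat \<Rightarrow> 'a \<Rightarrow> nat) set" and ?n = "real DIM('a)"
  have J: "J \<subseteq> {..<m}" "finite J" "card J = d"
    using JA finite_subset by (auto simp: echelon_systems_def)
  have "real (card {V \<in> ?G. \<forall>j\<in>J. \<bar>progression_form m q \<nu> V (A j)\<bar> \<le> 3 * \<eta>})
      \<le> (2 * (3 * \<eta>) / (1 / (2 * ?n)) + 1 / real q) ^ card J * real (card ?G)"
    using JA \<eta> by (intro card_echelon_near_0_le[OF J(2,1) q(1) _ _ c]) (auto simp: echelon_systems_def)
  also have "\<dots> \<le> (13 * ?n * \<eta>) ^ card J * real (card ?G)"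
  proof (intro mult_right_mono power_mono)
    have "1 / real q \<le> \<eta>" using q \<eta> by (simp add: field_simps)
    also have "\<eta> \<le> ?n * \<eta>" using \<eta> by simp
    finally show "2 * (3 * \<eta>) / (1 / (2 * ?n)) + 1 / real q \<le> 13 * ?n * \<eta>" by (simp add: mult.commute)
  qed (use \<eta> in auto)
  finally show ?thesis by (simp only: J(3))
qed

lemma card_resonant_grid_families_le:
  assumes q: "0 < q" "1 / \<eta> \<le> real q" and \<eta>: "0 < \<eta>" and L: "1 \<le> L" and Z: "2 * DIM('a) \<le> Z"
    and fine: "net_error DIM('a) m L Z \<le> \<eta>"
  shows "real (card {V \<in> grid_families m q :: (nat \<Rightarrow> 'a::euclidean_space \<Rightarrow> nat) set.
      \<not> nonresonant (progression_index m) L (progression_freq q V) \<eta> (L ^ (DIM('a) + d))})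
    \<le> union_bound DIM('a) m L Z d \<eta> * real (card (grid_families m q :: (nat \<Rightarrow> 'a \<Rightarrow> nat) set))"
proof -
  let ?G = "grid_families m q :: (nat \<Rightarrow> 'a \<Rightarrow> nat) set" and ?n = "real DIM('a)"
  let ?S = "echelon_systems m L d :: (nat set \<times> (nat \<Rightarrow> nat + 'a \<Rightarrow> int)) set"
  let ?bad = "{V \<in> ?G. \<not> nonresonant (progression_index m) L (progression_freq q V) \<eta> (L ^ (DIM('a) + d))}"
  define N :: "'a set" where "N = {\<nu> \<in> direction_net Z. \<exists>c\<in>Basis. 1 / (2 * ?n) \<le> \<bar>\<nu> \<bullet> c\<bar>}"
  define E where
    "E = (\<lambda>(\<nu> :: 'a, J :: nat set, A). {V \<in> ?G. \<forall>j\<in>J. \<bar>progression_form m q \<nu> V (A j)\<bar> \<le> 3 * \<eta>})"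
  define r where "r = 13 * ?n * \<eta>"
  have fin: "finite (N \<times> ?S)" by (simp add: N_def finite_direction_net finite_echelon_systems)
  have card_E: "real (card (E t)) \<le> r ^ d * real (card ?G)" if "t \<in> N \<times> ?S" for t
    using that card_system_near_0_le[OF q \<eta>] by (auto simp: N_def E_def r_def)
  have "?bad \<subseteq> (\<Union>t\<in>N \<times> ?S. E t)"
    using resonant_imp_net_form_near_0[OF _ q(1) L Z fine] unfolding N_def E_def by fast
  then have "card ?bad \<le> card (\<Union>t\<in>N \<times> ?S. E t)"
    using fin by (intro card_mono finite_UN_I) (auto simp: E_def finite_grid_families)
  also have "\<dots> \<le> (\<Sum>t\<in>N \<times> ?S. card (E t))" by (rule card_UN_le[OF fin])
  finally have "real (card ?bad) \<le> (\<Sum>t\<in>N \<times> ?S. real (card (E t)))"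
    by (simp flip: of_nat_sum)
  also have "\<dots> \<le> (\<Sum>t\<in>N \<times> ?S. r ^ d * real (card ?G))" by (intro sum_mono card_E)
  also have "\<dots> = real (card N) * real (card ?S) * (r ^ d * real (card ?G))"
    by (simp add: card_cartesian_product)
  also have "\<dots> \<le> real ((2 * Z + 1) ^ DIM('a)) * (2 ^ m * ((2 * real L) ^ (m + DIM('a))) ^ d)
      * (r ^ d * real (card ?G))"
  proof (intro mult_right_mono mult_mono card_echelon_systems_le)
    have "card N \<le> card (direction_net Z :: 'a set)"
      by (intro card_mono finite_direction_net) (auto simp: N_def)
    then show "real (card N) \<le> real ((2 * Z + 1) ^ DIM('a))"
      using card_direction_net_le[of Z, where 'a = 'a] by (simp only: of_nat_le_iff)
  qed (use \<eta> in \<open>auto simp: r_def\<close>)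
  also have "\<dots> = union_bound DIM('a) m L Z d \<eta> * real (card ?G)"
    by (simp only: union_bound_def r_def power_mult_distrib mult_ac)
  finally show ?thesis .
qed

lemma exists_nonresonant_hitting:
  fixes Q :: "'i \<Rightarrow> ('a::euclidean_space \<Rightarrow> nat) set"
  assumes q: "prime q" "1 / \<eta> \<le> real q" "L \<le> q" and \<eta>: "0 < \<eta>" and L: "1 \<le> L" and Z: "2 * DIM('a) \<le> Z"
    and fine: "net_error DIM('a) m L Z \<le> \<eta>"
    and small: "union_bound DIM('a) m L Z d \<eta> \<le> 1/4"
    and I: "finite I" and Q: "\<And>i. i \<in> I \<Longrightarrow> Q i \<subseteq> grid q"
      "\<And>i. i \<in> I \<Longrightarrow> q ^ DIM('a) \<le> L ^ m * card (Q i)"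
  shows "\<exists>V\<in>grid_families m q.
    nonresonant (progression_index m) L (progression_freq q V) \<eta> (L ^ (DIM('a) + d)) \<and>
    card I \<le> 4 * card {i \<in> I. \<exists>a\<in>PiE {..<m} (\<lambda>_. {..<L}). grid_point m q V a \<in> Q i}"
proof (rule exists_good_with_many_hits[OF finite_grid_families I])
  let ?G = "grid_families m q :: (nat \<Rightarrow> 'a \<Rightarrow> nat) set"
  let ?bad = "{V \<in> ?G. \<not> nonresonant (progression_index m) L (progression_freq q V) \<eta> (L ^ (DIM('a) + d))}"
  have q_pos: "0 < q" using q(1) by (rule prime_gt_0_nat)
  have "0 < card ?G" using q_pos by (simp add: card_grid_families card_grid)
  then show "?G \<noteq> {}" by auto
  show "card ?G \<le> 2 * card {V \<in> ?G. \<exists>a\<in>PiE {..<m} (\<lambda>_. {..<L}). grid_point m q V a \<in> Q i}" if "i \<in> I" for i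
    using q(1,3) Q that by (intro half_of_grid_families_hit) auto
  have "real (card ?bad) \<le> 1 / 4 * real (card ?G)"
    by (rule order_trans[OF card_resonant_grid_families_le[OF q_pos q(2) \<eta> L Z fine]
        mult_right_mono[OF small]]) simp
  then show "4 * card ?bad \<le> card ?G" by linarith
qed

section \<open>The extension operator and the maximal function on indicators\<close>

lemma Int_borel_in_sets_surface_measure: "B \<in> sets borel \<Longrightarrow> \<Sigma> \<inter> B \<in> sets (surface_measure \<Sigma>)"
  by (auto simp: sets_surface_measure sets_restrict_space)

lemma emeasure_surface_measure_Int:
  fixes \<Sigma> :: "'a::euclidean_space set"
  assumes "B \<in> sets borel"
  shows "emeasure (surface_measure \<Sigma>) (\<Sigma> \<inter> B) = hausdorff_outer (real (DIM('a) - 1)) (\<Sigma> \<inter> B)"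
  using Int_borel_in_sets_surface_measure[OF assms]
  by (simp add: emeasure_surface_measure sets_surface_measure)

lemma finite_measure_surface_measure:
  fixes \<Sigma> :: "'a::euclidean_space set"
  assumes "hausdorff_outer (real (DIM('a) - 1)) \<Sigma> < top"
  shows "finite_measure (surface_measure \<Sigma>)"
proof
  show "emeasure (surface_measure \<Sigma>) (space (surface_measure \<Sigma>)) \<noteq> \<infinity>"
    using assms emeasure_surface_measure_Int[of UNIV \<Sigma>] by (simp add: space_surface_measure)
qed

lemma measurable_ident_surface_measure: "(\<lambda>s. s) \<in> measurable (surface_measure \<Sigma>) borel"
  using measurable_restrict_space1[of "\<lambda>s. s" borel borel \<Sigma>]
    measurable_cong_sets[OF sets_surface_measure refl]
  by auto

lemma borel_measurable_surface_measure:
  "g \<in> borel_measurable borel \<Longrightarrow> g \<in> borel_measurable (surface_measure \<Sigma>)"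
  by (rule measurable_compose[OF measurable_ident_surface_measure])

lemma integrable_mult_cis_surface_measure:
  fixes f :: "'a::euclidean_space \<Rightarrow> complex"
  assumes f: "integrable (surface_measure \<Sigma>) f"
  shows "integrable (surface_measure \<Sigma>) (\<lambda>s. f s * cis (\<alpha> + 2 * pi * (x \<bullet> s)))"
proof (rule Bochner_Integration.integrable_bound[OF f])
  have "(\<lambda>s. cis (\<alpha> + 2 * pi * (x \<bullet> s))) \<in> borel_measurable (surface_measure \<Sigma>)"
    by (intro borel_measurable_surface_measure borel_measurable_continuous_onI continuous_intros)
  then show "(\<lambda>s. f s * cis (\<alpha> + 2 * pi * (x \<bullet> s))) \<in> borel_measurable (surface_measure \<Sigma>)"
    using borel_measurable_integrable[OF f] by measurable
qed (simp add: norm_mult)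

lemma borel_measurable_extension_op:
  assumes "finite_measure (surface_measure \<Sigma>)" and f: "f \<in> borel_measurable (surface_measure \<Sigma>)"
  shows "extension_op \<Sigma> f \<in> borel_measurable lborel"
proof -
  interpret finite_measure "surface_measure \<Sigma>" by fact
  let ?L = "lborel \<Otimes>\<^sub>M surface_measure \<Sigma>"
  have [measurable]: "(\<lambda>z. snd z) \<in> measurable ?L borel"
    by (rule measurable_compose[OF measurable_snd measurable_ident_surface_measure])
  have [measurable]: "(\<lambda>z. fst z) \<in> measurable ?L borel"
    by (rule measurable_compose[OF measurable_fst]) simp
  have "cis \<in> borel_measurable borel" by (intro borel_measurable_continuous_onI continuous_intros)
  moreover have "(\<lambda>z. 2 * pi * (fst z \<bullet> snd z)) \<in> borel_measurable ?L" by measurable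
  ultimately have "(\<lambda>z. cis (2 * pi * (fst z \<bullet> snd z))) \<in> borel_measurable ?L"
    by (rule measurable_compose[rotated])
  then have "(\<lambda>(x, s). f s * cis (2 * pi * (x \<bullet> s))) \<in> borel_measurable ?L"
    unfolding case_prod_beta by (intro borel_measurable_times measurable_compose[OF measurable_snd f])
  from borel_measurable_lebesgue_integral[OF this] show ?thesis
    unfolding extension_op_def[abs_def] by simp
qed

lemma norm_extension_op_le: "cmod (extension_op \<Sigma> f x) \<le> (LINT s|surface_measure \<Sigma>. cmod (f s))"
  unfolding extension_op_def
  using integral_norm_bound[of "surface_measure \<Sigma>" "\<lambda>s. f s * cis (2 * pi * (x \<bullet> s))"]
  by (simp add: norm_mult)

lemma norm_indicator_complex: "cmod (indicator Y s) = indicator Y s"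
  by (simp add: indicator_def)

lemma power2_indicator: "(indicator Y s :: real)\<^sup>2 = indicator Y s"
  by (simp add: indicator_def)

lemma (in finite_measure) integrable_indicator_complex:
  "Y \<in> sets M \<Longrightarrow> integrable M (indicator Y :: 'a \<Rightarrow> complex)"
  by (intro integrable_const_bound[where B = 1]) (auto simp: norm_indicator_complex indicator_def)

lemma (in finite_measure) L2_on_indicator: "Y \<in> sets M \<Longrightarrow> L2_on M (indicator Y)"
  using integrable_real_indicator[of Y M]
  by (simp add: L2_on_def norm_indicator_complex power2_indicator emeasure_eq_measure)

lemma (in finite_measure) L2_norm_sq_indicator: "Y \<in> sets M \<Longrightarrow> L2_norm_sq M (indicator Y) = measure M Y"
  by (simp add: L2_norm_sq_def norm_indicator_complex power2_indicator)

lemma norm_extension_op_indicator_ge: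
  assumes fin: "finite_measure (surface_measure \<Sigma>)" and Y: "Y \<in> sets (surface_measure \<Sigma>)"
    and phase: "\<And>s. s \<in> Y \<Longrightarrow> \<exists>k::int. \<bar>x \<bullet> s - t - of_int k\<bar> \<le> 1/6"
  shows "measure (surface_measure \<Sigma>) Y / 2 \<le> cmod (extension_op \<Sigma> (indicator Y) x)"
proof -
  define M where "M = surface_measure \<Sigma>"
  interpret finite_measure M unfolding M_def by fact
  define f :: "'a \<Rightarrow> complex" where "f = indicator Y"
  have Y: "Y \<in> sets M" using Y by (simp add: M_def)
  have f: "integrable M f" unfolding f_def by (rule integrable_indicator_complex[OF Y])
  have int: "integrable M (\<lambda>s. f s * cis (- (2 * pi * t) + 2 * pi * (x \<bullet> s)))"
    unfolding M_def by (rule integrable_mult_cis_surface_measure[OF f[unfolded M_def]])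
  have pointwise: "indicator Y s * (1/2) \<le> Re (f s * cis (- (2 * pi * t) + 2 * pi * (x \<bullet> s)))" for s
  proof (cases "s \<in> Y")
    case True
    then have "1 / 2 \<le> cos (2 * pi * (x \<bullet> s - t))" using phase cos_ge_half_near_int by blast
    then show ?thesis using True by (simp add: f_def right_diff_distrib)
  qed (simp add: f_def)
  have "measure M Y / 2 = (LINT s|M. indicator Y s * (1/2))" using Y by simp
  also have "\<dots> \<le> (LINT s|M. Re (f s * cis (- (2 * pi * t) + 2 * pi * (x \<bullet> s))))"
    using Y integrable_Re[OF int] pointwise
    by (intro integral_mono) (auto simp: emeasure_eq_measure intro!: integrable_real_indicator)
  also have "\<dots> = Re (LINT s|M. f s * cis (- (2 * pi * t) + 2 * pi * (x \<bullet> s)))" by (rule integral_Re[OF int])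
  also have "\<dots> \<le> cmod (LINT s|M. f s * cis (- (2 * pi * t) + 2 * pi * (x \<bullet> s)))"
    by (rule complex_Re_le_cmod)
  also have "(LINT s|M. f s * cis (- (2 * pi * t) + 2 * pi * (x \<bullet> s)))
      = (LINT s|M. cis (- (2 * pi * t)) * (f s * cis (2 * pi * (x \<bullet> s))))"
    by (intro Bochner_Integration.integral_cong refl) (simp only: cis_mult[symmetric] mult_ac)
  also have "\<dots> = cis (- (2 * pi * t)) * extension_op \<Sigma> f x" by (simp add: extension_op_def M_def)
  also have "cmod \<dots> = cmod (extension_op \<Sigma> f x)" by (simp add: norm_mult)
  finally show ?thesis by (simp add: M_def f_def)
qed

lemma set_lebesgue_integral_indicator_tube:
  "(LINT x:tube a \<nu>|lborel. indicator X x) = measure lborel (X \<inter> tube a \<nu>)"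
proof -
  have "(LINT x:tube a \<nu>|lborel. indicator X x) = (LINT x|lborel. indicator (X \<inter> tube a \<nu>) x :: real)"
    unfolding set_lebesgue_integral_def
    by (intro Bochner_Integration.integral_cong) (auto simp: indicator_def)
  then show ?thesis by simp
qed

lemma MT_max_indicator_le:
  assumes "\<And>a. measure lborel (X \<inter> tube a \<nu>) \<le> B"
  shows "MT_max (indicator X) \<nu> \<le> B"
  unfolding MT_max_def set_lebesgue_integral_indicator_tube using assms by (intro cSUP_least) auto

lemma sphere_0_1_nonempty: "sphere (0::'a::euclidean_space) 1 \<noteq> {}"
  using nonempty_Basis by (metis mem_sphere_0 norm_Basis ex_in_conv)

lemma MT_norm_indicator_le:
  assumes "\<And>\<nu> a. norm \<nu> = 1 \<Longrightarrow> measure lborel (X \<inter> tube a \<nu>) \<le> B"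
  shows "MT_norm (indicator X) \<le> B"
  unfolding MT_norm_def using assms
  by (intro cSUP_least sphere_0_1_nonempty MT_max_indicator_le) auto

lemma tube_ball_subset:
  assumes "norm \<nu> = 1"
  shows "ball a (1/2) \<subseteq> tube a \<nu>"
proof
  fix x assume "x \<in> ball a (1/2)"
  then have x: "norm (x - a) < 1/2" by (simp add: dist_norm norm_minus_commute)
  have "norm ((x - a) - ((x - a) \<bullet> \<nu>) *\<^sub>R \<nu>) \<le> norm (x - a) + \<bar>(x - a) \<bullet> \<nu>\<bar>"
    using norm_triangle_ineq4[of "x - a" "((x - a) \<bullet> \<nu>) *\<^sub>R \<nu>"] assms by simp
  also have "\<dots> \<le> norm (x - a) + norm (x - a)" using Cauchy_Schwarz_ineq2[of "x - a" \<nu>] assms by simp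
  finally show "x \<in> tube a \<nu>" using x by (simp add: tube_def)
qed

lemma MT_norm_indicator_pos:
  fixes X :: "'a::euclidean_space set"
  assumes X: "X \<in> sets borel" "bounded X" and r: "0 < r" "ball 0 r \<subseteq> X"
  shows "0 < MT_norm (indicator X)"
proof -
  obtain \<nu> :: 'a where \<nu>: "\<nu> \<in> sphere 0 1" using sphere_0_1_nonempty by blast
  define d where "d = min r (1/2)"
  have fm: "X \<inter> T \<in> fmeasurable lborel" if "T \<in> sets borel" for T
    using X that emeasure_bounded_finite[of "X \<inter> T"] by (intro fmeasurableI) (auto simp: bounded_Int)
  have le: "measure lborel (X \<inter> tube a \<nu>) \<le> measure lborel X" for a \<nu>
    using fm[of UNIV] fm[of "tube a \<nu>"] by (intro measure_mono_fmeasurable) auto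
  have "ball 0 d \<subseteq> X \<inter> tube 0 \<nu>"
    using r(2) tube_ball_subset[of \<nu> 0] \<nu> by (fastforce simp: d_def)
  then have "measure lborel (ball (0::'a) d) \<le> measure lborel (X \<inter> tube 0 \<nu>)"
    using fm[of "tube 0 \<nu>"] by (intro measure_mono_fmeasurable) auto
  moreover have "0 < measure lborel (ball (0::'a) d)" using r(1) by (simp add: d_def content_ball)
  moreover have "measure lborel (X \<inter> tube 0 \<nu>) \<le> MT_max (indicator X) \<nu>"
    unfolding MT_max_def set_lebesgue_integral_indicator_tube
    by (rule cSUP_upper) (use le in \<open>auto intro!: bdd_aboveI2\<close>)
  moreover have "MT_max (indicator X) \<nu> \<le> MT_norm (indicator X)"
    unfolding MT_norm_def
    by (rule cSUP_upper[OF \<nu>]) (use MT_max_indicator_le[OF le] in \<open>auto intro!: bdd_aboveI2\<close>)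
  ultimately show ?thesis by linarith
qed

definition weighted_ratio_ge :: "'a::euclidean_space set \<Rightarrow> real \<Rightarrow> real \<Rightarrow> bool" where
  "weighted_ratio_ge \<Sigma> R \<Lambda> \<longleftrightarrow> (\<exists>(f :: 'a \<Rightarrow> complex) (w :: 'a \<Rightarrow> real).
     L2_on (surface_measure \<Sigma>) f \<and> L2_norm_sq (surface_measure \<Sigma>) f > 0 \<and>
     w \<in> borel_measurable lborel \<and> (\<forall>x. 0 \<le> w x \<and> w x \<le> 1) \<and>
     (\<forall>x. w x \<noteq> 0 \<longrightarrow> x \<in> ball 0 R) \<and> MT_norm w > 0 \<and>
     (LINT x:ball 0 R|lborel. (cmod (extension_op \<Sigma> f x))\<^sup>2 * w x)
       \<ge> \<Lambda> * L2_norm_sq (surface_measure \<Sigma>) f * MT_norm w)"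

lemma weighted_ratio_ge_mono:
  assumes "weighted_ratio_ge \<Sigma> R \<Lambda>" "\<Lambda>' \<le> \<Lambda>"
  shows "weighted_ratio_ge \<Sigma> R \<Lambda>'"
proof -
  obtain f w where fw: "L2_on (surface_measure \<Sigma>) f" "L2_norm_sq (surface_measure \<Sigma>) f > 0"
    "w \<in> borel_measurable lborel" "\<forall>x. 0 \<le> w x \<and> w x \<le> 1"
    "\<forall>x. w x \<noteq> 0 \<longrightarrow> x \<in> ball 0 R" "MT_norm w > 0"
    and ge: "\<Lambda> * L2_norm_sq (surface_measure \<Sigma>) f * MT_norm w
      \<le> (LINT x:ball 0 R|lborel. (cmod (extension_op \<Sigma> f x))\<^sup>2 * w x)"
    using assms(1) unfolding weighted_ratio_ge_def by blast
  have "\<Lambda>' * L2_norm_sq (surface_measure \<Sigma>) f * MT_norm w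
      \<le> \<Lambda> * L2_norm_sq (surface_measure \<Sigma>) f * MT_norm w"
    using assms(2) fw(2,6) by (intro mult_right_mono) auto
  from order_trans[OF this ge] fw show ?thesis unfolding weighted_ratio_ge_def by blast
qed

lemma weighted_integral_extension_op_indicator_ge:
  assumes fin: "finite_measure (surface_measure \<Sigma>)" and Y: "Y \<in> sets (surface_measure \<Sigma>)"
    and X: "X \<in> sets borel" "X \<subseteq> ball 0 R"
    and lower: "\<And>x. x \<in> X \<Longrightarrow> measure (surface_measure \<Sigma>) Y / 2 \<le> cmod (extension_op \<Sigma> (indicator Y) x)"
  shows "(measure (surface_measure \<Sigma>) Y)\<^sup>2 / 4 * measure lborel X
    \<le> (LINT x:ball 0 R|lborel. (cmod (extension_op \<Sigma> (indicator Y) x))\<^sup>2 * indicator X x)"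
proof -
  interpret finite_measure "surface_measure \<Sigma>" by fact
  define S where "S = measure (surface_measure \<Sigma>) Y"
  define E where "E = extension_op \<Sigma> (indicator Y)"
  have "emeasure lborel X < \<infinity>"
    using X(2) by (intro emeasure_bounded_finite) (rule bounded_subset[OF bounded_ball])
  then have X_int: "integrable lborel (indicator X :: _ \<Rightarrow> real)"
    using X(1) by (intro integrable_real_indicator) auto
  have E_meas: "E \<in> borel_measurable lborel"
    unfolding E_def using Y by (intro borel_measurable_extension_op fin) simp
  have upper: "cmod (E x) \<le> S" for x
    using norm_extension_op_le[of \<Sigma> "indicator Y" x] Y by (simp add: E_def S_def norm_indicator_complex)
  have "S\<^sup>2 / 4 * measure lborel X = (LINT x|lborel. indicator X x * (S\<^sup>2 / 4))" by simp
  also have "\<dots> \<le> (LINT x|lborel. indicator (ball 0 R) x *\<^sub>R ((cmod (E x))\<^sup>2 * indicator X x))"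
  proof (rule integral_mono)
    show "integrable lborel (\<lambda>x. indicator X x * (S\<^sup>2 / 4))" using X_int by simp
    show "integrable lborel (\<lambda>x. indicator (ball 0 R) x *\<^sub>R ((cmod (E x))\<^sup>2 * indicator X x))"
    proof (rule Bochner_Integration.integrable_bound[OF integrable_mult_right[OF X_int, of "S\<^sup>2"]])
      show "(\<lambda>x. indicator (ball 0 R) x *\<^sub>R ((cmod (E x))\<^sup>2 * indicator X x)) \<in> borel_measurable lborel"
        using E_meas X(1)
        by (intro borel_measurable_scaleR borel_measurable_times borel_measurable_power
            borel_measurable_norm
            borel_measurable_indicator) auto
      have "(cmod (E x))\<^sup>2 \<le> S\<^sup>2" for x using upper[of x] by (intro power_mono) auto
      then show "AE x in lborel. norm (indicator (ball 0 R) x *\<^sub>R ((cmod (E x))\<^sup>2 * indicator X x))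
          \<le> norm (S\<^sup>2 * indicator X x)"
        by (intro AE_I2) (auto simp: indicator_def)
    qed
    fix x
    have "(S / 2)\<^sup>2 \<le> (cmod (E x))\<^sup>2" if "x \<in> X"
      using lower[OF that] by (intro power_mono) (auto simp: S_def E_def)
    then show "indicator X x * (S\<^sup>2 / 4) \<le> indicator (ball 0 R) x *\<^sub>R ((cmod (E x))\<^sup>2 * indicator X x)"
      using X(2) by (auto simp: indicator_def power_divide)
  qed
  finally show ?thesis by (simp add: set_lebesgue_integral_def S_def E_def)
qed

lemma weighted_ratio_ge_indicators:
  assumes fin: "finite_measure (surface_measure \<Sigma>)"
    and Y: "Y \<in> sets (surface_measure \<Sigma>)" "0 < measure (surface_measure \<Sigma>) Y"
    and X: "X \<in> sets borel" "X \<subseteq> ball 0 R" and r: "0 < r" "ball 0 r \<subseteq> X"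
    and phase: "\<And>x. x \<in> X \<Longrightarrow> \<exists>t. \<forall>s\<in>Y. \<exists>k::int. \<bar>x \<bullet> s - t - of_int k\<bar> \<le> 1/6"
    and tube: "\<And>\<nu> a. norm \<nu> = 1 \<Longrightarrow> measure lborel (X \<inter> tube a \<nu>) \<le> B"
    and \<Lambda>: "0 \<le> \<Lambda>" "\<Lambda> * B \<le> measure (surface_measure \<Sigma>) Y / 4 * measure lborel X"
  shows "weighted_ratio_ge \<Sigma> R \<Lambda>"
proof -
  interpret finite_measure "surface_measure \<Sigma>" by fact
  define S where "S = measure (surface_measure \<Sigma>) Y"
  have "\<Lambda> * S * MT_norm (indicator X) \<le> \<Lambda> * S * B"
    using MT_norm_indicator_le[OF tube] \<Lambda>(1) Y(2) by (intro mult_left_mono) (auto simp: S_def)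
  also have "\<dots> = S * (\<Lambda> * B)" by simp
  also have "\<dots> \<le> S * (S / 4 * measure lborel X)"
    using \<Lambda>(2) Y(2) by (intro mult_left_mono) (auto simp: S_def)
  also have "\<dots> = S\<^sup>2 / 4 * measure lborel X" by (simp add: power2_eq_square)
  also have "\<dots> \<le> (LINT x:ball 0 R|lborel. (cmod (extension_op \<Sigma> (indicator Y) x))\<^sup>2 * indicator X x)"
    unfolding S_def
  proof (rule weighted_integral_extension_op_indicator_ge[OF fin Y(1) X])
    fix x assume "x \<in> X"
    then obtain t where "\<forall>s\<in>Y. \<exists>k::int. \<bar>x \<bullet> s - t - of_int k\<bar> \<le> 1/6" using phase by blast
    then show "measure (surface_measure \<Sigma>) Y / 2 \<le> cmod (extension_op \<Sigma> (indicator Y) x)"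
      by (intro norm_extension_op_indicator_ge[OF fin Y(1)]) auto
  qed
  finally have ratio: "\<Lambda> * S * MT_norm (indicator X)
      \<le> (LINT x:ball 0 R|lborel. (cmod (extension_op \<Sigma> (indicator Y) x))\<^sup>2 * indicator X x)" .
  have "bounded X" using X(2) by (rule bounded_subset[OF bounded_ball])
  then show ?thesis
    unfolding weighted_ratio_ge_def
    using ratio X L2_on_indicator[OF Y(1)] L2_norm_sq_indicator[OF Y(1)] Y(2)
        MT_norm_indicator_pos[OF X(1) _ r]
    by (intro exI[of _ "indicator Y"] exI[of _ "indicator X"]) (auto simp: S_def indicator_def)
qed

lemma measure_separated_caps_ge:
  fixes \<Sigma> :: "'a::euclidean_space set"
  assumes fin: "finite_measure (surface_measure \<Sigma>)" and P: "finite P"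
    and cap: "\<And>p. p \<in> P \<Longrightarrow> ennreal \<kappa> \<le> hausdorff_outer (real (DIM('a) - 1)) (\<Sigma> \<inter> ball p r)"
    and sep: "\<And>p p'. p \<in> P \<Longrightarrow> p' \<in> P \<Longrightarrow> p \<noteq> p' \<Longrightarrow> 2 * r \<le> norm (p - p')"
  shows "real (card P) * \<kappa> \<le> measure (surface_measure \<Sigma>) (\<Union>p\<in>P. \<Sigma> \<inter> ball p r)"
proof -
  interpret finite_measure "surface_measure \<Sigma>" by fact
  have "disjoint_family_on (\<lambda>p. \<Sigma> \<inter> ball p r) P"
    unfolding disjoint_family_on_def
  proof (intro ballI impI, rule ccontr)
    fix p p' assume p: "p \<in> P" "p' \<in> P" "p \<noteq> p'" and "\<Sigma> \<inter> ball p r \<inter> (\<Sigma> \<inter> ball p' r) \<noteq> {}"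
    then obtain s where "dist p s < r" "dist p' s < r" by auto
    then have "dist p p' < 2 * r" using dist_triangle_less_add[of p s r p' r] by (simp add: dist_commute)
    then show False using sep[OF p] by (simp add: dist_norm)
  qed
  then have "measure (surface_measure \<Sigma>) (\<Union>p\<in>P. \<Sigma> \<inter> ball p r)
      = (\<Sum>p\<in>P. measure (surface_measure \<Sigma>) (\<Sigma> \<inter> ball p r))"
    using P by (intro finite_measure_finite_Union) (auto intro: Int_borel_in_sets_surface_measure)
  also have "\<dots> \<ge> (\<Sum>p\<in>P. \<kappa>)"
  proof (rule sum_mono)
    fix p assume "p \<in> P"
    then have "ennreal \<kappa> \<le> ennreal (measure (surface_measure \<Sigma>) (\<Sigma> \<inter> ball p r))"
      using cap by (simp add: emeasure_eq_measure[symmetric] emeasure_surface_measure_Int)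
    then show "\<kappa> \<le> measure (surface_measure \<Sigma>) (\<Sigma> \<inter> ball p r)" by simp
  qed
  finally show ?thesis by simp
qed

lemma bohr_set_phase:
  assumes x: "x \<in> bohr_set J u \<epsilon>" and \<epsilon>: "0 \<le> \<epsilon>" and p: "p - v\<^sub>0 \<in> integer_combinations J u K"
    and K: "of_int K * \<epsilon> \<le> 1/16" and near: "norm x * norm (s - p) \<le> 1/16"
  shows "\<exists>k::int. \<bar>x \<bullet> s - x \<bullet> v\<^sub>0 - of_int k\<bar> \<le> 1/6"
proof -
  obtain k :: int where "\<bar>x \<bullet> (p - v\<^sub>0) - of_int k\<bar> \<le> of_int K * \<epsilon>"
    using bohr_set_inner_integer_combination[OF x \<epsilon> p] by blast
  moreover have "\<bar>x \<bullet> (s - p)\<bar> \<le> norm x * norm (s - p)" by (rule Cauchy_Schwarz_ineq2)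
  moreover have "x \<bullet> s - x \<bullet> v\<^sub>0 - of_int k = (x \<bullet> (p - v\<^sub>0) - of_int k) + x \<bullet> (s - p)"
    by (simp add: inner_diff_right)
  ultimately have "\<bar>x \<bullet> s - x \<bullet> v\<^sub>0 - of_int k\<bar> \<le> 1/6" using K near by linarith
  then show ?thesis by blast
qed

lemma measure_bohr_tube_le:
  fixes u :: "'j \<Rightarrow> 'a::euclidean_space"
  assumes J: "finite J" and \<nu>: "norm \<nu> = 1" and R: "1 \<le> R" and \<eta>: "0 \<le> \<eta>" and L: "1 \<le> L" "6 * L \<le> N"
    and nonres: "nonresonant J L u \<eta> C"
  shows "measure lborel (bohr_set J u (1 / real N) \<inter> ball 0 R \<inter> tube a \<nu>)
    \<le> bohr_tube_bound (measure lborel (ball (0::'a) 2)) (card J) L C R \<eta>" (is "_ \<le> ?B")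
proof -
  have "6 * real L * (1 / real N) \<le> 1" using L by (simp add: field_simps)
  then have "emeasure lborel (bohr_set J u (1 / real N) \<inter> (tube a \<nu> \<inter> ball 0 R)) \<le> ennreal ?B"
    using nonres \<nu> by (intro emeasure_bohr_tube_le[OF J \<nu> R \<eta> L(1)]) (auto simp: nonresonant_def)
  moreover have "bohr_set J u (1 / real N) \<inter> ball 0 R \<inter> tube a \<nu>
      = bohr_set J u (1 / real N) \<inter> (tube a \<nu> \<inter> ball 0 R)"
    by auto
  moreover have "0 \<le> ?B" using R by (simp add: bohr_tube_bound_def)
  ultimately show ?thesis unfolding measure_def by (intro enn2real_leI) auto
qed

lemma weighted_ratio_ge_of_nonresonant_points:
  fixes \<Sigma> :: "'a::euclidean_space set" and u :: "'j \<Rightarrow> 'a" and N :: nat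
  assumes \<Sigma>: "hausdorff_outer (real (DIM('a) - 1)) \<Sigma> < top"
    and P: "finite P" "P \<noteq> {}" and \<kappa>: "0 < \<kappa>"
    and cap: "\<And>p. p \<in> P \<Longrightarrow> ennreal \<kappa> \<le> hausdorff_outer (real (DIM('a) - 1)) (\<Sigma> \<inter> ball p r)"
    and sep: "\<And>p p'. p \<in> P \<Longrightarrow> p' \<in> P \<Longrightarrow> p \<noteq> p' \<Longrightarrow> 2 * r \<le> norm (p - p')"
    and R: "1 \<le> R" "R * r \<le> 1/16" "R \<le> R'" and J: "finite J"
    and combination: "\<And>p. p \<in> P \<Longrightarrow> p - v\<^sub>0 \<in> integer_combinations J u K" and K: "16 * of_int K \<le> real N"
    and nonres: "nonresonant J L u \<eta> C" and \<eta>: "0 \<le> \<eta>" and L: "1 \<le> L" "6 * L \<le> N"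
    and \<Lambda>: "0 \<le> \<Lambda>" "\<Lambda> * bohr_tube_bound (measure lborel (ball (0::'a) 2)) (card J) L C R \<eta>
      \<le> real (card P) * \<kappa> / 4 * (measure lborel (ball (0::'a) (R / 2)) / real N ^ card J)"
  shows "weighted_ratio_ge \<Sigma> R' \<Lambda>"
proof -
  define B where "B = bohr_tube_bound (measure lborel (ball (0::'a) 2)) (card J) L C R \<eta>"
  define X where "X = bohr_set J u (1 / real N) \<inter> ball 0 R"
  define Y where "Y = (\<Union>p\<in>P. \<Sigma> \<inter> ball p r)"
  have fin: "finite_measure (surface_measure \<Sigma>)" by (rule finite_measure_surface_measure[OF \<Sigma>])
  have N: "0 < N" using L by simp
  have measure_Y: "real (card P) * \<kappa> \<le> measure (surface_measure \<Sigma>) Y"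
    unfolding Y_def by (rule measure_separated_caps_ge[OF fin P(1) cap sep])
  have measure_X: "measure lborel (ball (0::'a) (R / 2)) / real N ^ card J \<le> measure lborel X"
    unfolding X_def by (rule measure_bohr_ball_ge[OF J N])
  obtain d where d: "0 < d" "ball 0 d \<subseteq> bohr_set J u (1 / real N)"
    using ball_subset_bohr_set[OF J, of "1 / real N" u] N by auto
  have card_P: "0 < real (card P) * \<kappa>" using P \<kappa> by (simp add: card_gt_0_iff)
  show ?thesis
  proof (rule weighted_ratio_ge_indicators[OF fin, where Y = Y and X = X and r = "min d R"])
    show "Y \<in> sets (surface_measure \<Sigma>)"
      unfolding Y_def using P(1) by (intro sets.finite_UN Int_borel_in_sets_surface_measure) auto
    show "0 < measure (surface_measure \<Sigma>) Y" using card_P measure_Y by linarith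
    show "X \<in> sets borel" unfolding X_def using J by (intro sets.Int bohr_set_borel) auto
    show "X \<subseteq> ball 0 R'" "0 < min d R" "ball 0 (min d R) \<subseteq> X"
      using R(1,3) d by (auto simp: X_def)
    show "\<exists>t. \<forall>s\<in>Y. \<exists>k::int. \<bar>x \<bullet> s - t - of_int k\<bar> \<le> 1/6" if x: "x \<in> X" for x
    proof (rule exI[of _ "x \<bullet> v\<^sub>0"], rule ballI)
      fix s assume "s \<in> Y"
      then obtain p where p: "p \<in> P" "norm (s - p) < r" by (auto simp: Y_def dist_norm norm_minus_commute)
      have "norm x * norm (s - p) \<le> R * r" using x p(2) R(1) by (intro mult_mono) (auto simp: X_def)
      then have "norm x * norm (s - p) \<le> 1/16" using R(2) by simp
      moreover have "of_int K * (1 / real N) \<le> 1/16" using K N by (simp add: field_simps)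
      ultimately show "\<exists>k::int. \<bar>x \<bullet> s - x \<bullet> v\<^sub>0 - of_int k\<bar> \<le> 1/6"
        using x by (intro bohr_set_phase[OF _ _ combination[OF p(1)]]) (auto simp: X_def)
    qed
    show "measure lborel (X \<inter> tube a \<nu>) \<le> B" if "norm \<nu> = 1" for \<nu> a
      unfolding X_def B_def by (rule measure_bohr_tube_le[OF J that R(1) \<eta> L nonres])
    have "\<Lambda> * B \<le> real (card P) * \<kappa> / 4 * (measure lborel (ball (0::'a) (R / 2)) / real N ^ card J)"
      using \<Lambda>(2) by (simp only: B_def)
    also have "\<dots> \<le> measure (surface_measure \<Sigma>) Y / 4 * measure lborel X"
      using measure_Y measure_X card_P by (intro mult_mono divide_right_mono) auto
    finally show "\<Lambda> * B \<le> measure (surface_measure \<Sigma>) Y / 4 * measure lborel X" .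
  qed (rule \<Lambda>(1))
qed

section \<open>The points of a single scale\<close>

lemma card_nat_interval_ge:
  fixes x y :: real
  assumes "0 \<le> x" "x \<le> y"
  shows "y - x - 1 \<le> real (card {k::nat. x \<le> real k \<and> real k \<le> y})"
    and finite_nat_interval: "finite {k::nat. x \<le> real k \<and> real k \<le> y}"
proof -
  have interval: "{k::nat. x \<le> real k \<and> real k \<le> y} = {nat \<lceil>x\<rceil>..nat \<lfloor>y\<rfloor>}"
    using assms by (auto simp: nat_ceiling_le_eq le_nat_floor) (use of_nat_floor[of y] in linarith)
  show "finite {k::nat. x \<le> real k \<and> real k \<le> y}" by (simp add: interval)
  have "y - x - 1 \<le> real_of_int (\<lfloor>y\<rfloor> - \<lceil>x\<rceil> + 1)" by linarith
  also have "\<dots> \<le> real (Suc (nat \<lfloor>y\<rfloor>) - nat \<lceil>x\<rceil>)" using assms by linarith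
  finally show "y - x - 1 \<le> real (card {k::nat. x \<le> real k \<and> real k \<le> y})" by (simp add: interval)
qed

lemma card_square_window_ge:
  fixes s \<tau> q :: real
  assumes s: "0 \<le> s" "s + \<tau> \<le> 1" and \<tau>: "0 < \<tau>" "4 \<le> \<tau> * q" and q: "0 < q"
  shows "\<tau> * q / 4 \<le> real (card {k::nat. s \<le> (real k / q)\<^sup>2 \<and> (real k / q)\<^sup>2 \<le> s + \<tau>})"
    and finite_square_window: "finite {k::nat. s \<le> (real k / q)\<^sup>2 \<and> (real k / q)\<^sup>2 \<le> s + \<tau>}"
proof -
  have "s \<le> (real k / q)\<^sup>2 \<longleftrightarrow> q * sqrt s \<le> real k" for k :: nat
    using q real_sqrt_le_iff[of s "(real k / q)\<^sup>2"] by (simp add: pos_le_divide_eq mult.commute)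
  moreover have "(real k / q)\<^sup>2 \<le> s + \<tau> \<longleftrightarrow> real k \<le> q * sqrt (s + \<tau>)" for k :: nat
    using q real_sqrt_le_iff[of "(real k / q)\<^sup>2" "s + \<tau>"] by (simp add: pos_divide_le_eq mult.commute)
  ultimately have window: "{k::nat. s \<le> (real k / q)\<^sup>2 \<and> (real k / q)\<^sup>2 \<le> s + \<tau>}
      = {k. q * sqrt s \<le> real k \<and> real k \<le> q * sqrt (s + \<tau>)}"
    by simp
  have range: "0 \<le> q * sqrt s" "q * sqrt s \<le> q * sqrt (s + \<tau>)" using s \<tau> q by (auto intro!: mult_left_mono)
  show "finite {k::nat. s \<le> (real k / q)\<^sup>2 \<and> (real k / q)\<^sup>2 \<le> s + \<tau>}"
    unfolding window by (rule finite_nat_interval[OF range])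
  have "\<tau> = (sqrt (s + \<tau>) - sqrt s) * (sqrt (s + \<tau>) + sqrt s)"
    using s \<tau> by (simp add: algebra_simps)
  also have "\<dots> \<le> (sqrt (s + \<tau>) - sqrt s) * 2"
  proof (rule mult_left_mono)
    have "sqrt (s + \<tau>) \<le> 1" "sqrt s \<le> sqrt (s + \<tau>)" using s \<tau> by auto
    then show "sqrt (s + \<tau>) + sqrt s \<le> 2" "0 \<le> sqrt (s + \<tau>) - sqrt s" by linarith+
  qed
  finally have "q * (\<tau> / 2) \<le> q * (sqrt (s + \<tau>) - sqrt s)" using q by (intro mult_left_mono) auto
  with card_nat_interval_ge[OF range] \<tau>(2)
  show "\<tau> * q / 4 \<le> real (card {k::nat. s \<le> (real k / q)\<^sup>2 \<and> (real k / q)\<^sup>2 \<le> s + \<tau>})"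
    unfolding window by (simp add: algebra_simps)
qed

definition spherical_cell :: "'a::euclidean_space \<Rightarrow> ('a \<Rightarrow> real) \<Rightarrow> real \<Rightarrow> real \<Rightarrow> 'a set" where
  "spherical_cell e lo \<delta> \<tau> = {p. (\<forall>b\<in>Basis - {e}. lo b \<le> p \<bullet> b \<and> p \<bullet> b \<le> lo b + \<delta>) \<and>
     1 - \<tau> \<le> p \<bullet> p \<and> p \<bullet> p \<le> 1 \<and> 0 \<le> p \<bullet> e}"

lemma sum_power2_off_axis_le:
  fixes x :: "'a::euclidean_space \<Rightarrow> real"
  assumes "\<And>b. b \<in> Basis - {e} \<Longrightarrow> 0 \<le> x b" "\<And>b. b \<in> Basis - {e} \<Longrightarrow> x b \<le> 1 / (2 * real DIM('a))"
  shows "(\<Sum>b\<in>Basis - {e}. (x b)\<^sup>2) \<le> 1/4"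
proof -
  have "(\<Sum>b\<in>Basis - {e}. (x b)\<^sup>2) \<le> (\<Sum>b\<in>Basis - {e}. (1 / (2 * real DIM('a)))\<^sup>2)"
    using assms by (intro sum_mono power_mono) auto
  also have "\<dots> \<le> (\<Sum>b\<in>(Basis :: 'a set). (1 / (2 * real DIM('a)))\<^sup>2)" by (intro sum_mono2) auto
  also have "\<dots> = 1 / 4 * (1 / real DIM('a))" by (simp add: power2_eq_square)
  also have "\<dots> \<le> 1 / 4 * 1" by (intro mult_left_mono) (auto simp: Suc_le_eq)
  finally show ?thesis by simp
qed

lemma inner_self_split_axis:
  fixes p :: "'a::euclidean_space"
  assumes "e \<in> Basis"
  shows "p \<bullet> p = (p \<bullet> e)\<^sup>2 + (\<Sum>b\<in>Basis - {e}. (p \<bullet> b)\<^sup>2)"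
  by (subst euclidean_inner) (simp add: sum.remove[OF finite_Basis assms] power2_eq_square)

lemma spherical_cell_axis_ge:
  fixes e :: "'a::euclidean_space"
  assumes e: "e \<in> Basis" and lo: "\<And>b. 0 \<le> lo b" "\<And>b. lo b + \<delta> \<le> 1 / (2 * real DIM('a))"
    and \<tau>: "\<tau> \<le> 1/16" and p: "p \<in> spherical_cell e lo \<delta> \<tau>"
  shows "3/4 \<le> p \<bullet> e"
proof -
  have "(\<Sum>b\<in>Basis - {e}. (p \<bullet> b)\<^sup>2) \<le> 1/4"
  proof (rule sum_power2_off_axis_le)
    fix b assume "b \<in> Basis - {e}"
    then have "lo b \<le> p \<bullet> b" "p \<bullet> b \<le> lo b + \<delta>" using p by (auto simp: spherical_cell_def)
    then show "0 \<le> p \<bullet> b" "p \<bullet> b \<le> 1 / (2 * real DIM('a))" using lo[of b] by linarith+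
  qed
  moreover have "1 - \<tau> \<le> p \<bullet> p" using p by (simp add: spherical_cell_def)
  moreover have "(3/4 :: real)\<^sup>2 = 9/16" by (simp add: power2_eq_square)
  ultimately have "(3/4)\<^sup>2 \<le> (p \<bullet> e)\<^sup>2"
    using inner_self_split_axis[OF e, of p] \<tau> by linarith
  then show ?thesis by (rule power2_le_imp_le) (use p in \<open>simp add: spherical_cell_def\<close>)
qed

text \<open>The coordinates off the axis \<open>e\<close> of the grid points in a cell range over a box, and over each
  of its points the axis coordinate ranges over a window of squares.\<close>

definition cell_base :: "nat \<Rightarrow> 'a::euclidean_space \<Rightarrow> ('a \<Rightarrow> real) \<Rightarrow> real \<Rightarrow> ('a \<Rightarrow> nat) set" where
  "cell_base q e lo \<delta> = PiE (Basis - {e}) (\<lambda>b. {k. real q * lo b \<le> real k \<and> real k \<le> real q * (lo b + \<delta>)})"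

definition base_square :: "nat \<Rightarrow> 'a::euclidean_space \<Rightarrow> ('a \<Rightarrow> nat) \<Rightarrow> real" where
  "base_square q e y = (\<Sum>b\<in>Basis - {e}. (real (y b) / real q)\<^sup>2)"

lemma cell_base_bounds:
  assumes "0 < q" "y \<in> cell_base q e lo \<delta>" "b \<in> Basis - {e}"
  shows "lo b \<le> real (y b) / real q" "real (y b) / real q \<le> lo b + \<delta>"
  using PiE_mem[OF assms(2)[unfolded cell_base_def] assms(3)] assms(1) by (simp_all add: field_simps)

lemma card_cell_base_ge:
  fixes e :: "'a::euclidean_space"
  assumes e: "e \<in> Basis" and lo: "\<And>b. b \<in> Basis - {e} \<Longrightarrow> 0 < lo b" and \<delta>: "0 < \<delta>" "2 \<le> \<delta> * real q"
  shows "(\<delta> * real q / 2) ^ (DIM('a) - 1) \<le> real (card (cell_base q e lo \<delta>))"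
    and finite_cell_base: "finite (cell_base q e lo \<delta>)"
proof -
  let ?S = "\<lambda>b. {k. real q * lo b \<le> real k \<and> real k \<le> real q * (lo b + \<delta>)}"
  have S: "\<delta> * real q / 2 \<le> real (card (?S b))" "finite (?S b)" if b: "b \<in> Basis - {e}" for b
  proof -
    have "0 \<le> real q * lo b" "real q * lo b \<le> real q * (lo b + \<delta>)"
      using lo[OF b] \<delta>(1) by (auto simp: distrib_left)
    from card_nat_interval_ge[OF this] finite_nat_interval[OF this] \<delta>(2)
    show "\<delta> * real q / 2 \<le> real (card (?S b))" "finite (?S b)" by (simp_all add: algebra_simps)
  qed
  then show "finite (cell_base q e lo \<delta>)" unfolding cell_base_def by (intro finite_PiE) auto
  have "(\<delta> * real q / 2) ^ (DIM('a) - 1) = (\<Prod>b\<in>Basis - {e}. \<delta> * real q / 2)"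
    using e by (simp add: card_Diff_singleton)
  also have "\<dots> \<le> (\<Prod>b\<in>Basis - {e}. real (card (?S b)))"
    using S(1) \<delta>(1) by (intro prod_mono) auto
  also have "\<dots> = real (card (cell_base q e lo \<delta>))" unfolding cell_base_def by (subst card_PiE) auto
  finally show "(\<delta> * real q / 2) ^ (DIM('a) - 1) \<le> real (card (cell_base q e lo \<delta>))" .
qed

lemma base_square_bounds:
  fixes e :: "'a::euclidean_space"
  assumes dim: "2 \<le> DIM('a)" and q: "0 < q" and y: "y \<in> cell_base q e lo \<delta>"
    and lo: "\<And>b. b \<in> Basis - {e} \<Longrightarrow> 0 < lo b" "\<And>b. b \<in> Basis - {e} \<Longrightarrow> lo b + \<delta> \<le> 1 / (2 * real DIM('a))"
  shows "0 < base_square q e y" "base_square q e y \<le> 1/4"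
proof -
  show "base_square q e y \<le> 1/4"
    unfolding base_square_def using order_trans[OF cell_base_bounds(2)[OF q y] lo(2)]
    by (intro sum_power2_off_axis_le) auto
  show "0 < base_square q e y"
    unfolding base_square_def
  proof (rule sum_pos)
    show "Basis - {e} \<noteq> {}" using dim card_mono[of "{e}" "Basis :: 'a set"] by auto
    show "0 < (real (y b) / real q)\<^sup>2" if "b \<in> Basis - {e}" for b
      using order_less_le_trans[OF lo(1)[OF that] cell_base_bounds(1)[OF q y that]]
      by (simp only: zero_less_power)
  qed simp
qed

lemma grid_vector_upd_in_spherical_cell:
  fixes e :: "'a::euclidean_space"
  assumes e: "e \<in> Basis" and q: "0 < q" and y: "y \<in> cell_base q e lo \<delta>"
    and k: "1 - base_square q e y - \<tau> \<le> (real k / real q)\<^sup>2" "(real k / real q)\<^sup>2 \<le> 1 - base_square q e y"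
  shows "grid_vector q (y(e := k)) \<in> spherical_cell e lo \<delta> \<tau>"
proof -
  let ?p = "grid_vector q (y(e := k))"
  have off_axis: "?p \<bullet> b = real (y b) / real q" if "b \<in> Basis - {e}" for b
    using that by (simp add: grid_vector_inner_Basis)
  have axis: "?p \<bullet> e = real k / real q" using e by (simp add: grid_vector_inner_Basis)
  have "?p \<bullet> ?p = (real k / real q)\<^sup>2 + base_square q e y"
    unfolding inner_self_split_axis[OF e, of ?p] axis base_square_def using off_axis by simp
  then show ?thesis using k cell_base_bounds[OF q y] off_axis axis by (simp add: spherical_cell_def)
qed

lemma cell_base_upd_in_grid:
  fixes e :: "'a::euclidean_space"
  assumes e: "e \<in> Basis" and dim: "2 \<le> DIM('a)" and q: "0 < q" and y: "y \<in> cell_base q e lo \<delta>"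
    and lo: "\<And>b. b \<in> Basis - {e} \<Longrightarrow> lo b + \<delta> \<le> 1 / (2 * real DIM('a))" and k: "(real k / real q)\<^sup>2 < 1"
  shows "y(e := k) \<in> grid q"
proof -
  have "y b < q" if b: "b \<in> Basis - {e}" for b
  proof -
    have "real (y b) / real q \<le> 1 / (2 * real DIM('a))"
      using cell_base_bounds(2)[OF q y b] lo[OF b] by linarith
    also have "\<dots> < 1" using dim by simp
    finally show ?thesis using q by simp
  qed
  moreover have "k < q" using k q by (simp add: abs_square_less_1)
  ultimately show ?thesis using y e by (auto simp: grid_def cell_base_def PiE_def extensional_def)
qed

lemma card_grid_vectors_in_spherical_cell_ge:
  fixes e :: "'a::euclidean_space"
  assumes e: "e \<in> Basis" and dim: "2 \<le> DIM('a)"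
    and lo: "\<And>b. b \<in> Basis - {e} \<Longrightarrow> 0 < lo b" "\<And>b. b \<in> Basis - {e} \<Longrightarrow> lo b + \<delta> \<le> 1 / (2 * real DIM('a))"
    and \<delta>: "0 < \<delta>" "2 \<le> \<delta> * real q" and \<tau>: "0 < \<tau>" "\<tau> \<le> 1/4" "4 \<le> \<tau> * real q" and q: "0 < q"
  shows "(\<delta> * real q / 2) ^ (DIM('a) - 1) * (\<tau> * real q / 4)
    \<le> real (card {z \<in> grid q. grid_vector q z \<in> spherical_cell e lo \<delta> \<tau>})"
proof -
  let ?Y = "cell_base q e lo \<delta>"
  define s where "s y = 1 - base_square q e y - \<tau>" for y
  define T where "T y = {k::nat. s y \<le> (real k / real q)\<^sup>2 \<and> (real k / real q)\<^sup>2 \<le> s y + \<tau>}" for y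
  have square: "0 < base_square q e y" "base_square q e y \<le> 1/4" if "y \<in> ?Y" for y
    using base_square_bounds[OF dim q that lo] by auto
  have T: "\<tau> * real q / 4 \<le> real (card (T y))" "finite (T y)" if "y \<in> ?Y" for y
    unfolding T_def using square[OF that] \<tau> q
    by (intro card_square_window_ge finite_square_window; simp add: s_def)+
  have "(\<delta> * real q / 2) ^ (DIM('a) - 1) * (\<tau> * real q / 4) \<le> real (card ?Y) * (\<tau> * real q / 4)"
    using card_cell_base_ge[OF e lo(1) \<delta>] \<tau> by (intro mult_right_mono) auto
  also have "\<dots> \<le> (\<Sum>y\<in>?Y. real (card (T y)))" using sum_mono[of ?Y "\<lambda>_. \<tau> * real q / 4"] T(1) by fastforce
  also have "\<dots> = real (card (SIGMA y:?Y. T y))"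
    using finite_cell_base[OF e lo(1) \<delta>] T(2) by (simp add: card_SigmaI)
  also have "\<dots> \<le> real (card {z \<in> grid q. grid_vector q z \<in> spherical_cell e lo \<delta> \<tau>})"
  proof (intro of_nat_mono card_inj_on_le)
    show "inj_on (\<lambda>(y, k). y(e := k)) (SIGMA y:?Y. T y)"
    proof (rule inj_onI, clarify)
      fix y k y' k' assume y: "y \<in> ?Y" "y' \<in> ?Y" and eq: "y(e := k) = y'(e := k')"
      have "y b = y' b" if "b \<in> Basis - {e}" for b using fun_cong[OF eq, of b] that by simp
      then show "y = y' \<and> k = k'" using y fun_cong[OF eq, of e] by (auto simp: cell_base_def intro: PiE_ext)
    qed
    show "(\<lambda>(y, k). y(e := k)) ` (SIGMA y:?Y. T y)
        \<subseteq> {z \<in> grid q. grid_vector q z \<in> spherical_cell e lo \<delta> \<tau>}"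
    proof clarify
      fix y k assume y: "y \<in> ?Y" and k: "k \<in> T y"
      then show "y(e := k) \<in> grid q \<and> grid_vector q (y(e := k)) \<in> spherical_cell e lo \<delta> \<tau>"
        using square[OF y]
        by (intro conjI cell_base_upd_in_grid[OF e dim q y lo(2)]
            grid_vector_upd_in_spherical_cell[OF e q y])
          (auto simp: T_def s_def)
    qed
  qed (simp add: finite_grid)
  finally show ?thesis .
qed

lemma grid_point_minus_translation:
  fixes V :: "nat \<Rightarrow> 'a::euclidean_space \<Rightarrow> nat"
  assumes V: "V \<in> grid_families m q" and q: "0 < q" and a: "\<And>i. i < m \<Longrightarrow> a i < L"
  shows "grid_vector q (grid_point m q V a) - grid_vector q (V m)
    \<in> integer_combinations (progression_index m) (progression_freq q V) (int (m * L * (1 + DIM('a))))"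
proof -
  define t where "t c = V m c + (\<Sum>i<m. a i * V i c)" for c
  define A where "A = case_sum (\<lambda>i. int (a i)) (\<lambda>c. - int (t c div q))"
  have V_less: "V i c < q" if "i \<le> m" "c \<in> Basis" for i c
    using grid_less[OF grid_families_mem[OF V]] that by auto
  have quotient: "t c div q \<le> m * L" if c: "c \<in> Basis" for c
  proof -
    have "(\<Sum>i<m. a i * V i c) \<le> (\<Sum>i<m. L * q)"
      using a V_less c by (intro sum_mono mult_le_mono) (auto intro: less_imp_le)
    then have "t c < Suc (m * L) * q" using V_less[of m c] c by (simp add: t_def)
    then show ?thesis using less_mult_imp_div_less[of "t c" "Suc (m * L)" q] by simp
  qed
  have "(\<Sum>j\<in>progression_index m. \<bar>A j\<bar>) = int ((\<Sum>i<m. a i) + (\<Sum>c\<in>(Basis :: 'a set). t c div q))"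
    by (simp add: sum_progression_index A_def)
  also have "(\<Sum>i<m. a i) + (\<Sum>c\<in>(Basis :: 'a set). t c div q) \<le> (\<Sum>i<m. L) + (\<Sum>c\<in>(Basis :: 'a set). m * L)"
    using a quotient by (intro add_mono sum_mono) (auto intro: less_imp_le)
  finally have "(\<Sum>j\<in>progression_index m. \<bar>A j\<bar>) \<le> int (m * L * (1 + DIM('a)))"
    by (simp add: algebra_simps)
  moreover have "grid_vector q (grid_point m q V a) - grid_vector q (V m)
      = (\<Sum>j\<in>progression_index m. of_int (A j) *\<^sub>R progression_freq q V j)"
  proof (rule euclidean_eqI)
    fix c :: 'a assume c: "c \<in> Basis"
    have "real (t c) = real (t c div q) * real q + real (t c mod q)"
      unfolding of_nat_mult[symmetric] of_nat_add[symmetric] by simp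
    then have "real (t c mod q) / real q = real (t c) / real q - real (t c div q)"
      using q by (simp add: field_simps)
    then show "(grid_vector q (grid_point m q V a) - grid_vector q (V m)) \<bullet> c
        = (\<Sum>j\<in>progression_index m. of_int (A j) *\<^sub>R progression_freq q V j) \<bullet> c"
      using c by (simp add: sum_progression_index A_def progression_freq_def inner_diff_left inner_add_left
        inner_sum_left grid_vector_inner_Basis grid_point_def t_def[symmetric] inner_Basis if_distrib
        sum.delta' cong: if_cong) (simp add: t_def add_divide_distrib sum_divide_distrib)
  qed
  ultimately show ?thesis unfolding integer_combinations_def by blast
qed

definition subcell :: "'a::euclidean_space \<Rightarrow> real \<Rightarrow> real \<Rightarrow> real \<Rightarrow> ('a \<Rightarrow> nat) \<Rightarrow> 'a set" where
  "subcell e \<beta> \<delta> \<tau> i = spherical_cell e (\<lambda>b. \<beta> + 4 * \<delta> * real (i b)) \<delta> \<tau>"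

lemma subcell_upper:
  assumes "0 \<le> \<delta>" "i \<in> PiE A (\<lambda>_. {..<K})" "b \<in> A"
  shows "\<beta> + 4 * \<delta> * real (i b) + \<delta> \<le> \<beta> + 4 * \<delta> * real K"
proof -
  have "real (i b) + 1 \<le> real K" using PiE_mem[OF assms(2,3)] by simp
  then have "4 * \<delta> * (real (i b) + 1) \<le> 4 * \<delta> * real K" using assms(1) by (intro mult_left_mono) auto
  then show ?thesis using assms(1) by (simp add: distrib_left)
qed

lemma subcell_subset:
  assumes "0 \<le> \<delta>" "i \<in> PiE (Basis - {e}) (\<lambda>_. {..<K})"
  shows "subcell e \<beta> \<delta> \<tau> i \<subseteq> spherical_cell e (\<lambda>_. \<beta>) (4 * \<delta> * real K) \<tau>"
proof
  fix p assume p: "p \<in> subcell e \<beta> \<delta> \<tau> i"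
  have "\<beta> \<le> p \<bullet> b \<and> p \<bullet> b \<le> \<beta> + 4 * \<delta> * real K" if b: "b \<in> Basis - {e}" for b
  proof -
    have "\<beta> + 4 * \<delta> * real (i b) \<le> p \<bullet> b" "p \<bullet> b \<le> \<beta> + 4 * \<delta> * real (i b) + \<delta>"
      using p b by (auto simp: subcell_def spherical_cell_def)
    moreover have "0 \<le> 4 * \<delta> * real (i b)" using assms(1) by simp
    ultimately show ?thesis using subcell_upper[OF assms b, of \<beta>] by linarith
  qed
  then show "p \<in> spherical_cell e (\<lambda>_. \<beta>) (4 * \<delta> * real K) \<tau>"
    using p by (simp add: subcell_def spherical_cell_def)
qed

lemma subcells_separated:
  assumes \<delta>: "0 \<le> \<delta>" and i: "i \<in> extensional (Basis - {e})" "i' \<in> extensional (Basis - {e})" "i \<noteq> i'"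
    and p: "p \<in> subcell e \<beta> \<delta> \<tau> i" "p' \<in> subcell e \<beta> \<delta> \<tau> i'"
  shows "3 * \<delta> \<le> norm (p - p')"
proof -
  obtain b where b: "b \<in> Basis - {e}" "i b \<noteq> i' b" using extensionalityI[OF i(1,2)] i(3) by blast
  have "1 \<le> \<bar>real (i b) - real (i' b)\<bar>" using b(2) by linarith
  then have "4 * \<delta> * 1 \<le> 4 * \<delta> * \<bar>real (i b) - real (i' b)\<bar>" using \<delta> by (intro mult_left_mono) auto
  also have "\<dots> = \<bar>4 * \<delta> * real (i b) - 4 * \<delta> * real (i' b)\<bar>"
    using \<delta> by (simp add: right_diff_distrib[symmetric] abs_mult)
  finally have "4 * \<delta> \<le> \<bar>4 * \<delta> * real (i b) - 4 * \<delta> * real (i' b)\<bar>" by simp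
  moreover have "\<beta> + 4 * \<delta> * real (i b) \<le> p \<bullet> b" "p \<bullet> b \<le> \<beta> + 4 * \<delta> * real (i b) + \<delta>"
    "\<beta> + 4 * \<delta> * real (i' b) \<le> p' \<bullet> b" "p' \<bullet> b \<le> \<beta> + 4 * \<delta> * real (i' b) + \<delta>"
    using p b(1) by (auto simp: subcell_def spherical_cell_def)
  ultimately have "3 * \<delta> \<le> \<bar>(p - p') \<bullet> b\<bar>" unfolding inner_diff_left by linarith
  also have "\<dots> \<le> norm (p - p')" using b(1) by (intro Basis_le_norm) auto
  finally show ?thesis .
qed

lemma card_grid_vectors_in_subcell_ge:
  fixes e :: "'a::euclidean_space"
  assumes dim: "2 \<le> DIM('a)" and e: "e \<in> Basis" and \<delta>: "0 < \<delta>" "2 \<le> \<delta> * real q"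
    and \<tau>: "0 < \<tau>" "\<tau> \<le> 1/4" "4 \<le> \<tau> * real q" and q: "0 < q"
    and \<beta>: "0 < \<beta>" "\<beta> + 4 * \<delta> * real K \<le> 1 / (2 * real DIM('a))"
    and i: "i \<in> PiE (Basis - {e}) (\<lambda>_. {..<K})"
    and big: "1 \<le> real L ^ m * ((\<delta> / 2) ^ (DIM('a) - 1) * (\<tau> / 4))"
  shows "q ^ DIM('a) \<le> L ^ m * card {z \<in> grid q. grid_vector q z \<in> subcell e \<beta> \<delta> \<tau> i}"
proof -
  have cell: "(\<delta> * real q / 2) ^ (DIM('a) - 1) * (\<tau> * real q / 4)
      \<le> real (card {z \<in> grid q. grid_vector q z \<in> subcell e \<beta> \<delta> \<tau> i})"
    unfolding subcell_def
  proof (intro card_grid_vectors_in_spherical_cell_ge e dim \<delta> \<tau> q)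
    fix b assume b: "b \<in> Basis - {e}"
    show "0 < \<beta> + 4 * \<delta> * real (i b)" using \<beta>(1) \<delta>(1) by (simp add: add_pos_nonneg)
    show "\<beta> + 4 * \<delta> * real (i b) + \<delta> \<le> 1 / (2 * real DIM('a))"
      using subcell_upper[OF _ i b, of \<delta> \<beta>] \<beta>(2) \<delta>(1) by linarith
  qed
  have "real (q ^ DIM('a)) = real q ^ (DIM('a) - 1) * real q" using dim by (cases "DIM('a)") auto
  also have "\<dots> \<le> real q ^ (DIM('a) - 1) * real q * (real L ^ m * ((\<delta> / 2) ^ (DIM('a) - 1) * (\<tau> / 4)))"
    using mult_left_mono[OF big, of "real q ^ (DIM('a) - 1) * real q"] by simp
  also have "\<dots> = real L ^ m * ((\<delta> * real q / 2) ^ (DIM('a) - 1) * (\<tau> * real q / 4))"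
    by (simp add: power_divide power_mult_distrib)
  also have "\<dots> \<le> real L ^ m * real (card {z \<in> grid q. grid_vector q z \<in> subcell e \<beta> \<delta> \<tau> i})"
    using cell by (intro mult_left_mono) auto
  finally have "real (q ^ DIM('a)) \<le> real (L ^ m * card {z \<in> grid q. grid_vector q z \<in> subcell e \<beta> \<delta> \<tau> i})"
    by simp
  then show ?thesis by (simp only: of_nat_le_iff)
qed

lemma exists_prime_ge: "\<exists>q. prime q \<and> (x :: real) \<le> real q"
proof -
  obtain q where "prime q" "nat \<lceil>x\<rceil> < q" using bigger_prime by blast
  then have "x \<le> real q" by linarith
  with \<open>prime q\<close> show ?thesis by blast
qed

lemma exists_points_of_hit_subcells:
  fixes e :: "'a::euclidean_space" and \<beta> \<delta> \<tau> :: real and K L :: nat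
  assumes \<delta>: "0 < \<delta>" and q: "0 < q" and V: "V \<in> grid_families m q"
  defines "h \<equiv> {i \<in> PiE (Basis - {e}) (\<lambda>_. {..<K}).
    \<exists>a\<in>PiE {..<m} (\<lambda>_. {..<L}). grid_vector q (grid_point m q V a) \<in> subcell e \<beta> \<delta> \<tau> i}"
  shows "\<exists>P. finite P \<and> card P = card h \<and> P \<subseteq> spherical_cell e (\<lambda>_. \<beta>) (4 * \<delta> * real K) \<tau> \<and>
    (\<forall>p\<in>P. \<forall>p'\<in>P. p \<noteq> p' \<longrightarrow> 3 * \<delta> \<le> norm (p - p')) \<and>
    (\<forall>p\<in>P. p - grid_vector q (V m) \<in> integer_combinations (progression_index m) (progression_freq q V)
      (int (m * L * (1 + DIM('a)))))"
proof -
  have "\<forall>i\<in>h. \<exists>a. a \<in> PiE {..<m} (\<lambda>_. {..<L}) \<and> grid_vector q (grid_point m q V a) \<in> subcell e \<beta> \<delta> \<tau> i"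
    unfolding h_def by auto
  from bchoice[OF this] obtain A where A: "\<forall>i\<in>h. A i \<in> PiE {..<m} (\<lambda>_. {..<L}) \<and>
      grid_vector q (grid_point m q V (A i)) \<in> subcell e \<beta> \<delta> \<tau> i" ..
  define p where "p i = grid_vector q (grid_point m q V (A i))" for i
  have cell: "p i \<in> subcell e \<beta> \<delta> \<tau> i" if "i \<in> h" for i using A that by (simp add: p_def)
  have h: "i \<in> PiE (Basis - {e}) (\<lambda>_. {..<K})" if "i \<in> h" for i using that by (simp add: h_def)
  have sep: "3 * \<delta> \<le> norm (p i - p i')" if "i \<in> h" "i' \<in> h" "i \<noteq> i'" for i i'
    using h[OF that(1)] h[OF that(2)] \<delta>
    by (intro subcells_separated[OF _ _ _ that(3) cell[OF that(1)] cell[OF that(2)]])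
      (simp_all add: PiE_def)
  have "inj_on p h"
  proof (rule inj_onI, rule ccontr)
    fix i i' assume "i \<in> h" "i' \<in> h" "p i = p i'" "i \<noteq> i'"
    then show False using sep[of i i'] \<delta> by simp
  qed
  then have "card (p ` h) = card h" by (rule card_image)
  moreover have "finite (p ` h)" by (simp add: h_def finite_PiE)
  moreover have "p ` h \<subseteq> spherical_cell e (\<lambda>_. \<beta>) (4 * \<delta> * real K) \<tau>"
    using \<delta> by (intro image_subsetI subsetD[OF subcell_subset[OF _ h] cell]) auto
  moreover have "p i - grid_vector q (V m) \<in> integer_combinations (progression_index m) (progression_freq q V)
      (int (m * L * (1 + DIM('a))))" if "i \<in> h" for i
    unfolding p_def using A that by (intro grid_point_minus_translation V q) auto
  ultimately show ?thesis using sep by (intro exI[of _ "p ` h"] conjI) auto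
qed

lemma exists_nonresonant_points:
  fixes e :: "'a::euclidean_space" and \<eta> \<delta> \<tau> \<beta> :: real
  assumes dim: "2 \<le> DIM('a)" and e: "e \<in> Basis"
    and \<eta>: "0 < \<eta>" and L: "1 \<le> L" and Z: "2 * DIM('a) \<le> Z"
    and fine: "net_error DIM('a) m L Z \<le> \<eta>"
    and small: "union_bound DIM('a) m L Z d \<eta> \<le> 1/4"
    and \<delta>: "0 < \<delta>" and \<tau>: "0 < \<tau>" "\<tau> \<le> 1/4" and \<beta>: "0 < \<beta>" "\<beta> + 4 * \<delta> * real K \<le> 1 / (2 * real DIM('a))"
    and big: "1 \<le> real L ^ m * ((\<delta> / 2) ^ (DIM('a) - 1) * (\<tau> / 4))"
  shows "\<exists>P (u :: nat + 'a \<Rightarrow> 'a) v. finite P \<and> K ^ (DIM('a) - 1) \<le> 4 * card P \<and>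
    P \<subseteq> spherical_cell e (\<lambda>_. \<beta>) (4 * \<delta> * real K) \<tau> \<and>
    (\<forall>p\<in>P. \<forall>p'\<in>P. p \<noteq> p' \<longrightarrow> 3 * \<delta> \<le> norm (p - p')) \<and>
    (\<forall>p\<in>P. p - v \<in> integer_combinations (progression_index m) u (int (m * L * (1 + DIM('a))))) \<and>
    nonresonant (progression_index m) L u \<eta> (L ^ (DIM('a) + d))"
proof -
  define I where "I = PiE (Basis - {e}) (\<lambda>_. {..<K})"
  obtain q where q: "prime q" "Max {1 / \<eta>, real L, 2 / \<delta>, 4 / \<tau>} \<le> real q" using exists_prime_ge by blast
  then have q_ge: "1 / \<eta> \<le> real q" "L \<le> q" "2 \<le> \<delta> * real q" "4 \<le> \<tau> * real q"
    using \<delta> \<tau> by (auto simp: field_simps)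
  have q_pos: "0 < q" using q(1) by (rule prime_gt_0_nat)
  define Q where "Q i = {z \<in> grid q. grid_vector q z \<in> subcell e \<beta> \<delta> \<tau> i}" for i
  have I: "finite I" "card I = K ^ (DIM('a) - 1)"
    unfolding I_def using e by (auto simp: card_PiE card_Diff_singleton intro: finite_PiE)
  have "q ^ DIM('a) \<le> L ^ m * card (Q i)" if "i \<in> I" for i
    unfolding Q_def using that unfolding I_def
    by (intro card_grid_vectors_in_subcell_ge[OF dim e \<delta> q_ge(3) \<tau> q_ge(4) q_pos \<beta> _ big])
  then obtain V where V: "V \<in> grid_families m q"
    and nonres: "nonresonant (progression_index m) L (progression_freq q V) \<eta> (L ^ (DIM('a) + d))"
    and hits: "card I \<le> 4 * card {i \<in> I. \<exists>a\<in>PiE {..<m} (\<lambda>_. {..<L}). grid_point m q V a \<in> Q i}"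
    using exists_nonresonant_hitting[OF q(1) q_ge(1,2) \<eta> L Z fine small I(1), of Q] unfolding Q_def by blast
  have "{i \<in> I. \<exists>a\<in>PiE {..<m} (\<lambda>_. {..<L}). grid_point m q V a \<in> Q i} =
      {i \<in> I. \<exists>a\<in>PiE {..<m} (\<lambda>_. {..<L}). grid_vector q (grid_point m q V a) \<in> subcell e \<beta> \<delta> \<tau> i}"
    by (simp add: Q_def grid_point_in_grid[OF q_pos])
  moreover obtain P where P: "finite P" "card P = card {i \<in> I. \<exists>a\<in>PiE {..<m} (\<lambda>_. {..<L}).
      grid_vector q (grid_point m q V a) \<in> subcell e \<beta> \<delta> \<tau> i}"
    "P \<subseteq> spherical_cell e (\<lambda>_. \<beta>) (4 * \<delta> * real K) \<tau>"
    "\<forall>p\<in>P. \<forall>p'\<in>P. p \<noteq> p' \<longrightarrow> 3 * \<delta> \<le> norm (p - p')"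
    "\<forall>p\<in>P. p - grid_vector q (V m) \<in> integer_combinations (progression_index m) (progression_freq q V)
      (int (m * L * (1 + DIM('a))))"
    using exists_points_of_hit_subcells[OF \<delta> q_pos V, of e K L \<beta> \<tau>] unfolding I_def by blast
  ultimately have "K ^ (DIM('a) - 1) \<le> 4 * card P" using hits by (simp only: I(2))
  then show ?thesis using P nonres by blast
qed

section \<open>Choice of parameters\<close>

lemma eventually_between_consecutive:
  fixes r :: "nat \<Rightarrow> real"
  assumes r: "filterlim r at_top sequentially" and P: "eventually P sequentially"
  shows "\<forall>\<^sub>F R in at_top. \<exists>k. P k \<and> r k \<le> R \<and> R < r (Suc k)"
proof -
  obtain k\<^sub>0 where k\<^sub>0: "\<And>k. k\<^sub>0 \<le> k \<Longrightarrow> P k" using P by (auto simp: eventually_sequentially)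
  have "\<exists>k. P k \<and> r k \<le> R \<and> R < r (Suc k)" if R: "r k\<^sub>0 \<le> R" for R
  proof -
    have "\<forall>\<^sub>F k in sequentially. R < r k" using r by (simp add: filterlim_at_top_dense)
    then obtain k\<^sub>1 where "\<And>k. k\<^sub>1 \<le> k \<Longrightarrow> R < r k" by (auto simp: eventually_sequentially)
    then have "R < r (k\<^sub>0 + k\<^sub>1)" by simp
    then obtain j where "\<not> R < r (k\<^sub>0 + j)" "R < r (k\<^sub>0 + Suc j)"
      using ex_least_nat_less[of "\<lambda>j. R < r (k\<^sub>0 + j)" k\<^sub>1] R by auto
    then show ?thesis using k\<^sub>0[of "k\<^sub>0 + j"] by (intro exI[of _ "k\<^sub>0 + j"]) auto
  qed
  then show ?thesis unfolding eventually_at_top_linorder by blast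
qed

text \<open>Scale \<open>k\<close> has \<open>k\<^sup>2\<close> generators with coefficients below \<open>coeff_bound k\<close>. Its radius exceeds the
  size \<open>2 ^ ((n + 1) * k ^ 4)\<close> of the progression by the factor \<open>2 ^ (k ^ 3)\<close>, which is what makes the
  union bound over tuples of length \<open>tuple_length k\<close> work. All losses are \<open>2 ^ O(k ^ 3)\<close>, hence negligible
  powers of the radius, and so is the ratio of consecutive radii.\<close>

locale scales =
  fixes n :: nat
  assumes n_ge_2: "2 \<le> n"
begin

definition tuple_length :: "nat \<Rightarrow> nat" where "tuple_length k = 8 * n * (n + 1) * k"
definition coeff_bound :: "nat \<Rightarrow> nat" where "coeff_bound k = 2 ^ ((n + 1) * k\<^sup>2)"
definition net_fineness :: "nat \<Rightarrow> nat" where "net_fineness k = 2 ^ (3 * (n + 1) * k ^ 4)"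
definition torus_cells :: "nat \<Rightarrow> nat" where "torus_cells k = 2 ^ ((n + 1) * k\<^sup>2 + k)"
definition cells_per_side :: "nat \<Rightarrow> nat" where "cells_per_side k = 2 ^ (k ^ 4 - (2 * k + n + 6))"
definition radius :: "nat \<Rightarrow> real" where "radius k = 2 ^ ((n + 1) * k ^ 4 + k ^ 3)"
definition resonance_width :: "nat \<Rightarrow> real" where "resonance_width k = 2 ^ k / radius k"
definition bump_width :: "nat \<Rightarrow> real" where "bump_width k = 2 ^ k / 2 ^ (k ^ 4)"
definition shell_width :: "nat \<Rightarrow> real" where "shell_width k = (1/2) ^ k * (bump_width k)\<^sup>2 / 120"
definition cell_offset :: "nat \<Rightarrow> real" where "cell_offset k = 1 / 2 ^ (k + n + 2)"

lemma of_nat_le_two_power: "real x \<le> 2 ^ x"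
  using of_nat_less_two_power[of x, where 'a = real] by simp

lemma eventually_cubic_le_quartic:
  "\<forall>\<^sub>F k in sequentially. A * k ^ 3 + B * k\<^sup>2 + C * k + D \<le> (k :: nat) ^ 4"
proof -
  have "\<forall>\<^sub>F k in sequentially. real A * real k ^ 3 + real B * (real k)\<^sup>2 + real C * real k + real D
      \<le> real k ^ 4"
    by real_asymp
  then show ?thesis by eventually_elim (simp flip: of_nat_le_iff[where 'a = real])
qed

lemma eventually_quadratic_le_cubic: "\<forall>\<^sub>F k in sequentially. B * k\<^sup>2 + C * k + D \<le> (k :: nat) ^ 3"
proof -
  have "\<forall>\<^sub>F k in sequentially. real B * (real k)\<^sup>2 + real C * real k + real D \<le> real k ^ 3" by real_asymp
  then show ?thesis by eventually_elim (simp flip: of_nat_le_iff[where 'a = real])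
qed

lemma parameters_positive:
  "0 < resonance_width k" "1 \<le> coeff_bound k" "0 < bump_width k" "0 < shell_width k" "0 < cell_offset k"
  "1 \<le> radius k" "0 < torus_cells k" "0 < cells_per_side k" "0 < net_fineness k"
  by (simp_all add: resonance_width_def coeff_bound_def bump_width_def shell_width_def cell_offset_def
      radius_def torus_cells_def cells_per_side_def net_fineness_def)

lemma radius_resonance_width: "radius k * resonance_width k = 2 ^ k"
  using parameters_positive(6)[of k] by (simp add: resonance_width_def)

lemma torus_cells_eq: "real (torus_cells k) = 2 ^ k * real (coeff_bound k)"
  by (simp add: torus_cells_def coeff_bound_def power_add)

lemma filterlim_radius: "filterlim radius at_top sequentially"
proof (rule filterlim_at_top_mono[OF filterlim_real_sequentially], rule always_eventually, rule allI)
  fix k :: nat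
  have "k \<le> k ^ 3" by (cases "k = 0") (auto simp: self_le_power)
  then have "(2::real) ^ k \<le> radius k" unfolding radius_def by (intro power_increasing) auto
  then show "real k \<le> radius k" using of_nat_le_two_power[of k] by linarith
qed

lemma net_fineness_ge:
  assumes "1 \<le> k"
  shows "2 * n \<le> net_fineness k"
proof -
  have "2 * n \<le> 3 * (n + 1) * 1" by simp
  also have "\<dots> \<le> 3 * (n + 1) * k ^ 4" using assms by (intro mult_le_mono2) (simp add: one_le_power)
  also have "\<dots> < 2 ^ (3 * (n + 1) * k ^ 4)" by (rule less_exp)
  finally show ?thesis by (simp add: net_fineness_def)
qed

lemma eventually_net_error_le:
  "\<forall>\<^sub>F k in sequentially. net_error n (k\<^sup>2) (coeff_bound k) (net_fineness k) \<le> resonance_width k"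
  using eventually_cubic_le_quartic[of 1 "n + 2" 0 "n + 1"]
proof eventually_elim
  case (elim k)
  have "k ^ 4 \<le> 2 * (n + 1) * k ^ 4" by simp
  with elim have "1 * k ^ 3 + (n + 2) * k\<^sup>2 + 0 * k + (n + 1) \<le> 2 * (n + 1) * k ^ 4" by (rule order_trans)
  then have exponent: "n + (k\<^sup>2 + 1) + (n + 1) * k\<^sup>2 + ((n + 1) * k ^ 4 + k ^ 3) \<le> 3 * (n + 1) * k ^ 4 + k"
    by (simp add: algebra_simps)
  have "real n * ((real (k\<^sup>2) + 1) * real (coeff_bound k)) * radius k
      \<le> 2 ^ n * (2 ^ (k\<^sup>2 + 1) * 2 ^ ((n + 1) * k\<^sup>2)) * 2 ^ ((n + 1) * k ^ 4 + k ^ 3)"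
    unfolding radius_def coeff_bound_def
    using of_nat_le_two_power[of n] of_nat_le_two_power[of "k\<^sup>2 + 1"] by (intro mult_mono) auto
  also have "\<dots> = 2 ^ (n + (k\<^sup>2 + 1) + (n + 1) * k\<^sup>2 + ((n + 1) * k ^ 4 + k ^ 3))"
    by (simp only: power_add mult.assoc)
  also have "\<dots> \<le> 2 ^ (3 * (n + 1) * k ^ 4 + k)" using exponent by (intro power_increasing) auto
  also have "\<dots> = real (net_fineness k) * 2 ^ k" by (simp add: net_fineness_def power_add)
  finally show ?case
    using parameters_positive(6,9)[of k] unfolding resonance_width_def net_error_def
    by (simp add: pos_divide_le_eq pos_le_divide_eq mult.commute)
qed

lemma power_coeff_bound_resonance_width:
  "(2 * real (coeff_bound k)) ^ (k\<^sup>2 + n) * resonance_width k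
    = 2 ^ ((n + 1) * n * k\<^sup>2 + k\<^sup>2 + n + k) / 2 ^ (k ^ 3)"
proof -
  have "2 * real (coeff_bound k) = 2 ^ ((n + 1) * k\<^sup>2 + 1)" by (simp add: coeff_bound_def)
  then have "(2 * real (coeff_bound k)) ^ (k\<^sup>2 + n) = 2 ^ (((n + 1) * k\<^sup>2 + 1) * (k\<^sup>2 + n))"
    by (simp only: power_mult)
  also have "((n + 1) * k\<^sup>2 + 1) * (k\<^sup>2 + n) = (n + 1) * k ^ 4 + ((n + 1) * n * k\<^sup>2 + k\<^sup>2 + n)"
    by (simp add: algebra_simps power2_eq_square power4_eq_xxxx)
  finally have power: "(2 * real (coeff_bound k)) ^ (k\<^sup>2 + n)
      = 2 ^ ((n + 1) * k ^ 4) * 2 ^ ((n + 1) * n * k\<^sup>2 + k\<^sup>2 + n)"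
    by (simp only: power_add[of _ "(n + 1) * k ^ 4"])
  show ?thesis
    unfolding power resonance_width_def radius_def power_add[of _ _ "k ^ 3"] power_add[of _ _ k] by simp
qed

lemma eventually_resonance_probability_le:
  "\<forall>\<^sub>F k in sequentially.
    ((2 * real (coeff_bound k)) ^ (k\<^sup>2 + n) * (13 * real n * resonance_width k))\<^sup>2 \<le> 1 / 2 ^ (k ^ 3)"
  using eventually_quadratic_le_cubic[of "2 * (n + 1) * n + 2" 2 "28 * n"]
proof eventually_elim
  case (elim k)
  define y where "y = (2 * real (coeff_bound k)) ^ (k\<^sup>2 + n) * (13 * real n * resonance_width k)"
  define A where "A = (n + 1) * n * k\<^sup>2 + k\<^sup>2 + n + k"
  have y_nonneg: "0 \<le> y" using parameters_positive(1)[of k] by (simp add: y_def)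
  have "y = real (13 * n) * (2 ^ A / 2 ^ (k ^ 3))"
    unfolding y_def A_def power_coeff_bound_resonance_width[symmetric] by simp
  also have "\<dots> \<le> 2 ^ (13 * n) * (2 ^ A / 2 ^ (k ^ 3))" by (intro mult_right_mono of_nat_le_two_power) simp
  also have "\<dots> = 2 ^ (13 * n + A) / 2 ^ (k ^ 3)" by (simp add: power_add)
  finally have "y\<^sup>2 \<le> (2 ^ (13 * n + A) / 2 ^ (k ^ 3))\<^sup>2" using y_nonneg by (intro power_mono) auto
  also have "\<dots> = 2 ^ (2 * (13 * n + A)) / (2 ^ (k ^ 3) * 2 ^ (k ^ 3))"
    by (simp only: power_divide power_even_eq power2_eq_square times_divide_times_eq)
  also have "\<dots> \<le> 2 ^ (k ^ 3) / (2 ^ (k ^ 3) * 2 ^ (k ^ 3))"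
    using elim by (intro divide_right_mono power_increasing) (auto simp: A_def algebra_simps)
  finally show ?case by (simp add: y_def)
qed

lemma power_net_fineness_le: "real ((2 * net_fineness k + 1) ^ n) \<le> 2 ^ ((3 * (n + 1) * k ^ 4 + 2) * n)"
proof -
  have "2 * net_fineness k + 1 \<le> 4 * net_fineness k" using parameters_positive(9)[of k] by simp
  also have "\<dots> = 2 ^ (3 * (n + 1) * k ^ 4 + 2)" by (simp add: net_fineness_def power_add)
  finally have "real ((2 * net_fineness k + 1) ^ n) \<le> real ((2 ^ (3 * (n + 1) * k ^ 4 + 2)) ^ n)"
    unfolding of_nat_le_iff by (rule power_mono) simp
  also have "\<dots> = 2 ^ ((3 * (n + 1) * k ^ 4 + 2) * n)" by (simp only: of_nat_power power_mult of_nat_numeral)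
  finally show ?thesis .
qed

lemma eventually_union_bound_le:
  "\<forall>\<^sub>F k in sequentially.
    union_bound n (k\<^sup>2) (coeff_bound k) (net_fineness k) (tuple_length k) (resonance_width k) \<le> 1/4"
  using eventually_resonance_probability_le eventually_cubic_le_quartic[of 0 1 0 "2 * n + 2"]
proof eventually_elim
  case (elim k)
  define y where "y = (2 * real (coeff_bound k)) ^ (k\<^sup>2 + n) * (13 * real n * resonance_width k)"
  define E where "E = (3 * (n + 1) * k ^ 4 + 2) * n + k\<^sup>2"
  have y_nonneg: "0 \<le> y" using parameters_positive(1)[of k] by (simp add: y_def)
  have "k ^ 4 \<le> n * (n + 1) * k ^ 4" using n_ge_2 by simp
  with elim(2) have "1 * k\<^sup>2 + (2 * n + 2) \<le> n * (n + 1) * k ^ 4" by linarith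
  then have exponent: "E + 2 \<le> 4 * n * (n + 1) * k ^ 4" by (simp add: E_def algebra_simps)
  have "tuple_length k = 2 * (4 * n * (n + 1) * k)" by (simp add: tuple_length_def)
  then have "y ^ tuple_length k = (y\<^sup>2) ^ (4 * n * (n + 1) * k)" by (simp only: power_mult)
  also have "\<dots> \<le> (1 / 2 ^ (k ^ 3)) ^ (4 * n * (n + 1) * k)"
    using elim(1) by (intro power_mono) (auto simp: y_def)
  also have "\<dots> = 1 / 2 ^ (k ^ 3 * (4 * n * (n + 1) * k))" by (simp add: power_divide power_mult)
  also have "k ^ 3 * (4 * n * (n + 1) * k) = 4 * n * (n + 1) * k ^ 4"
    by (simp add: power4_eq_xxxx power3_eq_cube)
  finally have "real ((2 * net_fineness k + 1) ^ n) * 2 ^ (k\<^sup>2) * y ^ tuple_length k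
      \<le> 2 ^ ((3 * (n + 1) * k ^ 4 + 2) * n) * 2 ^ (k\<^sup>2) * (1 / 2 ^ (4 * n * (n + 1) * k ^ 4))"
    using power_net_fineness_le[of k] y_nonneg by (intro mult_mono) auto
  also have "\<dots> = 2 ^ (E + 2) / 2 ^ (4 * n * (n + 1) * k ^ 4) / 4" by (simp add: E_def power_add)
  also have "\<dots> \<le> 1 / 4"
  proof (rule divide_right_mono)
    have "(2::real) ^ (E + 2) \<le> 2 ^ (4 * n * (n + 1) * k ^ 4)"
      using exponent by (intro power_increasing) auto
    then show "(2::real) ^ (E + 2) / 2 ^ (4 * n * (n + 1) * k ^ 4) \<le> 1"
      by (simp only: divide_le_eq_1_pos zero_less_power zero_less_numeral)
  qed simp
  finally show ?case by (simp only: union_bound_def y_def)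
qed

lemma total_cell_width:
  assumes "2 * k + n + 6 \<le> k ^ 4"
  shows "4 * bump_width k * real (cells_per_side k) = cell_offset k / 4"
    and bump_width_le_cell_offset: "bump_width k \<le> cell_offset k / 16"
proof -
  obtain j where j: "k ^ 4 = (2 * k + n + 6) + j" using assms le_Suc_ex by blast
  then have "k ^ 4 = k + k + (n + 6) + j" by simp
  then have "(2::real) ^ (k ^ 4) = 2 ^ k * 2 ^ k * 2 ^ (n + 6) * 2 ^ j" by (simp only: power_add)
  then have "4 * bump_width k * real (cells_per_side k) = 4 / (2 ^ k * 2 ^ (n + 6))"
    by (simp add: bump_width_def cells_per_side_def j)
  also have "\<dots> = cell_offset k / 4" by (simp add: cell_offset_def power_add)
  finally show fit: "4 * bump_width k * real (cells_per_side k) = cell_offset k / 4" .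
  have "4 * bump_width k * 1 \<le> 4 * bump_width k * real (cells_per_side k)"
    using parameters_positive(3,8)[of k] by (intro mult_left_mono) auto
  then show "bump_width k \<le> cell_offset k / 16" using fit by simp
qed

lemma cell_offset_le: "cell_offset k \<le> 1 / (4 * real n)"
proof -
  have "real n \<le> 2 ^ n" by (rule of_nat_le_two_power)
  also have "(2::real) ^ n \<le> 2 ^ (k + n)" by (intro power_increasing) auto
  finally have "cell_offset k * (4 * real n) \<le> 1" unfolding cell_offset_def by (simp add: power_add)
  then show ?thesis using n_ge_2 by (simp add: pos_le_divide_eq)
qed

lemma cell_offset_le_half: "k < k' \<Longrightarrow> cell_offset k' \<le> cell_offset k / 2"
proof -
  assume "k < k'"
  then have "(2::real) ^ (k + n + 2 + 1) \<le> 2 ^ (k' + n + 2)" by (intro power_increasing) auto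
  then show ?thesis unfolding cell_offset_def by (simp add: field_simps)
qed

lemma cells_upper_le:
  assumes "2 * k + n + 6 \<le> k ^ 4"
  shows "cell_offset k + 4 * bump_width k * real (cells_per_side k) \<le> 1 / (2 * real n)"
proof -
  have "1 / (2 * real n) = 2 * (1 / (4 * real n))" by simp
  then show ?thesis
    using total_cell_width[OF assms] cell_offset_le[of k] parameters_positive(5)[of k] by linarith
qed

lemma bump_width_le_1: "2 * k + n + 6 \<le> k ^ 4 \<Longrightarrow> bump_width k \<le> 1"
proof -
  assume "2 * k + n + 6 \<le> k ^ 4"
  moreover have "1 / (4 * real n) \<le> 1" using n_ge_2 by simp
  ultimately show ?thesis using bump_width_le_cell_offset[of k] cell_offset_le[of k] by linarith
qed

lemma shell_width_le: "2 * k + n + 6 \<le> k ^ 4 \<Longrightarrow> shell_width k \<le> 1 / 16"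
proof -
  assume "2 * k + n + 6 \<le> k ^ 4"
  then have "(1/2) ^ k * (bump_width k)\<^sup>2 \<le> 1 * 1"
    using parameters_positive(3)[of k] bump_width_le_1[of k] by (intro mult_mono power_le_one) auto
  then show ?thesis unfolding shell_width_def by linarith
qed

lemma one_le_radius_bump_width: "1 \<le> radius k * bump_width k"
proof -
  have "(2::real) ^ (k ^ 4) \<le> 2 ^ ((n + 1) * k ^ 4 + k ^ 3 + k)" by (intro power_increasing) auto
  then show ?thesis unfolding radius_def bump_width_def by (simp add: power_add field_simps)
qed

lemma one_le_expected_hits:
  assumes "9 \<le> k"
  shows "1 \<le> real (coeff_bound k) ^ (k\<^sup>2) * ((bump_width k / 2) ^ (n - 1) * (shell_width k / 4))"
proof -
  have "(n + 1) * k ^ 4 = (n + 1) * k\<^sup>2 * k\<^sup>2"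
    unfolding power4_eq_xxxx power2_eq_square by (simp only: mult_ac)
  then have coefficients: "real (coeff_bound k) ^ (k\<^sup>2) = 2 ^ ((n + 1) * k ^ 4)"
    unfolding coeff_bound_def by (simp only: power_mult of_nat_power of_nat_numeral)
  have "(2 ^ k / 2 ^ (k ^ 4)) ^ (n + 1) = (2::real) ^ (k * (n + 1)) / 2 ^ (k ^ 4 * (n + 1))"
    by (simp only: power_divide power_mult)
  then have widths: "bump_width k ^ (n + 1) * 2 ^ ((n + 1) * k ^ 4) = 2 ^ ((n + 1) * k)"
    unfolding bump_width_def mult.commute[of "n + 1"] by simp
  have "n * 9 \<le> n * k" using assms by (intro mult_le_mono2)
  then have "(n - 1) + k + 9 \<le> (n + 1) * k" using n_ge_2 unfolding distrib_right by linarith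
  then have "(2::real) ^ ((n - 1) + k + 9) \<le> 2 ^ ((n + 1) * k)" by (intro power_increasing) auto
  moreover have "(2::real) ^ (n - 1) * 2 ^ k * 480 \<le> 2 ^ (n - 1) * 2 ^ k * 2 ^ 9"
    by (intro mult_left_mono) auto
  ultimately have "(2::real) ^ (n - 1) * 2 ^ k * 480 \<le> 2 ^ ((n + 1) * k)" by (simp only: power_add)
  then have "1 \<le> 2 ^ ((n + 1) * k) / ((2::real) ^ (n - 1) * 2 ^ k * 480)"
    by (simp only: le_divide_eq_1_pos mult_pos_pos zero_less_power zero_less_numeral)
  also have "\<dots>
      = (bump_width k ^ (n - 1) * (bump_width k)\<^sup>2) * 2 ^ ((n + 1) * k ^ 4) / (2 ^ (n - 1) * 2 ^ k * 480)"
    using n_ge_2 by (simp only: widths[symmetric] power_add[symmetric]) simp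
  also have "\<dots> = real (coeff_bound k) ^ (k\<^sup>2) * ((bump_width k / 2) ^ (n - 1) * (shell_width k / 4))"
    unfolding coefficients shell_width_def by (simp add: power_divide mult_ac)
  finally show ?thesis .
qed

lemma coeff_bound_le_torus_cells:
  assumes "3 \<le> k"
  shows "6 * coeff_bound k \<le> torus_cells k"
proof -
  have "(2::nat) ^ 3 \<le> 2 ^ k" using assms by (intro power_increasing) auto
  then show ?thesis by (simp add: coeff_bound_def torus_cells_def power_add)
qed

lemma eventually_phase_error_le:
  "\<forall>\<^sub>F k in sequentially. 16 * (k\<^sup>2 * coeff_bound k * (1 + n)) \<le> torus_cells k"
proof -
  have "\<forall>\<^sub>F k in sequentially. 16 * (real k)\<^sup>2 * (1 + real n) \<le> 2 ^ k" by real_asymp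
  then show ?thesis
  proof eventually_elim
    case (elim k)
    have "real (16 * (k\<^sup>2 * coeff_bound k * (1 + n)))
        = 16 * (real k)\<^sup>2 * (1 + real n) * real (coeff_bound k)"
      by (simp add: algebra_simps)
    also have "\<dots> \<le> real (torus_cells k)" unfolding torus_cells_eq using elim by (intro mult_right_mono) auto
    finally show ?case by (simp only: of_nat_le_iff)
  qed
qed

lemma eventually_gauss_tail_le:
  "\<forall>\<^sub>F k in sequentially. real (coeff_bound k) ^ (k\<^sup>2 + n) * exp (- (radius k * resonance_width k)\<^sup>2) \<le> 1"
proof -
  have "\<forall>\<^sub>F k in sequentially. (real n + 1) * (real k)\<^sup>2 * ((real k)\<^sup>2 + real n) \<le> 4 ^ k" by real_asymp
  then show ?thesis
  proof eventually_elim
    case (elim k)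
    have "real (coeff_bound k) ^ (k\<^sup>2 + n) = 2 ^ ((n + 1) * k\<^sup>2 * (k\<^sup>2 + n))"
      by (simp add: coeff_bound_def power_mult)
    also have "\<dots> \<le> exp 1 ^ ((n + 1) * k\<^sup>2 * (k\<^sup>2 + n))"
      using exp_ge_add_one_self[of 1] by (intro power_mono) auto
    also have "\<dots> = exp (real ((n + 1) * k\<^sup>2 * (k\<^sup>2 + n)))" by (simp only: exp_of_nat_mult[symmetric]) simp
    also have "\<dots> \<le> exp (4 ^ k)" using elim by (simp add: algebra_simps)
    also have "(4::real) ^ k = (radius k * resonance_width k)\<^sup>2"
      unfolding radius_resonance_width by (simp add: power2_eq_square flip: power_mult_distrib)
    finally show ?case by (simp add: exp_minus field_simps)
  qed
qed

definition admissible :: "nat \<Rightarrow> bool" where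
  "admissible k \<longleftrightarrow> 9 \<le> k \<and> 2 * k + n + 6 \<le> k ^ 4 \<and>
    net_error n (k\<^sup>2) (coeff_bound k) (net_fineness k) \<le> resonance_width k \<and>
    union_bound n (k\<^sup>2) (coeff_bound k) (net_fineness k) (tuple_length k) (resonance_width k) \<le> 1/4 \<and>
    16 * (k\<^sup>2 * coeff_bound k * (1 + n)) \<le> torus_cells k \<and>
    real (coeff_bound k) ^ (k\<^sup>2 + n) * exp (- (radius k * resonance_width k)\<^sup>2) \<le> 1"

lemma eventually_cells_exponent_le: "\<forall>\<^sub>F k in sequentially. 2 * k + n + 6 \<le> k ^ 4"
  using eventually_cubic_le_quartic[of 0 0 2 "n + 6"] by eventually_elim simp

lemma eventually_admissible: "\<forall>\<^sub>F k in sequentially. admissible k"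
  unfolding admissible_def
  by (intro eventually_conj eventually_ge_at_top eventually_cells_exponent_le eventually_net_error_le
      eventually_union_bound_le eventually_phase_error_le eventually_gauss_tail_le)

definition gain :: "nat \<Rightarrow> real" where
  "gain k = real (cells_per_side k) ^ (n - 1) /
     (2 ^ (k * (k\<^sup>2 + n)) * 4 ^ (k\<^sup>2 + n) * real (coeff_bound k) ^ (n + tuple_length k))"

lemma gain_nonneg: "0 \<le> gain k"
  by (simp add: gain_def)

definition log_gain :: "real \<Rightarrow> real" where
  "log_gain x = (real n - 1) * (x ^ 4 - (2 * x + real n + 6)) - x * (x\<^sup>2 + real n) - 2 * (x\<^sup>2 + real n)
     - (real n + 1) * x\<^sup>2 * (real n + 8 * real n * (real n + 1) * x)"

lemma gain_eq_powr:
  assumes "2 * k + n + 6 \<le> k ^ 4"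
  shows "gain k = 2 powr log_gain (real k)"
proof -
  have "real (cells_per_side k) ^ (n - 1) = 2 powr real ((k ^ 4 - (2 * k + n + 6)) * (n - 1))"
    by (subst powr_realpow)
      (simp_all only: cells_per_side_def of_nat_power of_nat_numeral power_mult zero_less_numeral)
  also have "real ((k ^ 4 - (2 * k + n + 6)) * (n - 1))
      = (real n - 1) * (real k ^ 4 - (2 * real k + real n + 6))"
    using assms n_ge_2 by (simp add: of_nat_diff)
  finally have cells: "real (cells_per_side k) ^ (n - 1)
      = 2 powr ((real n - 1) * (real k ^ 4 - (2 * real k + real n + 6)))" .
  have "real (coeff_bound k) ^ (n + tuple_length k) = 2 powr real ((n + 1) * k\<^sup>2 * (n + tuple_length k))"
    by (subst powr_realpow)
      (simp_all only: coeff_bound_def of_nat_power of_nat_numeral power_mult zero_less_numeral)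
  then have coefficients: "real (coeff_bound k) ^ (n + tuple_length k)
      = 2 powr ((real n + 1) * (real k)\<^sup>2 * (real n + 8 * real n * (real n + 1) * real k))"
    by (simp add: tuple_length_def algebra_simps)
  have "(4::real) ^ (k\<^sup>2 + n) = 2 ^ (2 * (k\<^sup>2 + n))" unfolding power_mult by simp
  also have "\<dots> = 2 powr (2 * ((real k)\<^sup>2 + real n))" by (simp add: powr_realpow[symmetric])
  finally have four: "(4::real) ^ (k\<^sup>2 + n) = 2 powr (2 * ((real k)\<^sup>2 + real n))" .
  have two: "(2::real) ^ (k * (k\<^sup>2 + n)) = 2 powr (real k * ((real k)\<^sup>2 + real n))"
    by (simp add: powr_realpow[symmetric])
  show ?thesis
    unfolding gain_def cells coefficients four two log_gain_def
    by (simp only: powr_diff powr_add) (simp add: field_simps)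
qed

lemma radius_Suc_powr:
  "radius (Suc k) powr s = 2 powr (s * ((real n + 1) * (real k + 1) ^ 4 + (real k + 1) ^ 3))"
proof -
  have "radius (Suc k) = 2 powr ((real n + 1) * (real k + 1) ^ 4 + (real k + 1) ^ 3)"
    unfolding radius_def by (subst powr_realpow[symmetric]) (simp_all add: algebra_simps)
  then show ?thesis by (simp add: powr_powr mult.commute)
qed

lemma eventually_log_radius_le_log_gain:
  fixes s c :: real
  assumes s: "s * (real n + 1) < real n - 1"
  shows "\<forall>\<^sub>F x in at_top. s * ((real n + 1) * (x + 1) ^ 4 + (x + 1) ^ 3) \<le> c + log_gain x"
proof -
  define D where "D = (real n - 1) - s * (real n + 1)"
  have D: "0 < D" using s by (simp add: D_def)
  have "\<forall>\<^sub>F x in at_top. s * ((real n + 1) * (4 * x ^ 3 + 6 * x\<^sup>2 + 4 * x + 1) + (x + 1) ^ 3) - c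
      + (real n - 1) * (2 * x + real n + 6) + x * (x\<^sup>2 + real n) + 2 * (x\<^sup>2 + real n)
      + (real n + 1) * x\<^sup>2 * (real n + 8 * real n * (real n + 1) * x) \<le> D * x ^ 4"
    using D by real_asymp
  then show ?thesis
    by eventually_elim
        (simp add: D_def log_gain_def algebra_simps power4_eq_xxxx power3_eq_cube power2_eq_square)
qed

lemma eventually_radius_powr_le_gain:
  fixes s c :: real
  assumes c: "0 < c" and s: "s * (real n + 1) < real n - 1"
  shows "\<forall>\<^sub>F k in sequentially. radius (Suc k) powr s \<le> c * gain k"
  using eventually_cells_exponent_le
    eventually_compose_filterlim[OF eventually_log_radius_le_log_gain[OF s, of "log 2 c"]
        filterlim_real_sequentially]
proof eventually_elim
  case (elim k)
  have "radius (Suc k) powr s \<le> 2 powr (log 2 c + log_gain (real k))"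
    unfolding radius_Suc_powr using elim(2) by (intro powr_mono) auto
  then show ?case using c by (simp add: powr_add gain_eq_powr[OF elim(1)])
qed

lemma eventually_exists_scale_powr_le_gain:
  assumes c: "0 < c" and \<epsilon>: "0 < \<epsilon>" and P: "eventually P sequentially"
  shows "\<forall>\<^sub>F R in at_top. \<exists>k. P k \<and> radius k \<le> R \<and> R powr ((real n - 1) / (real n + 1) - \<epsilon>) \<le> c * gain k"
proof -
  define s where "s = max 0 ((real n - 1) / (real n + 1) - \<epsilon>)"
  have "s < (real n - 1) / (real n + 1)" using \<epsilon> n_ge_2 by (simp add: s_def)
  then have "s * (real n + 1) < real n - 1" by (simp add: pos_less_divide_eq)
  from eventually_between_consecutive[OF filterlim_radius
      eventually_conj[OF P eventually_radius_powr_le_gain[OF c this]]]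
  show ?thesis
  proof eventually_elim
    case (elim R)
    then obtain k where k: "P k" "radius (Suc k) powr s \<le> c * gain k" "radius k \<le> R" "R < radius (Suc k)"
      by blast
    have "1 \<le> R" using parameters_positive(6)[of k] k(3) by linarith
    then have "R powr ((real n - 1) / (real n + 1) - \<epsilon>) \<le> R powr s" by (intro powr_mono) (auto simp: s_def)
    also have "\<dots> \<le> radius (Suc k) powr s" using \<open>1 \<le> R\<close> k(4) by (intro powr_mono2) (auto simp: s_def)
    finally show ?case using k by (intro exI[of _ k]) auto
  qed
qed

end

section \<open>The counterexample\<close>

context scales
begin

definition ratio_constant :: real where
  "ratio_constant = unit_ball_vol (real (n - 1)) * (1 / (512 * real n)) ^ (n - 1) / (640 * 4 ^ n)"

definition cap_radius :: "nat \<Rightarrow> real" where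
  "cap_radius k = 1 / (16 * radius k)"

definition cap_measure :: "nat \<Rightarrow> real" where
  "cap_measure k = unit_ball_vol (real (n - 1)) * (cap_radius k / (32 * real n)) ^ (n - 1)"

lemma ratio_constant_pos: "0 < ratio_constant"
  unfolding ratio_constant_def using n_ge_2 by simp

lemma cap_radius: "0 < cap_radius k" "cap_radius k \<le> 1/4" "radius k * cap_radius k = 1/16"
  using parameters_positive(6)[of k] by (auto simp: cap_radius_def field_simps)

lemma cap_measure_pos: "0 < cap_measure k"
  unfolding cap_measure_def using cap_radius(1)[of k] n_ge_2 by simp

lemma cap_measure_times_ball:
  "cap_measure k * (\<omega> * (radius k / 2) ^ n) = 640 * 2 ^ n * ratio_constant * \<omega> * radius k"
proof -
  have "radius k ^ n = radius k ^ (n - 1) * radius k" using n_ge_2 by (cases n) auto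
  then have "cap_measure k * (\<omega> * (radius k / 2) ^ n)
      = unit_ball_vol (real (n - 1)) * (cap_radius k / (32 * real n) * radius k) ^ (n - 1)
        * \<omega> * radius k / 2 ^ n"
    by (simp add: cap_measure_def power_divide power_mult_distrib)
  also have "cap_radius k / (32 * real n) * radius k = 1 / (512 * real n)"
    using cap_radius(3)[of k] n_ge_2 by (simp add: field_simps)
  also have "unit_ball_vol (real (n - 1)) * (1 / (512 * real n)) ^ (n - 1) = 640 * 4 ^ n * ratio_constant"
    by (simp add: ratio_constant_def)
  also have "(4::real) ^ n = 2 ^ n * 2 ^ n" by (simp flip: power_mult_distrib)
  finally show ?thesis by simp
qed

lemma ratio_bound:
  assumes k: "admissible k" and N: "cells_per_side k ^ (n - 1) \<le> 4 * N" and \<omega>: "0 \<le> \<omega>"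
  shows "ratio_constant * gain k * bohr_tube_bound (\<omega> * 2 ^ n) (k\<^sup>2 + n) (coeff_bound k)
      (coeff_bound k ^ (n + tuple_length k)) (radius k) (resonance_width k)
    \<le> real N * cap_measure k / 4 * (\<omega> * (radius k / 2) ^ n / real (torus_cells k) ^ (k\<^sup>2 + n))"
proof -
  define M where "M = k\<^sup>2 + n"
  define L where "L = real (coeff_bound k)"
  define D where "D = L ^ (n + tuple_length k)"
  define A where "A = 40 * (\<omega> * 2 ^ n) * ratio_constant * radius k"
  have L: "1 \<le> L" using parameters_positive(2)[of k] by (simp add: L_def)
  have D: "1 \<le> D" unfolding D_def using L by (rule one_le_power)
  have A: "0 \<le> A" using \<omega> ratio_constant_pos parameters_positive(6)[of k] by (simp add: A_def)
  have tail: "L ^ M * exp (- (radius k * resonance_width k)\<^sup>2) \<le> D"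
    using k D by (auto simp: admissible_def M_def L_def)
  have cells: "real (torus_cells k) ^ M = 2 ^ (k * M) * L ^ M"
    by (simp only: torus_cells_eq L_def power_mult_distrib power_mult)
  have "ratio_constant * gain k * (20 * (\<omega> * 2 ^ n) * radius k * 4 ^ M / L ^ M *
      (D + L ^ M * exp (- (radius k * resonance_width k)\<^sup>2)))
    \<le> ratio_constant * gain k * (20 * (\<omega> * 2 ^ n) * radius k * 4 ^ M / L ^ M * (D + D))"
    using tail \<omega> L ratio_constant_pos gain_nonneg[of k] parameters_positive(6)[of k]
    by (intro mult_left_mono add_left_mono) auto
  also have "\<dots> = A * real (cells_per_side k) ^ (n - 1) / real (torus_cells k) ^ M"
    unfolding gain_def M_def[symmetric] L_def[symmetric] D_def[symmetric] cells
    using D L by (simp add: A_def field_simps)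
  also have "\<dots> \<le> A * (4 * real N) / real (torus_cells k) ^ M"
    using A of_nat_mono[OF N, where 'a = real] by (intro divide_right_mono mult_left_mono) auto
  also have "\<dots> = real N / 4 * (640 * 2 ^ n * ratio_constant * \<omega> * radius k) / real (torus_cells k) ^ M"
    by (simp add: A_def)
  also have "\<dots> = real N * cap_measure k / 4 * (\<omega> * (radius k / 2) ^ n / real (torus_cells k) ^ M)"
    by (simp add: cap_measure_times_ball[symmetric])
  finally show ?thesis by (simp add: bohr_tube_bound_def M_def L_def D_def)
qed

end

locale scale_configurations = scales "DIM('a)" for e :: "'a::euclidean_space" +
  assumes e: "e \<in> Basis"
begin

definition configuration :: "nat \<Rightarrow> 'a set \<Rightarrow> (nat + 'a \<Rightarrow> 'a) \<Rightarrow> 'a \<Rightarrow> bool" where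
  "configuration k P u v \<longleftrightarrow> finite P \<and> cells_per_side k ^ (DIM('a) - 1) \<le> 4 * card P \<and>
    P \<subseteq> spherical_cell e (\<lambda>_. cell_offset k) (4 * bump_width k * real (cells_per_side k)) (shell_width k) \<and>
    (\<forall>p\<in>P. \<forall>p'\<in>P. p \<noteq> p' \<longrightarrow> 3 * bump_width k \<le> norm (p - p')) \<and>
    (\<forall>p\<in>P. p - v \<in> integer_combinations (progression_index (k\<^sup>2)) u
        (int (k\<^sup>2 * coeff_bound k * (1 + DIM('a))))) \<and>
    nonresonant (progression_index (k\<^sup>2)) (coeff_bound k) u (resonance_width k)
      (coeff_bound k ^ (DIM('a) + tuple_length k))"

lemma exists_configuration:
  assumes k: "admissible k"
  shows "\<exists>P u v. configuration k P u v"
proof -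
  have large: "9 \<le> k" "2 * k + DIM('a) + 6 \<le> k ^ 4" using k by (simp_all only: admissible_def)
  show ?thesis
    unfolding configuration_def
  proof (rule exists_nonresonant_points[OF n_ge_2 e parameters_positive(1,2) net_fineness_ge _ _
        parameters_positive(3,4)
        _ parameters_positive(5) cells_upper_le one_le_expected_hits])
    show "1 \<le> k" "9 \<le> k" "2 * k + DIM('a) + 6 \<le> k ^ 4" using large by simp_all
    show "shell_width k \<le> 1/4" using shell_width_le[OF large(2)] by simp
  qed (use k in \<open>simp_all only: admissible_def\<close>)
qed

lemma configuration_in_strip:
  assumes k: "admissible k" "configuration k P u v" and p: "p \<in> P" and b: "b \<in> Basis - {e}"
  shows "cell_offset k \<le> p \<bullet> b \<and> p \<bullet> b \<le> 5/4 * cell_offset k"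
proof -
  have "cell_offset k \<le> p \<bullet> b \<and> p \<bullet> b \<le> cell_offset k + 4 * bump_width k * real (cells_per_side k)"
    using k(2) p b by (auto simp: configuration_def spherical_cell_def)
  then show ?thesis using total_cell_width[of k] k(1) by (simp add: admissible_def)
qed

lemma configurations_far_apart:
  assumes k: "k < k'" and P: "admissible k" "configuration k P u v"
    and P': "admissible k'" "configuration k' P' u' v'"
    and p: "p \<in> P" "p' \<in> P'"
  shows "bump_width k \<le> norm (p - p') \<and> bump_width k' \<le> norm (p - p')"
proof -
  have "Basis - {e} \<noteq> {}" using n_ge_2 card_mono[of "{e}" "Basis :: 'a set"] by auto
  then obtain b where b: "b \<in> Basis - {e}" by blast
  have "3/8 * cell_offset k \<le> (p - p') \<bullet> b"
    using configuration_in_strip[OF P p(1) b] configuration_in_strip[OF P' p(2) b] cell_offset_le_half[OF k]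
    by (simp add: inner_diff_left)
  also have "\<dots> \<le> \<bar>(p - p') \<bullet> b\<bar>" by (rule abs_ge_self)
  also have "\<dots> \<le> norm (p - p')" using b by (intro Basis_le_norm) auto
  finally show ?thesis
    using bump_width_le_cell_offset[of k] bump_width_le_cell_offset[of k'] P(1) P'(1)
      cell_offset_le_half[OF k] parameters_positive(5)[of k] by (simp add: admissible_def)
qed

lemma exists_perturbed_sphere_through_configurations:
  assumes k: "\<And>k. admissible (k\<^sub>0 + k)" and P: "\<And>k. configuration (k\<^sub>0 + k) (P k) (u k) (v k)"
  shows "\<exists>\<psi> G H. perturbed_sphere \<psi> G H \<and> (\<forall>k. P k \<subseteq> perturbed_sphere.surf \<psi>)"
proof (rule exists_perturbed_sphere_through[where \<delta> = "\<lambda>k. bump_width (k\<^sub>0 + k)"])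
  show "finite (P k)" for k using P by (simp add: configuration_def)
  show "0 < bump_width (k\<^sub>0 + k)" for k by (rule parameters_positive)
  show "bump_width (k\<^sub>0 + k) \<le> 1" for k using k[of k] bump_width_le_1 by (simp add: admissible_def)
  show "2 * bump_width (k\<^sub>0 + k) \<le> norm (p - p')" if "p \<in> P k" "p' \<in> P k" "p \<noteq> p'" for k p p'
  proof -
    have "3 * bump_width (k\<^sub>0 + k) \<le> norm (p - p')" using P[of k] that by (simp add: configuration_def)
    then show ?thesis using parameters_positive(3)[of "k\<^sub>0 + k"] by linarith
  qed
  show "bump_width (k\<^sub>0 + k') \<le> norm (p - p')" if "k \<noteq> k'" "p \<in> P k" "p' \<in> P k'" for k k' p p'
  proof (cases "k < k'")
    case True
    then show ?thesis using configurations_far_apart[OF _ k P k P that(2,3)] by simp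
  next
    case False
    then have "k\<^sub>0 + k' < k\<^sub>0 + k" using that(1) by simp
    then show ?thesis
      using configurations_far_apart[OF _ k P k P that(3,2)] by (simp add: norm_minus_commute)
  qed
  show "\<bar>1 - p \<bullet> p\<bar> \<le> (1/2) ^ k * (bump_width (k\<^sub>0 + k))\<^sup>2 / 120" if "p \<in> P k" for k p
  proof -
    have "\<bar>1 - p \<bullet> p\<bar> \<le> shell_width (k\<^sub>0 + k)"
      using P[of k] that by (auto simp: configuration_def spherical_cell_def abs_le_iff)
    also have "\<dots> \<le> (1/2) ^ k * (bump_width (k\<^sub>0 + k))\<^sup>2 / 120"
      unfolding shell_width_def by (intro divide_right_mono mult_right_mono power_decreasing) auto
    finally show ?thesis .
  qed
qed

lemma configuration_card_pos: "configuration k P u v \<Longrightarrow> 0 < card P"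
proof -
  assume "configuration k P u v"
  then have "cells_per_side k ^ (DIM('a) - 1) \<le> 4 * card P" by (simp only: configuration_def)
  moreover have "0 < cells_per_side k ^ (DIM('a) - 1)" using parameters_positive(8)[of k] by simp
  ultimately show ?thesis by linarith
qed

lemma configuration_axis_ge:
  assumes k: "admissible k" and P: "configuration k P u v" and p: "p \<in> P"
  shows "3/4 \<le> p \<bullet> e"
proof (rule spherical_cell_axis_ge[OF e])
  have "2 * k + DIM('a) + 6 \<le> k ^ 4" using k by (simp add: admissible_def)
  then show "shell_width k \<le> 1/16"
    "cell_offset k + 4 * bump_width k * real (cells_per_side k) \<le> 1 / (2 * real DIM('a))"
    by (rule shell_width_le cells_upper_le)+
  show "0 \<le> cell_offset k" using parameters_positive(5)[of k] by simp
  show "p \<in> spherical_cell e (\<lambda>_. cell_offset k)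
      (4 * bump_width k * real (cells_per_side k)) (shell_width k)"
    using P p by (auto simp: configuration_def)
qed

lemma weighted_ratio_ge_of_configuration:
  assumes "perturbed_sphere \<psi> G H" and k: "admissible k" and P: "configuration k P u v"
    and surf: "P \<subseteq> perturbed_sphere.surf \<psi>" and R: "radius k \<le> R"
  shows "weighted_ratio_ge (perturbed_sphere.surf \<psi>) R (ratio_constant * gain k)"
proof -
  interpret perturbed_sphere \<psi> G H by fact
  let ?J = "progression_index (k\<^sup>2) :: (nat + 'a) set"
  show ?thesis
  proof (rule weighted_ratio_ge_of_nonresonant_points[OF hausdorff_surf_finite, where P = P and J = ?J
        and r = "cap_radius k" and \<kappa> = "cap_measure k" and R = "radius k" and N = "torus_cells k"])
    show "ennreal (cap_measure k) \<le> hausdorff_outer (real (DIM('a) - 1)) (surf \<inter> ball p (cap_radius k))"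
      if "p \<in> P" for p
      unfolding cap_measure_def
      using surf configuration_axis_ge[OF k P] that e n_ge_2 cap_radius by (intro hausdorff_outer_cap_ge) auto
    show "2 * cap_radius k \<le> norm (p - p')" if "p \<in> P" "p' \<in> P" "p \<noteq> p'" for p p'
    proof -
      have "2 * cap_radius k \<le> 3 * bump_width k"
        using one_le_radius_bump_width[of k] parameters_positive(6)[of k]
        by (simp add: cap_radius_def field_simps)
      also have "\<dots> \<le> norm (p - p')" using P that by (simp add: configuration_def)
      finally show ?thesis .
    qed
    show "p - v \<in> integer_combinations ?J u (int (k\<^sup>2 * coeff_bound k * (1 + DIM('a))))" if "p \<in> P" for p
      using P that by (simp only: configuration_def)
    show "16 * real_of_int (int (k\<^sup>2 * coeff_bound k * (1 + DIM('a)))) \<le> real (torus_cells k)"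
      using k by (simp only: admissible_def flip: of_nat_le_iff[where 'a = real]) simp
    show "nonresonant ?J (coeff_bound k) u (resonance_width k) (coeff_bound k ^ (DIM('a) + tuple_length k))"
      using P by (simp only: configuration_def)
    show "6 * coeff_bound k \<le> torus_cells k"
      using k by (intro coeff_bound_le_torus_cells) (simp add: admissible_def)
    show "ratio_constant * gain k * bohr_tube_bound (measure lborel (ball (0::'a) 2)) (card ?J) (coeff_bound k)
        (coeff_bound k ^ (DIM('a) + tuple_length k)) (radius k) (resonance_width k)
      \<le> real (card P) * cap_measure k / 4 *
          (measure lborel (ball (0::'a) (radius k / 2)) / real (torus_cells k) ^ card ?J)"
      using ratio_bound[OF k, of "card P" "unit_ball_vol (real DIM('a))"] P parameters_positive(6)[of k]
      by (simp add: content_ball card_progression_index configuration_def)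
  qed (use P configuration_card_pos[OF P] cap_radius[of k] cap_measure_pos[of k] parameters_positive[of k]
      ratio_constant_pos gain_nonneg[of k] R in \<open>auto simp: configuration_def finite_progression_index\<close>)
qed

lemma exists_surface_with_large_ratios:
  "\<exists>\<Sigma> :: 'a set. strictly_convex_compact_C2_hypersurface \<Sigma> \<and>
    (\<forall>\<^sub>F k in sequentially. \<forall>R\<ge>radius k. weighted_ratio_ge \<Sigma> R (ratio_constant * gain k))"
proof -
  obtain k\<^sub>0 where k\<^sub>0: "\<And>k. k\<^sub>0 \<le> k \<Longrightarrow> admissible k"
    using eventually_admissible by (auto simp: eventually_sequentially)
  then have admissible: "admissible (k\<^sub>0 + k)" for k by simp
  have "\<forall>k. \<exists>P u v. configuration (k\<^sub>0 + k) P u v" using exists_configuration[OF admissible] by blast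
  then obtain P u v where P: "\<And>k. configuration (k\<^sub>0 + k) (P k) (u k) (v k)" by metis
  obtain \<psi> G H where \<psi>: "perturbed_sphere \<psi> G H" and surf: "\<And>k. P k \<subseteq> perturbed_sphere.surf \<psi>"
    using exists_perturbed_sphere_through_configurations[OF admissible P] by blast
  have "weighted_ratio_ge (perturbed_sphere.surf \<psi>) R (ratio_constant * gain (k\<^sub>0 + k))"
    if "radius (k\<^sub>0 + k) \<le> R" for k R
    by (rule weighted_ratio_ge_of_configuration[OF \<psi> admissible P surf that])
  then have "\<forall>\<^sub>F k in sequentially. \<forall>R\<ge>radius k.
      weighted_ratio_ge (perturbed_sphere.surf \<psi>) R (ratio_constant * gain k)"
    unfolding eventually_sequentially by (metis le_iff_add)
  then show ?thesis using perturbed_sphere.strictly_convex_surf[OF \<psi>] by blast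
qed

end

theorem corollary5p2:
  assumes "DIM('a::euclidean_space) \<ge> 2"
  shows "\<exists>\<Sigma> :: 'a set. strictly_convex_compact_C2_hypersurface \<Sigma> \<and>
    (\<forall>\<epsilon>>0. \<exists>R0. \<forall>R\<ge>R0. R > 0 \<longrightarrow>
      (\<exists>(f :: 'a \<Rightarrow> complex) (w :: 'a \<Rightarrow> real).
         L2_on (surface_measure \<Sigma>) f \<and> L2_norm_sq (surface_measure \<Sigma>) f > 0 \<and>
         w \<in> borel_measurable lborel \<and> (\<forall>x. 0 \<le> w x \<and> w x \<le> 1) \<and>
         (\<forall>x. w x \<noteq> 0 \<longrightarrow> x \<in> ball 0 R) \<and> MT_norm w > 0 \<and>
         (LINT x:ball 0 R|lborel. (cmod (extension_op \<Sigma> f x))\<^sup>2 * w x)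
           \<ge> R powr ((real DIM('a) - 1) / (real DIM('a) + 1) - \<epsilon>)
              * L2_norm_sq (surface_measure \<Sigma>) f * MT_norm w))"
proof -
  obtain e :: 'a where "e \<in> Basis" using nonempty_Basis by blast
  then interpret scale_configurations e by unfold_locales (use assms in auto)
  obtain \<Sigma> :: "'a set" where \<Sigma>: "strictly_convex_compact_C2_hypersurface \<Sigma>"
    and ratio: "\<forall>\<^sub>F k in sequentially. \<forall>R\<ge>radius k. weighted_ratio_ge \<Sigma> R (ratio_constant * gain k)"
    using exists_surface_with_large_ratios by blast
  have "\<exists>R0. \<forall>R\<ge>R0. weighted_ratio_ge \<Sigma> R (R powr ((real DIM('a) - 1) / (real DIM('a) + 1) - \<epsilon>))"
    if "0 < \<epsilon>" for \<epsilon>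
    using eventually_exists_scale_powr_le_gain[OF ratio_constant_pos that ratio] weighted_ratio_ge_mono
    unfolding eventually_at_top_linorder by meson
  then show ?thesis unfolding weighted_ratio_ge_def[symmetric] using \<Sigma> by blast
qed

end
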